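(* Let $\ell\in\mathbb{N}$ (the case $\ell=0$ included) and for $T>0$ set $$Z^{(\ell)}(T):=\max_{t\in[T,2T]}\big|\zeta^{(\ell)}(1+{\rm i}t)\big|,$$ where $\zeta^{(\ell)}$ is the $\ell$-th derivative of the Riemann zeta function. Then, as $T\to\infty$ and for $\ell\leqslant (\log T)/(\log_2 T)$, $$Z^{(\ell)}(T)\geqslant \frac{{\rm e}^{\gamma}}{\ell+1}(\log_2 T)^{\ell+1}\{1+o(1)\},$$ where $o(1)$ denotes a quantity tending to $0$ as $T\to\infty$.
   Context: $\gamma$ denotes the Euler constant, and $\log_j$ denotes the $j$-th iterated logarithm (so $\log_2 T=\log\log T$). *)

theory Defs
  imports "HOL-Complex_Analysis.Complex_Analysis"
begin

text \<open>
  \<open>zeta_continuation a f\<close>: the function \<open>f\<close> continues the Dirichlet series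
  \<open>\<Sum>\<^sub>n n powr -s\<close> (over \<open>n \<ge> 1\<close>) holomorphically to the half-plane \<open>Re s > a\<close> punctured at \<open>1\<close>.
\<close>

definition zeta_continuation :: "real \<Rightarrow> (complex \<Rightarrow> complex) \<Rightarrow> bool" where
  "zeta_continuation a f \<longleftrightarrow>
     f holomorphic_on {s. Re s > a} - {1} \<and>
     (\<forall>s. Re s > 1 \<longrightarrow> (\<lambda>n. of_nat (Suc n) powr (- s)) sums f s)"

text \<open>
  The Riemann zeta function is the analytic continuation of its Dirichlet series. Its value at \<open>s\<close>
  is read off from a continuation to any punctured half-plane containing \<open>s\<close>; as these domains
  are connected and nested, the choice does not matter (\<open>zeta_eq\<close>). Hence this is the usual
  zeta function on all of \<open>\<complex> - {1}\<close>; the value at the pole \<open>1\<close> is immaterial.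
\<close>

definition zeta :: "complex \<Rightarrow> complex" where
  "zeta s = (THE w. \<exists>a f. a < Re s \<and> zeta_continuation a f \<and> w = f s)"

text \<open>
  A literal maximum rather than a supremum; it exists for \<open>T > 0\<close> because the derivatives of
  \<open>zeta\<close> are continuous away from \<open>1\<close>.
\<close>

definition zeta_max :: "nat \<Rightarrow> real \<Rightarrow> real" where
  "zeta_max l T = (GREATEST y. y \<in> (\<lambda>t. norm ((deriv ^^ l) zeta (Complex 1 t))) ` {T..2*T})"


text \<open>The continuation is unique, and one exists on a domain containing the punctured line \<open>Re s = 1\<close>.\<close>

lemma zeta_continuation_unique:
  assumes "zeta_continuation a f" "zeta_continuation b g" "a < Re s" "b < Re s" "s \<noteq> 1"
  shows "f s = g s"
proof -
  let ?H = "{s. Re s > max a b} - {1::complex}"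
  let ?U = "{s. Re s > max 1 (max a b)} :: complex set"
  have op: "open {s. Re s > c}" for c
    by (rule open_halfspace_Re_gt)
  have "connected ?H"
    by (intro connected_open_delete op convex_connected convex_halfspace_Re_gt) simp
  moreover have "complex_of_real (2 + \<bar>a\<bar> + \<bar>b\<bar>) \<in> ?U"
    by (simp add: abs_real_def)
  hence "?U \<noteq> {}"
    by blast
  moreover have "f z = g z" if "z \<in> ?U" for z
  proof -
    have "(\<lambda>n. of_nat (Suc n) powr (- z)) sums f z" "(\<lambda>n. of_nat (Suc n) powr (- z)) sums g z"
      using that assms(1,2) unfolding zeta_continuation_def by simp_all
    thus ?thesis
      by (rule sums_unique2)
  qed
  moreover have "f holomorphic_on ?H"
    by (rule holomorphic_on_subset[of f "{s. Re s > a} - {1}"])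
       (use assms(1) in \<open>auto simp: zeta_continuation_def\<close>)
  moreover have "g holomorphic_on ?H"
    by (rule holomorphic_on_subset[of g "{s. Re s > b} - {1}"])
       (use assms(2) in \<open>auto simp: zeta_continuation_def\<close>)
  moreover have "open ?H"
    by (intro open_delete op)
  moreover have "?U \<subseteq> ?H" "s \<in> ?H"
    using assms(3-5) by auto
  ultimately show ?thesis
    using analytic_continuation_open[of ?U ?H f g s] op by blast
qed

lemma zeta_eq:
  assumes "zeta_continuation a f" "a < Re s" "s \<noteq> 1"
  shows "zeta s = f s"
proof -
  have "w = f s" if "\<exists>b g. b < Re s \<and> zeta_continuation b g \<and> w = g s" for w
    using that zeta_continuation_unique[OF _ assms(1) _ assms(2,3)] by auto
  moreover have "\<exists>b g. b < Re s \<and> zeta_continuation b g \<and> f s = g s"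
    using assms by auto
  ultimately show ?thesis
    unfolding zeta_def by (rule the_equality[rotated])
qed

lemma zeta_term_bound:
  fixes s :: complex and m :: real
  assumes s: "s \<noteq> 1" "Re s > 0" and m: "m > 0"
  shows "norm (of_real m powr (- s)
            - (of_real (m + 1) powr (1 - s) - of_real m powr (1 - s)) / (1 - s))
         \<le> norm s * m powr (- Re s - 1)"
proof -
  let ?B = "norm s * m powr (- Re s - 1)"
  let ?S = "closed_segment (complex_of_real m) (complex_of_real (m + 1))"
  have seg: "\<exists>x. z = of_real x \<and> m \<le> x \<and> x \<le> m + 1" if "z \<in> ?S" for z
    using that unfolding closed_segment_of_real
    by (auto simp: closed_segment_eq_real_ivl simp del: of_real_add)
  have nonpos: "z \<notin> \<real>\<^sub>\<le>\<^sub>0" if "z \<in> ?S" for z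
    using seg[OF that] m by auto
  have step1: "norm (z powr (- s) - of_real m powr (- s)) \<le> ?B" if z: "z \<in> ?S" for z
  proof -
    have "norm (z powr (- s) - of_real m powr (- s)) \<le> ?B * norm (z - of_real m)"
    proof (rule field_differentiable_bound[of ?S _ "\<lambda>z. - s * z powr (- s - 1)"])
      fix w assume w: "w \<in> ?S"
      show "((\<lambda>z. z powr (- s)) has_field_derivative - s * w powr (- s - 1)) (at w within ?S)"
        using has_field_derivative_powr[OF nonpos[OF w]] has_field_derivative_at_within by blast
      obtain x where x: "w = of_real x" "m \<le> x"
        using seg[OF w] by blast
      have "x powr (- Re s - 1) \<le> m powr (- Re s - 1)"
        using x m s by (intro powr_mono2') auto
      thus "norm (- s * w powr (- s - 1)) \<le> ?B"
        using x m by (simp add: norm_mult norm_powr_real_powr mult_left_mono)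
    qed (use z in auto)
    also have "norm (z - of_real m) \<le> 1"
    proof -
      obtain x where x: "z = of_real x" "m \<le> x" "x \<le> m + 1"
        using seg[OF z] by blast
      have "norm (z - of_real m) = \<bar>x - m\<bar>"
        using x(1) by (metis norm_of_real of_real_diff)
      thus ?thesis using x by simp
    qed
    hence "?B * norm (z - of_real m) \<le> ?B"
      by (intro mult_left_le) auto
    finally show ?thesis .
  qed
  let ?\<phi> = "\<lambda>z. z powr (1 - s) / (1 - s) - z * of_real m powr (- s)"
  have "norm (?\<phi> (of_real (m + 1)) - ?\<phi> (of_real m))
          \<le> ?B * norm (complex_of_real (m + 1) - of_real m)"
  proof (rule field_differentiable_bound[of ?S _ "\<lambda>z. z powr (- s) - of_real m powr (- s)"])
    fix w assume w: "w \<in> ?S"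
    have "((\<lambda>z. z powr (1 - s)) has_field_derivative (1 - s) * w powr (- s)) (at w within ?S)"
      using has_field_derivative_at_within[OF has_field_derivative_powr[OF nonpos[OF w], of "1 - s"]]
      by simp
    from DERIV_cdivide[OF this, of "1 - s"] s
    have "((\<lambda>z. z powr (1 - s) / (1 - s)) has_field_derivative w powr (- s)) (at w within ?S)"
      by simp
    from DERIV_diff[OF this DERIV_cmult_right[OF DERIV_ident, of "of_real m powr (- s)"]]
    show "(?\<phi> has_field_derivative w powr (- s) - of_real m powr (- s)) (at w within ?S)"
      by simp
  qed (use step1 in auto)
  also have "?\<phi> (of_real (m + 1)) - ?\<phi> (of_real m)
      = - (of_real m powr (- s) - (of_real (m + 1) powr (1 - s) - of_real m powr (1 - s)) / (1 - s))"
    by (simp add: diff_divide_distrib algebra_simps)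
  finally show ?thesis
    by (simp add: norm_minus_commute)
qed

lemma zeta_continuation_exists: "\<exists>f. zeta_continuation 0 f"
proof -
  define g where "g = (\<lambda>(n::nat) (s::complex). of_real (real n + 1) powr (- s)
    - (of_real (real n + 1 + 1) powr (1 - s) - of_real (real n + 1) powr (1 - s)) / (1 - s))"
  define F where "F = (\<lambda>s. 1 / (s - 1) + (\<Sum>n. g n s))"
  let ?D = "{s. Re s > 0} - {1::complex}"
  have D: "open ?D"
    by (intro open_delete open_halfspace_Re_gt)
  have bound: "norm (g n s) \<le> norm s * (real n + 1) powr (- Re s - 1)" if "s \<in> ?D" for n s
    using zeta_term_bound[of s "real n + 1"] that unfolding g_def by auto
  have summ: "summable (\<lambda>n. (real n + 1) powr a)" if "a < -1" for a
    using that summable_real_powr_iff[of a] summable_Suc_iff[of "\<lambda>n. real n powr a"]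
    by (simp add: add.commute)
  have "(\<lambda>s. \<Sum>n. g n s) holomorphic_on ?D"
  proof (rule holomorphic_uniform_sequence[OF D])
    show "(\<lambda>s. \<Sum>i<n. g i s) holomorphic_on ?D" for n
      unfolding g_def by (intro holomorphic_intros) (auto simp: complex_eq_iff)
  next
    fix z assume z: "z \<in> ?D"
    then obtain d where d: "d > 0" "cball z d \<subseteq> ?D"
      using D open_contains_cball by blast
    define r where "r = min d (Re z / 2)"
    have r: "r > 0" "cball z r \<subseteq> ?D"
      using d z by (auto simp: r_def)
    have "uniform_limit (cball z r) (\<lambda>n s. \<Sum>i<n. g i s) (\<lambda>s. \<Sum>n. g n s) sequentially"
    proof (rule Weierstrass_m_test)
      fix n w assume w: "w \<in> cball z r"
      have "norm (z - w) \<le> r"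
        using w by (simp add: dist_norm)
      moreover have "\<bar>Re (z - w)\<bar> \<le> norm (z - w)"
        by (rule abs_Re_le_cmod)
      moreover have "norm w \<le> norm z + norm (z - w)"
        by (metis norm_minus_commute norm_triangle_sub)
      ultimately have w': "Re w \<ge> Re z / 2" "norm w \<le> norm z + r"
        by (auto simp: r_def)
      have "norm (g n w) \<le> norm w * (real n + 1) powr (- Re w - 1)"
        using bound r w by blast
      also have "\<dots> \<le> (norm z + r) * (real n + 1) powr (- (Re z / 2) - 1)"
        using w' r by (intro mult_mono powr_mono) auto
      finally show "norm (g n w) \<le> (norm z + r) * (real n + 1) powr (- (Re z / 2) - 1)" .
    next
      show "summable (\<lambda>n. (norm z + r) * (real n + 1) powr (- (Re z / 2) - 1))"
        using z by (intro summable_mult summ) auto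
    qed
    thus "\<exists>d>0. cball z d \<subseteq> ?D \<and>
        uniform_limit (cball z d) (\<lambda>n s. \<Sum>i<n. g i s) (\<lambda>s. \<Sum>n. g n s) sequentially"
      using r by blast
  qed
  hence "F holomorphic_on ?D"
    unfolding F_def by (intro holomorphic_intros) auto
  moreover have "(\<lambda>n. of_nat (Suc n) powr (- s)) sums F s" if s: "Re s > 1" for s
  proof -
    have ne: "s \<noteq> 1" using s by auto
    have "(\<lambda>n. complex_of_nat (Suc n) powr (1 - s)) \<longlonglongrightarrow> 0"
      using s by (intro tendsto_neg_powr_complex_of_nat filterlim_Suc) auto
    from telescope_sums[OF this]
    have "(\<lambda>n. (of_nat (Suc (Suc n)) powr (1 - s) - of_nat (Suc n) powr (1 - s)) / (1 - s))
            sums ((0 - 1) / (1 - s))"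
      by (intro sums_divide) simp
    moreover have "summable (\<lambda>n. g n s)"
    proof (rule summable_comparison_test')
      show "summable (\<lambda>n. norm s * (real n + 1) powr (- Re s - 1))"
        using s by (intro summable_mult summ) auto
    qed (use bound s ne in auto)
    hence "(\<lambda>n. g n s) sums (\<Sum>n. g n s)"
      by (rule summable_sums)
    ultimately have "(\<lambda>n. (of_nat (Suc (Suc n)) powr (1 - s) - of_nat (Suc n) powr (1 - s)) / (1 - s)
        + g n s) sums ((0 - 1) / (1 - s) + (\<Sum>n. g n s))"
      by (rule sums_add)
    also have "(0 - 1) / (1 - s) = 1 / (s - 1)"
      using ne by (simp add: field_simps)
    finally show ?thesis
      by (simp add: g_def F_def add_ac)
  qed
  ultimately show ?thesis
    unfolding zeta_continuation_def by blast
qed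

end

theory Submission
  imports Defs "HOL-Real_Asymp.Real_Asymp"
begin

text \<open>
  The resonance method with a resonator supported on a box of smooth numbers. Let
  \<open>B = {\<Prod>\<^bsub>p \<le> y\<^esub> p^b\<^sub>p | b\<^sub>p \<le> K}\<close> with \<open>y = e^k\<close>, \<open>K = k\<^sup>3\<close> and \<open>k\<close> slightly smaller than
  \<open>log\<^sub>2 T\<close>, so that all elements of \<open>B\<close> are \<open>T^{o(1)}\<close>. Weighting \<open>\<zeta>^{(\<ell>)}(1 + it)\<close> by
  \<open>|\<Sum>\<^bsub>m \<in> B\<^esub> m^{it}|\<^sup>2\<close> and averaging over \<open>[T, 2T]\<close> isolates the terms \<open>m = m'n\<close>, and for
  \<open>y\<close>-smooth \<open>n \<le> e^{k\<^sup>2}\<close> almost all \<open>m' \<in> B\<close> satisfy \<open>m'n \<in> B\<close>. Hence the maximum is at least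
  \<open>(1 - o(1)) \<Sum> (log n)^\<ell>/n\<close> over these \<open>n\<close>. For \<open>\<ell> = 0\<close> this sum is \<open>\<sim> e^\<gamma> k\<close> by Mertens'
  third theorem. With respect to the weights \<open>1/n\<close> the second moment of \<open>log n\<close> exceeds
  \<open>(1.1 k)\<^sup>2\<close>, so Jensen's inequality yields more than required for \<open>\<ell> \<ge> 2\<close>, uniformly in \<open>\<ell>\<close>.
  The bound \<open>\<ell> \<le> log T / log\<^sub>2 T\<close>, i.e. \<open>(log T)^\<ell> \<le> T\<close>, controls the error made by truncating
  the Dirichlet series at \<open>T\<^sup>4\<close>.
\<close>

section \<open>Smooth numbers\<close>

text \<open>The scales are tied together as follows. If \<open>ln n <= k^2\<close>, then
  \<open>n\<close> has at most \<open>2 k^2\<close> prime factors with multiplicity, so allowing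
  exponents up to \<open>k^3\<close> loses only a proportion \<open>2/k\<close> of the box. The
  largest element of the box has logarithm at most \<open>2 k^3 e^k\<close>, which stays below
  \<open>ln T / 10\<close> if \<open>k\<close> is about \<open>ln L - free\<close>, namely
  \<open>L - 4 ln L\<close> with \<open>L = ln (ln T)\<close>. The cutoff \<open>e^(k^2)\<close> is
  harmless because the mean of \<open>ln n\<close> under the weights \<open>1/n\<close> is at most
  \<open>k + 6\<close>. The obstacle is uniformity in \<open>l\<close>: replacing \<open>L\<close>
  by \<open>k\<close> would cost a factor \<open>(k/L)^l\<close>, which is not
  \<open>1 + o(1)\<close> for large \<open>l\<close>. For \<open>l >= 2\<close> the room in the
  second moment pays for it, since \<open>(1.1 k)^l >= L^l\<close>. For \<open>l = 1\<close> a mean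
  near \<open>k\<close> is compared with about \<open>k/2\<close>. Only \<open>l = 0\<close> needs
  the sharp constant. Averages run over a finite arithmetic grid instead of an integral, so only
  geometric sums occur.\<close>

definition smooths :: "nat set \<Rightarrow> real \<Rightarrow> nat set" where
  "smooths P x = {n. 0 < n \<and> real n \<le> x \<and> prime_factors n \<subseteq> P}"

definition log_moment :: "nat \<Rightarrow> nat set \<Rightarrow> real \<Rightarrow> real" where
  "log_moment l P x = (\<Sum>n\<in>smooths P x. ln (real n) ^ l / real n)"

definition exponent_box :: "nat set \<Rightarrow> nat \<Rightarrow> nat set" where
  "exponent_box P J = {n. 0 < n \<and> prime_factors n \<subseteq> P \<and> (\<forall>p\<in>P. multiplicity p n \<le> J)}"

lemma finite_smooths [simp]: "finite (smooths P x)"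
proof (rule finite_subset)
  show "smooths P x \<subseteq> {..nat \<lfloor>x\<rfloor>}"
    by (auto simp: smooths_def le_nat_iff le_floor_iff)
qed simp

lemma smooths_mono: "x \<le> y \<Longrightarrow> smooths P x \<subseteq> smooths P y"
  by (auto simp: smooths_def)

lemma log_moment_nonneg: "log_moment l P x \<ge> 0"
  unfolding log_moment_def by (intro sum_nonneg) (auto simp: smooths_def)

lemma log_moment_mono: "x \<le> y \<Longrightarrow> log_moment l P x \<le> log_moment l P y"
  unfolding log_moment_def
  by (intro sum_mono2 smooths_mono finite_smooths) (auto simp: smooths_def)

text \<open>Tangent inequality for \<open>x \<mapsto> x^{l/2}\<close> at \<open>1\<close>, \<open>x = v\<^sup>2\<close>, without fractional powers.\<close>

lemma bernoulli_half:
  fixes v :: real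
  assumes "v \<ge> 0"
  shows "1 + real (n + 2) / 2 * (v^2 - 1) \<le> v ^ (n + 2)"
proof (induction n)
  case 0
  show ?case by (simp add: power2_eq_square)
next
  case (Suc n)
  \<comment> \<open>\<open>v\<close> times the old bound minus the new one. Both have value 1 and
    equal derivatives at \<open>v = 1\<close>, hence the double zero.\<close>
  have "0 \<le> (v - 1)^2 * ((v + 1) * real (n + 2) - 1) / 2"
    using assms by (intro divide_nonneg_pos mult_nonneg_nonneg) (auto simp: algebra_simps)
  also have "\<dots> = v * (1 + real (n + 2) / 2 * (v^2 - 1)) - (1 + real (Suc n + 2) / 2 * (v^2 - 1))"
    by (simp add: field_simps power2_eq_square)
  also have "v * (1 + real (n + 2) / 2 * (v^2 - 1)) \<le> v * v ^ (n + 2)"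
    by (intro mult_left_mono Suc.IH assms)
  finally show ?case by simp
qed

text \<open>Jensen's inequality for \<open>x^(l/2)\<close>: the tangent inequality at
  \<open>v = ln m / a\<close> is summed with weights \<open>1/m\<close>. By the assumption on the
  second moment the linear part of the tangent has a nonnegative sum, so the constant part is a
  lower bound.\<close>

lemma log_moment_jensen:
  assumes "a > 0" "a^2 * log_moment 0 P x \<le> log_moment 2 P x" "l \<ge> 2"
  shows "a ^ l * log_moment 0 P x \<le> log_moment l P x"
proof -
  obtain n where l: "l = n + 2"
    using assms(3) by (metis add.commute le_Suc_ex)
  have "a ^ l * log_moment 0 P x
        \<le> a ^ l * log_moment 0 P x + a ^ l * (real l / 2 / a^2) * (log_moment 2 P x - a^2 * log_moment 0 P x)"
    using assms by (intro le_add_same_cancel1[THEN iffD2] mult_nonneg_nonneg) auto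
  also have "\<dots> = (\<Sum>m\<in>smooths P x. a ^ l * (1 + real l / 2 * ((ln m / a)^2 - 1)) / m)"
  proof -
    have "a ^ l * (1 + real l / 2 * ((ln m / a)^2 - 1)) / m
          = a ^ l * (ln m ^ 0 / m) + a ^ l * (real l / 2 / a^2) * (ln m ^ 2 / m - a^2 * (ln m ^ 0 / m))" for m :: nat
      using assms(1) by (cases "m = 0") (simp_all add: field_simps)
    thus ?thesis
      unfolding log_moment_def by (simp only: sum.distrib sum_distrib_left sum_subtractf right_diff_distrib)
  qed
  also have "\<dots> \<le> (\<Sum>m\<in>smooths P x. ln m ^ l / m)"
  proof (intro sum_mono divide_right_mono)
    fix m assume m: "m \<in> smooths P x"
    have "a ^ l * (1 + real l / 2 * ((ln m / a)^2 - 1)) \<le> a ^ l * (ln m / a) ^ l"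
      unfolding l using assms(1) m by (intro mult_left_mono bernoulli_half) (auto simp: smooths_def)
    also have "\<dots> = ln m ^ l"
      using assms(1) by (simp add: power_divide)
    finally show "a ^ l * (1 + real l / 2 * ((ln m / a)^2 - 1)) \<le> ln m ^ l" .
  qed simp
  finally show ?thesis unfolding log_moment_def .
qed

locale prime_set =
  fixes P :: "nat set"
  assumes finite_P: "finite P" and prime_P: "p \<in> P \<Longrightarrow> prime p"
begin

lemma P_ge_2: "p \<in> P \<Longrightarrow> p \<ge> 2"
  using prime_P prime_ge_2_nat by blast

text \<open>The identity \<open>ln n = sum of Lambda(d) over d dvd n\<close>. The exponent range is
  bounded by a common \<open>X\<close>, not by \<open>n\<close>, so that sums over \<open>n\<close>
  can be interchanged with it.\<close>

lemma ln_eq_sum_prime_powers: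
  assumes "n > 0" "prime_factors n \<subseteq> P" "n \<le> X"
  shows "ln (real n) = (\<Sum>p\<in>P. \<Sum>k=1..X. if p ^ k dvd n then ln (real p) else 0)"
proof -
  have "ln (real n) = ln (real (\<Prod>p\<in>prime_factors n. p ^ multiplicity p n))"
    using prime_factorization_nat[OF assms(1)] by simp
  also have "\<dots> = (\<Sum>p\<in>prime_factors n. real (multiplicity p n) * ln (real p))"
    by (subst of_nat_prod, subst ln_prod)
       (auto simp: in_prime_factors_iff prime_gt_0_nat ln_realpow intro!: sum.cong)
  also have "\<dots> = (\<Sum>p\<in>P. real (multiplicity p n) * ln (real p))"
    using assms prime_P finite_P
    by (intro sum.mono_neutral_left) (auto simp: prime_factors_multiplicity)
  also have "\<dots> = (\<Sum>p\<in>P. \<Sum>k=1..X. if p ^ k dvd n then ln (real p) else 0)"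
  proof (rule sum.cong[OF refl])
    fix p assume p: "p \<in> P"
    have dvd: "p ^ k dvd n \<longleftrightarrow> k \<le> multiplicity p n" for k
      using assms(1) P_ge_2[OF p] by (intro power_dvd_iff_le_multiplicity) auto
    have "multiplicity p n < 2 ^ multiplicity p n"
      by (rule less_exp)
    also have "(2::nat) ^ multiplicity p n \<le> p ^ multiplicity p n"
      using P_ge_2[OF p] by (intro power_mono) auto
    also have "\<dots> \<le> n"
      using assms(1) by (intro dvd_imp_le multiplicity_dvd) auto
    finally have le: "multiplicity p n \<le> X"
      using assms(3) by linarith
    have "(\<Sum>k=1..X. if p ^ k dvd n then ln (real p) else 0) = (\<Sum>k=1..multiplicity p n. ln (real p))"
      unfolding dvd using le by (intro sum.mono_neutral_cong_right) auto
    thus "real (multiplicity p n) * ln (real p) = (\<Sum>k=1..X. if p ^ k dvd n then ln (real p) else 0)"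
      by simp
  qed
  finally show ?thesis .
qed

lemma ln_ge_sum_primes:
  assumes "n > 0" "prime_factors n \<subseteq> P"
  shows "ln (real n) \<ge> (\<Sum>p\<in>P. if p dvd n then ln (real p) else 0)"
proof -
  have "(\<Sum>p\<in>P. if p dvd n then ln (real p) else 0) \<le> (\<Sum>p\<in>P. \<Sum>k=1..n. if p ^ k dvd n then ln (real p) else 0)"
  proof (rule sum_mono)
    fix p assume p: "p \<in> P"
    have "(\<Sum>k\<in>{1::nat}. if p ^ k dvd n then ln (real p) else 0) \<le> (\<Sum>k=1..n. if p ^ k dvd n then ln (real p) else 0)"
      using assms P_ge_2[OF p] by (intro sum_mono2) auto
    thus "(if p dvd n then ln (real p) else 0) \<le> (\<Sum>k=1..n. if p ^ k dvd n then ln (real p) else 0)"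
      by simp
  qed
  thus ?thesis
    using ln_eq_sum_prime_powers[OF assms order_refl] by simp
qed

lemma smooths_dvd_eq:
  assumes "d > 0" "prime_factors d \<subseteq> P"
  shows "{n\<in>smooths P x. d dvd n} = (\<lambda>m. d * m) ` smooths P (x / real d)"
proof -
  have "d * m \<in> smooths P x \<longleftrightarrow> m \<in> smooths P (x / real d)" for m
  proof (cases "m = 0")
    case False
    hence "prime_factors (d * m) = prime_factors d \<union> prime_factors m"
      using assms(1) by (intro prime_factors_product) auto
    moreover have "real (d * m) \<le> x \<longleftrightarrow> real m \<le> x / real d"
      using assms(1) by (simp add: pos_le_divide_eq mult.commute)
    ultimately show ?thesis
      using False assms unfolding smooths_def by simp
  qed (simp add: smooths_def)
  thus ?thesis by (auto elim!: dvdE)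
qed

lemma sum_smooths_dvd:
  assumes "d > 0" "prime_factors d \<subseteq> P"
  shows "(\<Sum>n\<in>smooths P x. if d dvd n then f n else 0) = (\<Sum>m\<in>smooths P (x / real d). f (d * m))"
    (is "?L = _")
proof -
  have "?L = sum f {n\<in>smooths P x. d dvd n}"
    by (simp add: sum.inter_filter)
  also have "\<dots> = (\<Sum>m\<in>smooths P (x / real d). f (d * m))"
    unfolding smooths_dvd_eq[OF assms] using assms
    by (subst sum.reindex) (auto simp: inj_on_def)
  finally show ?thesis .
qed

lemma prime_factors_power_subset:
  assumes "p \<in> P"
  shows "prime_factors (p ^ k) \<subseteq> P"
proof
  fix q assume "q \<in> prime_factors (p ^ k)"
  hence "prime q" "q dvd p"
    by (auto simp: in_prime_factors_iff dest: prime_dvd_power)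
  thus "q \<in> P"
    using primes_dvd_imp_eq[of q p] prime_P[OF assms] assms by simp
qed

section \<open>Moments of the logarithm over smooth numbers\<close>

lemma sum_inverse_powers_le:
  assumes "p \<in> P"
  shows "(\<Sum>k=1..X. 1 / real (p ^ k)) \<le> 1 / (real p - 1)"
proof -
  have p: "real p \<ge> 2" using P_ge_2[OF assms] by simp
  have "(\<Sum>k=1..X. 1 / real (p ^ k)) * (real p - 1) = 1 - 1 / real p ^ X"
  proof (induction X)
    case (Suc X)
    have "1 / real p ^ Suc X * (real p - 1) = 1 / real p ^ X - 1 / real p ^ Suc X"
      using p by (simp add: field_simps)
    thus ?case using Suc by (simp add: ring_distribs)
  qed simp
  hence "(\<Sum>k=1..X. 1 / real (p ^ k)) = (1 - 1 / real p ^ X) / (real p - 1)"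
    using p by (simp add: eq_divide_eq)
  also have "\<dots> \<le> 1 / (real p - 1)"
    using p by (intro divide_right_mono) auto
  finally show ?thesis .
qed

text \<open>Expand \<open>ln n\<close> over prime powers \<open>p^k dvd n\<close> and substitute
  \<open>n = p^k * m\<close>. Each inner sum is a zeroth moment with a smaller cutoff, and the
  factors \<open>p^(-k)\<close> form a geometric series.\<close>

lemma log_moment_1_le:
  "log_moment 1 P x \<le> (\<Sum>p\<in>P. ln (real p) / (real p - 1)) * log_moment 0 P x"
proof -
  define X where "X = nat \<lfloor>x\<rfloor>"
  have "log_moment 1 P x
        = (\<Sum>n\<in>smooths P x. \<Sum>p\<in>P. \<Sum>k=1..X. if p ^ k dvd n then ln (real p) / real n else 0)"
    unfolding log_moment_def
  proof (rule sum.cong[OF refl])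
    fix n assume n: "n \<in> smooths P x"
    hence "n \<le> X" by (auto simp: smooths_def X_def le_nat_iff le_floor_iff)
    have "ln (real n) ^ 1 / real n = (\<Sum>p\<in>P. \<Sum>k=1..X. if p ^ k dvd n then ln (real p) else 0) / real n"
      using n \<open>n \<le> X\<close> by (subst ln_eq_sum_prime_powers[of n X, symmetric]) (auto simp: smooths_def)
    thus "ln (real n) ^ 1 / real n = (\<Sum>p\<in>P. \<Sum>k=1..X. if p ^ k dvd n then ln (real p) / real n else 0)"
      by (simp add: sum_divide_distrib if_distrib[of "\<lambda>u. u / real n"] cong: if_cong)
  qed
  also have "\<dots> = (\<Sum>p\<in>P. \<Sum>k=1..X. \<Sum>n\<in>smooths P x. if p ^ k dvd n then ln (real p) / real n else 0)"
    by (subst sum.swap, intro sum.cong refl sum.swap)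
  also have "\<dots> \<le> (\<Sum>p\<in>P. \<Sum>k=1..X. ln (real p) * (1 / real (p ^ k)) * log_moment 0 P x)"
  proof (intro sum_mono)
    fix p k assume p: "p \<in> P"
    have p2: "p \<ge> 2" by (rule P_ge_2[OF p])
    have "x / real (p ^ k) \<le> x" if "x \<ge> 0"
      using that p2 mult_left_mono[of 1 "real p ^ k" x] by (simp add: divide_le_eq)
    \<comment> \<open>For negative \<open>x\<close> the division moves the cutoff up, but then both
      sets of smooth numbers are empty.\<close>
    hence le: "log_moment 0 P (x / real (p ^ k)) \<le> log_moment 0 P x"
    proof (cases "x \<ge> 0")
      case False
      hence "x / real (p ^ k) < 0"
        using p2 by (intro divide_neg_pos) auto
      hence "smooths P (x / real (p ^ k)) = {}"
        by (auto simp: smooths_def)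
      thus ?thesis
        using log_moment_nonneg[of 0 P x] by (simp add: log_moment_def)
    qed (auto intro: log_moment_mono)
    have "(\<Sum>n\<in>smooths P x. if p ^ k dvd n then ln (real p) / real n else 0)
          = ln (real p) * (1 / real (p ^ k)) * log_moment 0 P (x / real (p ^ k))"
      using p2 by (subst sum_smooths_dvd[OF _ prime_factors_power_subset[OF p]])
         (auto simp: log_moment_def sum_distrib_left)
    also have "\<dots> \<le> ln (real p) * (1 / real (p ^ k)) * log_moment 0 P x"
      using le p2 by (intro mult_left_mono) auto
    finally show "(\<Sum>n\<in>smooths P x. if p ^ k dvd n then ln (real p) / real n else 0)
                  \<le> ln (real p) * (1 / real (p ^ k)) * log_moment 0 P x" .
  qed
  also have "\<dots> = (\<Sum>p\<in>P. ln (real p) * (\<Sum>k=1..X. 1 / real (p ^ k))) * log_moment 0 P x"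
    by (simp add: sum_distrib_left sum_distrib_right mult.assoc)
  also have "\<dots> \<le> (\<Sum>p\<in>P. ln (real p) * (1 / (real p - 1))) * log_moment 0 P x"
    using P_ge_2
    by (intro mult_right_mono sum_mono mult_left_mono sum_inverse_powers_le log_moment_nonneg)
       (auto simp: Suc_le_eq dest!: P_ge_2)
  finally show ?thesis by simp
qed

text \<open>Markov's inequality for \<open>ln n\<close> under the weights \<open>1/n\<close>, with
  \<open>log_moment_1_le\<close> bounding the mean. The relative loss does not depend on
  \<open>X\<close>.\<close>

lemma log_moment_0_tail:
  assumes "1 < z" "z \<le> X"
  shows "log_moment 0 P z \<ge> (1 - (\<Sum>p\<in>P. ln (real p) / (real p - 1)) / ln z) * log_moment 0 P X"
proof -
  have "ln z * (log_moment 0 P X - log_moment 0 P z) = (\<Sum>n\<in>smooths P X - smooths P z. ln z / real n)"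
    unfolding log_moment_def using smooths_mono[OF assms(2), of P]
    by (simp add: sum_diff right_diff_distrib sum_distrib_left)
  also have "\<dots> \<le> (\<Sum>n\<in>smooths P X - smooths P z. ln (real n) ^ 1 / real n)"
    using assms(1) by (intro sum_mono divide_right_mono) (auto simp: smooths_def intro!: ln_mono)
  also have "\<dots> \<le> log_moment 1 P X"
    unfolding log_moment_def by (intro sum_mono2 finite_smooths) (auto simp: smooths_def)
  also note log_moment_1_le
  finally show ?thesis
    using assms(1) by (simp add: field_simps)
qed

text \<open>One of the \<open>l + 1\<close> factors \<open>ln n\<close> is bounded below by the sum
  of \<open>ln p\<close> over \<open>p dvd n\<close>; then \<open>n = p * m\<close>. This recursion
  produces the lower bounds for the first two moments.\<close>

lemma log_moment_Suc_ge:
  "log_moment (Suc l) P x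
   \<ge> (\<Sum>p\<in>P. ln (real p) / real p * (\<Sum>m\<in>smooths P (x / real p). (ln (real p) + ln (real m)) ^ l / real m))"
proof -
  have "(\<Sum>p\<in>P. ln (real p) / real p * (\<Sum>m\<in>smooths P (x / real p). (ln (real p) + ln (real m)) ^ l / real m))
    = (\<Sum>p\<in>P. \<Sum>n\<in>smooths P x. if p dvd n then ln (real p) * ln (real n) ^ l / real n else 0)"
  proof (rule sum.cong[OF refl])
    fix p assume p: "p \<in> P"
    have p2: "p \<ge> 2" by (rule P_ge_2[OF p])
    have "(\<Sum>n\<in>smooths P x. if p dvd n then ln (real p) * ln (real n) ^ l / real n else 0)
          = (\<Sum>m\<in>smooths P (x / real p). ln (real p) * ln (real (p * m)) ^ l / real (p * m))"
      using p2 prime_factors_power_subset[OF p, of 1] by (intro sum_smooths_dvd) auto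
    also have "\<dots> = (\<Sum>m\<in>smooths P (x / real p). ln (real p) / real p * ((ln (real p) + ln (real m)) ^ l / real m))"
      using p2 by (intro sum.cong refl) (auto simp: smooths_def ln_mult)
    finally show "ln (real p) / real p * (\<Sum>m\<in>smooths P (x / real p). (ln (real p) + ln (real m)) ^ l / real m)
      = (\<Sum>n\<in>smooths P x. if p dvd n then ln (real p) * ln (real n) ^ l / real n else 0)"
      by (simp add: sum_distrib_left)
  qed
  also have "\<dots> = (\<Sum>n\<in>smooths P x. ln (real n) ^ l / real n * (\<Sum>p\<in>P. if p dvd n then ln (real p) else 0))"
    by (subst sum.swap) (auto simp: sum_distrib_left intro!: sum.cong)
  also have "\<dots> \<le> (\<Sum>n\<in>smooths P x. ln (real n) ^ l / real n * ln (real n))"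
    by (intro sum_mono mult_left_mono ln_ge_sum_primes) (auto simp: smooths_def)
  also have "\<dots> = log_moment (Suc l) P x"
    by (simp add: log_moment_def mult_ac)
  finally show ?thesis .
qed

lemma log_moment_1_ge:
  assumes "\<And>p. p \<in> P \<Longrightarrow> real p \<le> y" "x \<ge> 0"
  shows "log_moment 1 P x \<ge> (\<Sum>p\<in>P. ln (real p) / real p) * log_moment 0 P (x / y)"
proof -
  have "(\<Sum>p\<in>P. ln (real p) / real p) * log_moment 0 P (x / y)
        \<le> (\<Sum>p\<in>P. ln (real p) / real p * log_moment 0 P (x / real p))"
    unfolding sum_distrib_right
  proof (intro sum_mono mult_left_mono log_moment_mono)
    fix p assume p: "p \<in> P"
    show "x / y \<le> x / real p"
      using P_ge_2[OF p] assms(1)[OF p] assms(2) by (intro divide_left_mono mult_pos_pos) auto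
  qed (auto dest!: P_ge_2)
  also have "\<dots> \<le> log_moment 1 P x"
    using log_moment_Suc_ge[of 0 x] by (simp add: log_moment_def)
  finally show ?thesis .
qed

text \<open>In the recursion the summand \<open>ln p\<close> yields the sum of
  \<open>(ln p)^2 / p\<close>, while \<open>ln m\<close> yields a first moment, to which the
  recursion applies again. The first contribution is what lifts the second moment above the square
  of the mean. The cutoff \<open>x / y^2\<close> lies below all cutoffs that occur.\<close>

lemma log_moment_2_ge:
  assumes "\<And>p. p \<in> P \<Longrightarrow> real p \<le> y" "x \<ge> 0" "y \<ge> 1"
  shows "log_moment 2 P x
         \<ge> ((\<Sum>p\<in>P. ln (real p) ^ 2 / real p) + (\<Sum>p\<in>P. ln (real p) / real p) ^ 2) * log_moment 0 P (x / y^2)"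
proof -
  let ?A = "\<Sum>p\<in>P. ln (real p) / real p" and ?D = "log_moment 0 P (x / y^2)"
  have A: "?A \<ge> 0" by (intro sum_nonneg) (auto dest!: P_ge_2)
  have "((\<Sum>p\<in>P. ln (real p) ^ 2 / real p) + ?A ^ 2) * ?D
        = (\<Sum>p\<in>P. ln (real p) / real p * (ln (real p) * ?D + ?A * ?D))"
  proof -
    have "(\<Sum>p\<in>P. ln (real p) / real p * (ln (real p) * ?D + ?A * ?D))
          = (\<Sum>p\<in>P. ln (real p) ^ 2 / real p * ?D) + (\<Sum>p\<in>P. ln (real p) / real p * (?A * ?D))"
      unfolding sum.distrib[symmetric] by (intro sum.cong refl) (simp add: ring_distribs power2_eq_square)
    also have "\<dots> = (\<Sum>p\<in>P. ln (real p) ^ 2 / real p) * ?D + ?A * (?A * ?D)"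
      by (simp only: sum_distrib_right)
    finally show ?thesis
      by (simp only: distrib_right power2_eq_square mult.assoc)
  qed
  also have "\<dots> \<le> (\<Sum>p\<in>P. ln (real p) / real p * (\<Sum>m\<in>smooths P (x / real p). (ln (real p) + ln (real m)) ^ 1 / real m))"
  proof (intro sum_mono mult_left_mono)
    fix p assume p: "p \<in> P"
    have p2: "p \<ge> 2" by (rule P_ge_2[OF p])
    have le1: "x / y^2 \<le> x / real p"
    proof (rule divide_left_mono)
      have "real p * 1 \<le> y * y" using assms(1)[OF p] assms(3) by (intro mult_mono) auto
      thus "real p \<le> y^2" by (simp add: power2_eq_square)
    qed (use assms p2 in auto)
    have le2: "x / y^2 \<le> (x / real p) / y"
    proof -
      have "x / y^2 = (x / y) / y" by (simp add: power2_eq_square)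
      also have "\<dots> \<le> (x / real p) / y"
        using assms(2,3) assms(1)[OF p] p2 by (intro divide_right_mono divide_left_mono) auto
      finally show ?thesis .
    qed
    have "ln (real p) * ?D + ?A * ?D \<le> ln (real p) * log_moment 0 P (x / real p) + ?A * log_moment 0 P ((x / real p) / y)"
      using A p2 le1 le2 by (intro add_mono mult_left_mono log_moment_mono) auto
    also have "\<dots> \<le> ln (real p) * log_moment 0 P (x / real p) + log_moment 1 P (x / real p)"
      using assms by (intro add_left_mono log_moment_1_ge) auto
    also have "\<dots> = (\<Sum>m\<in>smooths P (x / real p). (ln (real p) + ln (real m)) ^ 1 / real m)"
      by (simp add: log_moment_def sum_distrib_left sum.distrib add_divide_distrib)
    finally show "ln (real p) * ?D + ?A * ?D \<le> \<dots>" .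
  qed (auto dest!: P_ge_2)
  also have "\<dots> \<le> log_moment 2 P x"
    using log_moment_Suc_ge[of 1 x] by (simp add: numeral_2_eq_2)
  finally show ?thesis .
qed

section \<open>Boxes of exponents and finite Euler products\<close>

lemma bij_betw_exponent_box:
  "bij_betw (\<lambda>b. \<Prod>p\<in>P. p ^ b p) (PiE P (\<lambda>_. {..J})) (exponent_box P J)"
\<comment> \<open>Unique factorisation: the vector of multiplicities is the inverse map. In these
  coordinates sums over the box become products and cardinalities become powers.\<close>
proof (rule bij_betw_byWitness[where f' = "\<lambda>n. \<lambda>p\<in>P. multiplicity p n"])
  have mult: "multiplicity p (\<Prod>p\<in>P. p ^ b p) = b p" if "p \<in> P" for b p
    using multiplicity_prod_prime_powers[OF finite_P prime_P prime_P[OF that], of b] that by simp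
  have pos: "(\<Prod>p\<in>P. p ^ b p) > 0" for b
    by (intro prod_pos) (auto dest!: P_ge_2)
  show "\<forall>b\<in>PiE P (\<lambda>_. {..J}). (\<lambda>p\<in>P. multiplicity p (\<Prod>p\<in>P. p ^ b p)) = b"
    using mult by (auto simp: restrict_def PiE_def extensional_def fun_eq_iff)
  show "\<forall>n\<in>exponent_box P J. (\<Prod>p\<in>P. p ^ (\<lambda>p\<in>P. multiplicity p n) p) = n"
  proof
    fix n assume n: "n \<in> exponent_box P J"
    have "(\<Prod>p\<in>P. p ^ (\<lambda>p\<in>P. multiplicity p n) p) = (\<Prod>p\<in>prime_factors n. p ^ multiplicity p n)"
      using n finite_P prime_P
      by (intro prod.mono_neutral_cong_right) (auto simp: exponent_box_def prime_factors_multiplicity)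
    thus "(\<Prod>p\<in>P. p ^ (\<lambda>p\<in>P. multiplicity p n) p) = n"
      using n prime_factorization_nat[of n] by (simp add: exponent_box_def)
  qed
  show "(\<lambda>b. \<Prod>p\<in>P. p ^ b p) ` PiE P (\<lambda>_. {..J}) \<subseteq> exponent_box P J"
  proof safe
    fix b assume b: "b \<in> PiE P (\<lambda>_. {..J})"
    have "p \<in> P" if "p \<in> prime_factors (\<Prod>p\<in>P. p ^ b p)" for p
      using that multiplicity_prod_prime_powers[OF finite_P prime_P, of p b]
      by (auto simp: prime_factors_multiplicity split: if_splits)
    thus "(\<Prod>p\<in>P. p ^ b p) \<in> exponent_box P J"
      using pos b mult by (auto simp: exponent_box_def)
  qed
  show "(\<lambda>n. \<lambda>p\<in>P. multiplicity p n) ` exponent_box P J \<subseteq> PiE P (\<lambda>_. {..J})"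
    by (auto simp: exponent_box_def)
qed

lemma finite_exponent_box [simp]: "finite (exponent_box P J)"
  using bij_betw_finite[OF bij_betw_exponent_box[of J]] finite_P by (auto intro: finite_PiE)

lemma card_exponent_box: "card (exponent_box P J) = (J + 1) ^ card P"
  using bij_betw_same_card[OF bij_betw_exponent_box[of J]] finite_P by (simp add: card_PiE)

lemma exponent_box_le: "n \<in> exponent_box P J \<Longrightarrow> n \<le> (\<Prod>P) ^ J"
proof -
  assume "n \<in> exponent_box P J"
  then obtain b where b: "b \<in> PiE P (\<lambda>_. {..J})" "n = (\<Prod>p\<in>P. p ^ b p)"
    using bij_betw_exponent_box[of J] unfolding bij_betw_def by blast
  have "n \<le> (\<Prod>p\<in>P. p ^ J)"
    unfolding b(2) using b(1) by (intro prod_mono conjI power_increasing) (auto dest: P_ge_2)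
  thus ?thesis by (simp add: prod_power_distrib)
qed

lemma exponent_box_pos: "n \<in> exponent_box P J \<Longrightarrow> n > 0"
  by (simp add: exponent_box_def)

lemma sum_exponent_box_powr:
  "(\<Sum>n\<in>exponent_box P J. real n powr (-s)) = (\<Prod>p\<in>P. \<Sum>j\<le>J. (real p powr (-s)) ^ j)"
proof -
  have "(\<Sum>n\<in>exponent_box P J. real n powr (-s))
        = (\<Sum>b\<in>PiE P (\<lambda>_. {..J}). real (\<Prod>p\<in>P. p ^ b p) powr (-s))"
    by (rule sum.reindex_bij_betw[OF bij_betw_exponent_box, symmetric])
  also have "\<dots> = (\<Sum>b\<in>PiE P (\<lambda>_. {..J}). \<Prod>p\<in>P. (real p powr (-s)) ^ b p)"
  proof (rule sum.cong[OF refl])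
    fix b
    have "real (\<Prod>p\<in>P. p ^ b p) powr (-s) = (\<Prod>p\<in>P. real (p ^ b p) powr (-s))"
      by (simp add: prod_powr_distrib)
    also have "\<dots> = (\<Prod>p\<in>P. (real p powr (-s)) ^ b p)"
      by (intro prod.cong refl) (auto simp: powr_realpow[symmetric] powr_powr mult.commute powr_power dest!: P_ge_2)
    finally show "real (\<Prod>p\<in>P. p ^ b p) powr (-s) = (\<Prod>p\<in>P. (real p powr (-s)) ^ b p)" .
  qed
  also have "\<dots> = (\<Prod>p\<in>P. \<Sum>j\<le>J. (real p powr (-s)) ^ j)"
    by (rule prod_sum_PiE[symmetric]) (use finite_P in auto)
  finally show ?thesis .
qed

lemma log_moment_0_ge_prod:
  "\<exists>X. \<forall>x\<ge>X. log_moment 0 P x \<ge> (\<Prod>p\<in>P. \<Sum>j\<le>J. (1 / real p) ^ j)"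
proof (intro exI allI impI)
  fix x :: real assume x: "x \<ge> real ((\<Prod>P) ^ J)"
  have "exponent_box P J \<subseteq> smooths P x"
  proof
    fix n assume n: "n \<in> exponent_box P J"
    have "real n \<le> x"
      using exponent_box_le[OF n] x by (metis of_nat_le_iff order_trans)
    thus "n \<in> smooths P x"
      using n by (auto simp: exponent_box_def smooths_def)
  qed
  hence "(\<Sum>n\<in>exponent_box P J. 1 / real n) \<le> log_moment 0 P x"
    unfolding log_moment_def by (simp add: sum_mono2)
  thus "(\<Prod>p\<in>P. \<Sum>j\<le>J. (1 / real p) ^ j) \<le> log_moment 0 P x"
    using sum_exponent_box_powr[where s = 1 and J = J] by (simp add: powr_minus_divide)
qed

text \<open>The loss in \<open>log_moment_0_tail\<close> is independent of the larger cutoff, which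
  may therefore be taken beyond a whole box. Letting the exponent bound \<open>J\<close> tend to
  infinity completes the Euler factors.\<close>

lemma log_moment_0_ge:
  assumes z: "1 < z" and Q: "(\<Sum>p\<in>P. ln (real p) / (real p - 1)) \<le> ln z"
  shows "log_moment 0 P z \<ge> (1 - (\<Sum>p\<in>P. ln (real p) / (real p - 1)) / ln z) * (\<Prod>p\<in>P. 1 / (1 - 1 / real p))"
proof (rule LIMSEQ_le_const2)
  let ?c = "1 - (\<Sum>p\<in>P. ln (real p) / (real p - 1)) / ln z"
  show "(\<lambda>J. ?c * (\<Prod>p\<in>P. \<Sum>j\<le>J. (1 / real p) ^ j)) \<longlonglongrightarrow> ?c * (\<Prod>p\<in>P. 1 / (1 - 1 / real p))"
  proof (intro tendsto_mult tendsto_const tendsto_prod)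
    fix p assume p: "p \<in> P"
    have "(\<lambda>j. (1 / real p) ^ j) sums (1 / (1 - 1 / real p))"
      using P_ge_2[OF p] by (intro geometric_sums) auto
    thus "(\<lambda>J. \<Sum>j\<le>J. (1 / real p) ^ j) \<longlonglongrightarrow> 1 / (1 - 1 / real p)"
      by (simp add: sums_def_le)
  qed
  show "\<exists>N. \<forall>J\<ge>N. ?c * (\<Prod>p\<in>P. \<Sum>j\<le>J. (1 / real p) ^ j) \<le> log_moment 0 P z"
  proof (intro exI allI impI)
    fix J
    obtain X0 where X0: "\<forall>x\<ge>X0. log_moment 0 P x \<ge> (\<Prod>p\<in>P. \<Sum>j\<le>J. (1 / real p) ^ j)"
      using log_moment_0_ge_prod by blast
    have "?c * (\<Prod>p\<in>P. \<Sum>j\<le>J. (1 / real p) ^ j) \<le> ?c * log_moment 0 P (max X0 z)"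
      using X0 z Q by (intro mult_left_mono) auto
    also have "\<dots> \<le> log_moment 0 P z"
      using z by (intro log_moment_0_tail) auto
    finally show "?c * (\<Prod>p\<in>P. \<Sum>j\<le>J. (1 / real p) ^ j) \<le> log_moment 0 P z" .
  qed
qed

text \<open>Every \<open>n <= N\<close> has its prime factors in \<open>P\<close> and multiplicities
  below \<open>N\<close>, because \<open>2^v <= n\<close> forces \<open>v < n\<close>. So it occurs
  when the Euler product is expanded.\<close>

lemma prod_ge_sum_powr:
  assumes "\<And>p. prime p \<Longrightarrow> p \<le> N \<Longrightarrow> p \<in> P" "s > 0"
  shows "(\<Sum>n=1..N. real n powr (-s)) \<le> (\<Prod>p\<in>P. 1 / (1 - real p powr (-s)))"
proof -
  have "{1..N} \<subseteq> exponent_box P N"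
  proof
    fix n assume n: "n \<in> {1..N}"
    have "multiplicity p n \<le> N" if "p \<in> P" for p
    proof -
      have "multiplicity p n < 2 ^ multiplicity p n"
        by (rule less_exp)
      also have "(2::nat) ^ multiplicity p n \<le> p ^ multiplicity p n"
        using P_ge_2[OF that] by (intro power_mono) auto
      also have "\<dots> \<le> n"
        using n by (intro dvd_imp_le multiplicity_dvd) auto
      finally show ?thesis using n by simp
    qed
    moreover have "p \<in> P" if "p \<in> prime_factors n" for p
      using that n assms(1)[of p] dvd_imp_le[of p n] by (auto simp: in_prime_factors_iff)
    ultimately show "n \<in> exponent_box P N"
      using n by (auto simp: exponent_box_def)
  qed
  hence "(\<Sum>n=1..N. real n powr (-s)) \<le> (\<Sum>n\<in>exponent_box P N. real n powr (-s))"
    by (intro sum_mono2) auto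
  also have "\<dots> \<le> (\<Prod>p\<in>P. 1 / (1 - real p powr (-s)))"
    unfolding sum_exponent_box_powr
  proof (intro prod_mono conjI sum_nonneg)
    fix p assume p: "p \<in> P"
    let ?r = "real p powr (-s)"
    have r: "0 < ?r" "?r < 1"
      using P_ge_2[OF p] assms(2) by (auto simp: powr_less_one)
    have "(\<Sum>j\<le>N. ?r ^ j) \<le> (\<Sum>j. ?r ^ j)"
      using r by (intro sum_le_suminf) (auto intro!: summable_geometric)
    also have "\<dots> = 1 / (1 - ?r)"
      using r by (intro suminf_geometric) auto
    finally show "(\<Sum>j\<le>N. ?r ^ j) \<le> 1 / (1 - ?r)" .
  qed auto
  finally show ?thesis .
qed

end

section \<open>Mertens' theorems\<close>

lemma prod_primes_dvd:
  fixes n :: nat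
  assumes "finite S" "\<And>p. p \<in> S \<Longrightarrow> prime p" "\<And>p. p \<in> S \<Longrightarrow> p dvd n"
  shows "\<Prod>S dvd n"
  using assms
proof (induction S rule: finite_induct)
  case (insert q S)
  have "coprime q (\<Prod>S)"
    using insert by (intro prod_coprime_right primes_coprime) auto
  thus ?case
    using insert by (simp add: divides_mult)
qed simp

text \<open>Erdos's induction: for \<open>n = 2m + 1\<close> the primes in \<open>(m + 1, n]\<close>
  all divide \<open>n choose m\<close>, which is at most \<open>4^m\<close>; an even
  \<open>n > 2\<close> contributes no new prime.\<close>

lemma primorial_le: "\<Prod>{p. prime p \<and> p \<le> n} \<le> (4::nat) ^ n"
proof (induction n rule: less_induct)
  case (less n)
  show ?case
  proof (cases "n \<le> 2")
    case True
    have "p = 2" if "prime p" "p \<le> n" for p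
      using prime_ge_2_nat[OF that(1)] that True by simp
    hence "{p. prime p \<and> p \<le> n} = {} \<or> {p. prime p \<and> p \<le> n} = {2} \<and> n = 2"
      using True by (cases "n = 2") fastforce+
    thus ?thesis
    proof
      assume "{p. prime p \<and> p \<le> n} = {}"
      hence "\<Prod>{p. prime p \<and> p \<le> n} = 1" by (simp only: prod.empty)
      thus ?thesis by simp
    next
      assume "{p. prime p \<and> p \<le> n} = {2} \<and> n = 2"
      hence "\<Prod>{p. prime p \<and> p \<le> n} = \<Prod>{2}" and "n = 2"
        by (elim conjE, simp only:)+
      thus ?thesis by simp
    qed
  next
    case n: False
    show ?thesis
    proof (cases "even n")
      case True
      have "\<not> prime n"
        using n True prime_odd_nat[of n] by auto
      hence "p \<le> n \<longleftrightarrow> p \<le> n - 1" if "prime p" for p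
        using that n by (cases "p = n") auto
      hence "{p. prime p \<and> p \<le> n} = {p. prime p \<and> p \<le> n - 1}"
        by blast
      hence "\<Prod>{p. prime p \<and> p \<le> n} = \<Prod>{p. prime p \<and> p \<le> n - 1}"
        by (simp only:)
      also have "\<dots> \<le> 4 ^ (n - 1)"
        using n by (intro less.IH) auto
      also have "(4::nat) ^ (n - 1) \<le> 4 ^ n"
        by (intro power_increasing) auto
      finally show ?thesis .
    next
      case False
      then obtain m where m: "n = 2 * m + 1" by (elim oddE)
      have m1: "m \<ge> 1" using n m by simp
      let ?C = "(2 * m + 1) choose m" and ?S = "{p. prime p \<and> m + 1 < p \<and> p \<le> n}"
      have "\<Prod>?S dvd ?C"
      proof (rule prod_primes_dvd)
        fix p assume p: "p \<in> ?S"
        have "fact m * fact (2 * m + 1 - m) * ?C = (fact (2 * m + 1) :: nat)"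
          by (intro binomial_fact_lemma) auto
        moreover have "p dvd (fact (2 * m + 1) :: nat)"
          using p m by (subst prime_dvd_fact_iff) auto
        ultimately have "p dvd fact m * fact (2 * m + 1 - m) * ?C"
          by simp
        moreover have "\<not> p dvd fact m" "\<not> p dvd fact (2 * m + 1 - m)"
          using p by (subst prime_dvd_fact_iff; simp)+
        ultimately show "p dvd ?C"
          using p prime_dvd_mult_nat by blast
      qed auto
      hence "\<Prod>?S \<le> ?C"
        by (intro dvd_imp_le) auto
      also have "?C \<le> 4 ^ m"
      proof -
        \<comment> \<open>The two middle coefficients of an odd row coincide and together are at
          most the row sum \<open>2^(2m+1)\<close>.\<close>
        have "2 * ?C = ?C + ((2 * m + 1) choose (m + 1))"
          using binomial_symmetric[of m "2 * m + 1"] by simp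
        also have "\<dots> = (\<Sum>k\<in>{m, m + 1}. (2 * m + 1) choose k)"
          by simp
        also have "\<dots> \<le> (\<Sum>k\<le>2 * m + 1. (2 * m + 1) choose k)"
          by (intro sum_mono2) auto
        also have "\<dots> = 2 * 4 ^ m"
          unfolding choose_row_sum by (simp add: power_mult)
        finally show ?thesis by simp
      qed
      finally have "\<Prod>?S \<le> 4 ^ m" .
      moreover have "\<Prod>{p. prime p \<and> p \<le> m + 1} \<le> 4 ^ (m + 1)"
        using m m1 by (intro less.IH) auto
      moreover have "{p. prime p \<and> p \<le> n} = {p. prime p \<and> p \<le> m + 1} \<union> ?S"
        using m by auto
      hence "\<Prod>{p. prime p \<and> p \<le> n} = \<Prod>{p. prime p \<and> p \<le> m + 1} * \<Prod>?S"
        by (simp, subst prod.union_disjoint) auto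
      ultimately have "\<Prod>{p. prime p \<and> p \<le> n} \<le> 4 ^ (m + 1) * 4 ^ m"
        by (simp add: mult_mono)
      also have "4 ^ (m + 1) * 4 ^ m = (4::nat) ^ n"
        by (simp add: m mult_2 power_add)
      finally show ?thesis .
    qed
  qed
qed

lemma sum_ln_primes_le: "(\<Sum>p | prime p \<and> p \<le> n. ln (real p)) \<le> real n * ln 4"
proof -
  have "(\<Sum>p | prime p \<and> p \<le> n. ln (real p)) = ln (real (\<Prod>{p. prime p \<and> p \<le> n}))"
    by (subst of_nat_prod, subst ln_prod) (auto simp: prime_gt_0_nat)
  also have "\<dots> \<le> ln (4 ^ n)"
  proof (rule ln_mono)
    have "real (\<Prod>{p. prime p \<and> p \<le> n}) \<le> real (4 ^ n)"
      by (subst of_nat_le_iff) (rule primorial_le)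
    thus "real (\<Prod>{p. prime p \<and> p \<le> n}) \<le> 4 ^ n" by simp
    have "\<Prod>{p. prime p \<and> p \<le> n} > 0"
      by (intro prod_pos) (auto simp: prime_gt_0_nat)
    thus "0 < real (\<Prod>{p. prime p \<and> p \<le> n})" by (simp only: of_nat_0_less_iff)
  qed
  finally show ?thesis by (simp add: ln_realpow)
qed

section \<open>Mertens' first theorem\<close>

lemma card_multiples:
  assumes "d > (0::nat)"
  shows "card {m\<in>{1..n}. d dvd m} = n div d"
proof -
  have "{m\<in>{1..n}. d dvd m} = (\<lambda>k. d * k) ` {1..n div d}"
    using assms by (auto elim!: dvdE simp: less_eq_div_iff_mult_less_eq mult.commute)
  thus ?thesis
    using assms by (simp add: card_image inj_on_def)
qed

text \<open>Legendre's formula in logarithmic form. Compared with the crude Stirling bounds below,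
  it gives both halves of Mertens' first theorem.\<close>

lemma ln_fact_eq_sum_primes:
  "ln (fact n) = (\<Sum>p | prime p \<and> p \<le> n. \<Sum>k=1..n. ln (real p) * real (n div p ^ k))"
proof -
  let ?P = "{p. prime p \<and> p \<le> n}"
  interpret prime_set ?P by unfold_locales auto
  have "ln (fact n :: real) = (\<Sum>m=1..n. ln (real m))"
    unfolding fact_prod of_nat_prod by (subst ln_prod) auto
  also have "\<dots> = (\<Sum>m=1..n. \<Sum>p\<in>?P. \<Sum>k=1..n. if p ^ k dvd m then ln (real p) else 0)"
  proof (intro sum.cong refl ln_eq_sum_prime_powers)
    fix m assume m: "m \<in> {1..n}"
    show "prime_factors m \<subseteq> ?P"
      using m by (auto simp: in_prime_factors_iff dest!: dvd_imp_le)
  qed auto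
  also have "\<dots> = (\<Sum>p\<in>?P. \<Sum>k=1..n. \<Sum>m=1..n. if p ^ k dvd m then ln (real p) else 0)"
    by (subst sum.swap, intro sum.cong refl sum.swap)
  also have "\<dots> = (\<Sum>p\<in>?P. \<Sum>k=1..n. ln (real p) * real (n div p ^ k))"
  proof (intro sum.cong refl)
    fix p k assume "p \<in> ?P"
    hence "card {m\<in>{1..n}. p ^ k dvd m} = n div p ^ k"
      by (intro card_multiples) (auto simp: prime_gt_0_nat)
    thus "(\<Sum>m=1..n. if p ^ k dvd m then ln (real p) else 0) = ln (real p) * real (n div p ^ k)"
      by (subst sum.inter_filter[symmetric]) auto
  qed
  finally show ?thesis .
qed

lemma ln_fact_le: "ln (fact n :: real) \<le> real n * ln (real n)"
proof (cases "n = 0")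
  case False
  have "ln (fact n :: real) \<le> ln (real n ^ n)"
    using False fact_le_power[of n] by (intro ln_mono) auto
  thus ?thesis using False by (simp add: ln_realpow)
qed simp

lemma ln_fact_ge: "ln (fact n :: real) \<ge> real n * ln (real n) - real n"
proof (induction n)
  case (Suc n)
  have "real n * (ln (real (Suc n)) - ln (real n)) \<le> 1"
  proof (cases "n = 0")
    case False
    have "ln (real (Suc n)) - ln (real n) = ln (1 + 1 / real n)"
      using False ln_divide_pos[of "real (Suc n)" "real n"] by (simp add: add_divide_distrib add.commute)
    also have "\<dots> \<le> 1 / real n"
      by (rule ln_add_one_self_le_self) simp
    finally show ?thesis using False by (simp add: field_simps)
  qed simp
  moreover have "ln (fact (Suc n) :: real) = ln (real (Suc n)) + ln (fact n)"
    by (subst fact_Suc, subst ln_mult) auto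
  ultimately show ?case
    using Suc.IH by (simp add: algebra_simps)
qed simp

text \<open>Keep only \<open>k = 1\<close> in Legendre's formula. Removing the floors costs at most
  \<open>ln p\<close> per prime, and Chebyshev's bound makes the total at most
  \<open>n * ln 4\<close>.\<close>

lemma sum_ln_primes_div_le:
  "(\<Sum>p | prime p \<and> p \<le> n. ln (real p) / real p) \<le> ln (real n) + ln 4"
proof (cases "n = 0")
  case False
  let ?P = "{p. prime p \<and> p \<le> n}"
  have "real n * (\<Sum>p\<in>?P. ln (real p) / real p) - real n * ln 4
        \<le> real n * (\<Sum>p\<in>?P. ln (real p) / real p) - (\<Sum>p\<in>?P. ln (real p))"
    using sum_ln_primes_le[of n] by simp
  also have "\<dots> = (\<Sum>p\<in>?P. ln (real p) * (real n / real p - 1))"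
    by (simp add: sum_distrib_left sum_subtractf algebra_simps)
  also have "\<dots> \<le> (\<Sum>p\<in>?P. \<Sum>k\<in>{1}. ln (real p) * real (n div p ^ k))"
  proof (rule sum_mono)
    fix p assume p: "p \<in> ?P"
    have "real n / real p - 1 \<le> real (n div p)"
      using floor_divide_of_nat_eq[of n p, where 'a = real] by linarith
    thus "ln (real p) * (real n / real p - 1) \<le> (\<Sum>k\<in>{1}. ln (real p) * real (n div p ^ k))"
      using p prime_ge_1_nat[of p] by (auto intro!: mult_left_mono)
  qed
  also have "\<dots> \<le> (\<Sum>p\<in>?P. \<Sum>k=1..n. ln (real p) * real (n div p ^ k))"
    using False by (intro sum_mono sum_mono2 mult_nonneg_nonneg ln_ge_zero) (auto dest: prime_ge_1_nat)
  also have "\<dots> \<le> real n * ln (real n)"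
    unfolding ln_fact_eq_sum_primes[symmetric] by (rule ln_fact_le)
  finally have "real n * (\<Sum>p\<in>?P. ln (real p) / real p) \<le> real n * (ln (real n) + ln 4)"
    by (simp add: algebra_simps)
  thus ?thesis using False by simp
qed simp

text \<open>Here the floors in Legendre's formula are dropped upwards and all exponents are kept;
  the geometric series produces the denominator \<open>p - 1\<close>.\<close>

lemma sum_ln_primes_div_pred_ge:
  assumes "n > 0"
  shows "(\<Sum>p | prime p \<and> p \<le> n. ln (real p) / (real p - 1)) \<ge> ln (real n) - 1"
proof -
  let ?P = "{p. prime p \<and> p \<le> n}"
  interpret prime_set ?P by unfold_locales auto
  have "real n * (ln (real n) - 1) \<le> ln (fact n :: real)"
    using ln_fact_ge[of n] by (simp add: algebra_simps)
  also have "\<dots> = (\<Sum>p\<in>?P. \<Sum>k=1..n. ln (real p) * real (n div p ^ k))"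
    by (rule ln_fact_eq_sum_primes)
  also have "\<dots> \<le> (\<Sum>p\<in>?P. \<Sum>k=1..n. ln (real p) * (real n * (1 / real (p ^ k))))"
  proof (intro sum_mono mult_left_mono)
    fix p k
    show "real (n div p ^ k) \<le> real n * (1 / real (p ^ k))"
      using of_nat_div_le_of_nat[of n "p ^ k"] by simp
  qed (auto intro!: ln_ge_zero dest: prime_ge_1_nat)
  also have "\<dots> = (\<Sum>p\<in>?P. real n * ln (real p) * (\<Sum>k=1..n. 1 / real (p ^ k)))"
    by (simp add: sum_distrib_left mult_ac)
  also have "\<dots> \<le> (\<Sum>p\<in>?P. real n * ln (real p) * (1 / (real p - 1)))"
    by (intro sum_mono mult_left_mono sum_inverse_powers_le mult_nonneg_nonneg ln_ge_zero) (auto dest: prime_ge_1_nat)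
  also have "\<dots> = real n * (\<Sum>p\<in>?P. ln (real p) / (real p - 1))"
    by (simp add: sum_distrib_left)
  finally show ?thesis using assms by simp
qed

lemma sum_ln_div_pred_le: "(\<Sum>m=2..n. ln (real m) / (real m * (real m - 1))) \<le> 4"
proof -
  \<comment> \<open>A telescoping majorant: with \<open>a = sqrt n\<close> and
    \<open>b = sqrt (n + 1)\<close>, the bound \<open>ln (b^2) <= 2 (b - 1) <= 2 a\<close> shows
    that the new term is at most \<open>4/a - 4/b\<close>.\<close>
  have "(\<Sum>m=2..n. ln (real m) / (real m * (real m - 1))) \<le> 4 - 4 / sqrt (real n)" if "n \<ge> 1"
    using that
  proof (induction n rule: nat_induct_at_least)
    case (Suc n)
    define a b where "a = sqrt (real n)" and "b = sqrt (real (Suc n))"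
    have ab: "1 \<le> a" "a < b" "b^2 = a^2 + 1" "real n = a^2"
      using Suc.hyps by (simp_all add: a_def b_def)
    have "ln (real (Suc n)) = 2 * ln b"
      by (simp add: b_def ln_sqrt)
    also have "ln b \<le> b - 1"
      using ab by (intro ln_le_minus_one) auto
    also have "b - 1 \<le> a"
    proof -
      have "b^2 \<le> (a + 1)^2"
        using ab(1) unfolding ab(3) by (simp add: power2_sum)
      hence "b \<le> a + 1"
        by (rule power2_le_imp_le) (use ab(1) in simp)
      thus ?thesis by simp
    qed
    finally have "ln (real (Suc n)) / (b^2 * a^2) \<le> 2 * a / (b^2 * a^2)"
      by (intro divide_right_mono) auto
    also have "\<dots> \<le> 4 / a - 4 / b"
    proof -
      have "(b - a) * (b + a) = 1"
        using ab(3) by (simp add: algebra_simps power2_eq_square)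
      moreover have "(b - a) * (b + a) \<le> (b - a) * (2 * b)"
        using ab(1,2) by (intro mult_left_mono) auto
      ultimately have "1 \<le> (b - a) * (2 * b)" by simp
      hence "2 * 1 / (a * b * b) \<le> 2 * ((b - a) * (2 * b)) / (a * b * b)"
        using ab(1,2) by (intro divide_right_mono mult_left_mono) auto
      also have "\<dots> = 4 / a - 4 / b"
        using ab(1,2) by (simp add: field_simps)
      also have "2 * 1 / (a * b * b) = 2 * a / (b^2 * a^2)"
        using ab(1,2) by (simp add: power2_eq_square)
      finally show ?thesis .
    qed
    finally have "ln (real (Suc n)) / (real (Suc n) * (real (Suc n) - 1)) \<le> 4 / a - 4 / b"
      using ab by (simp add: add.commute[of 1])
    thus ?case
      using Suc by (simp add: a_def b_def)
  qed simp
  moreover have "4 - 4 / sqrt (real n) \<le> 4" by simp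
  ultimately show ?thesis
    by (cases "n \<ge> 1") (auto intro: order_trans)
qed

lemma sum_ln_primes_div_pred_le:
  "(\<Sum>p | prime p \<and> p \<le> n. ln (real p) / (real p - 1)) \<le> (\<Sum>p | prime p \<and> p \<le> n. ln (real p) / real p) + 4"
proof -
  let ?P = "{p. prime p \<and> p \<le> n}"
  have "(\<Sum>p\<in>?P. ln (real p) / (real p - 1)) - (\<Sum>p\<in>?P. ln (real p) / real p)
        = (\<Sum>p\<in>?P. ln (real p) / (real p * (real p - 1)))"
    unfolding sum_subtractf[symmetric]
  proof (intro sum.cong refl)
    fix p assume "p \<in> ?P"
    hence "real p \<ge> 2" using prime_ge_2_nat[of p] by auto
    thus "ln (real p) / (real p - 1) - ln (real p) / real p = ln (real p) / (real p * (real p - 1))"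
      by (simp add: field_simps)
  qed
  also have "\<dots> \<le> (\<Sum>m=2..n. ln (real m) / (real m * (real m - 1)))"
    by (intro sum_mono2) (auto dest: prime_ge_2_nat)
  also have "\<dots> \<le> 4" by (rule sum_ln_div_pred_le)
  finally show ?thesis by simp
qed

text \<open>Integral \<open>k\<close> as logarithm of the cutoff: Mertens sums grow linearly in
  \<open>k\<close>, so that sums over successive blocks of primes can be compared with harmonic
  numbers.\<close>

definition primes_exp :: "nat \<Rightarrow> nat set" where
  "primes_exp k = {p. prime p \<and> real p \<le> exp (real k)}"

text \<open>\<open>1 / (p - 1)\<close> is the sum of all \<open>1 / p^k\<close>, as in
  \<open>log_moment_1_le\<close>, and it also dominates \<open>- ln (1 - 1/p)\<close>.\<close>

definition mertens_sum :: "nat \<Rightarrow> real" where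
  "mertens_sum k = (\<Sum>p\<in>primes_exp k. ln (real p) / (real p - 1))"

lemma primes_exp_0: "primes_exp 0 = {}"
  by (auto simp: primes_exp_def dest: prime_ge_2_nat)

lemma primes_exp_eq: "primes_exp k = {p. prime p \<and> p \<le> nat \<lfloor>exp (real k)\<rfloor>}"
  by (auto simp: primes_exp_def le_nat_iff le_floor_iff)


interpretation primes_exp: prime_set "primes_exp k" for k
  by unfold_locales (auto simp: primes_exp_eq)

lemma ln_nat_floor_exp: "real k - 1 \<le> ln (real (nat \<lfloor>exp (real k)\<rfloor>))" "ln (real (nat \<lfloor>exp (real k)\<rfloor>)) \<le> real k"
  "nat \<lfloor>exp (real k)\<rfloor> > 0"
proof -
  have pos: "nat \<lfloor>exp (real k)\<rfloor> > 0"
    using one_le_exp_iff[of "real k"] by linarith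
  show "nat \<lfloor>exp (real k)\<rfloor> > 0" by (rule pos)
  have "real (nat \<lfloor>exp (real k)\<rfloor>) \<le> exp (real k)"
    by simp
  thus "ln (real (nat \<lfloor>exp (real k)\<rfloor>)) \<le> real k"
    using pos ln_mono[of "real (nat \<lfloor>exp (real k)\<rfloor>)" "exp (real k)"] by simp
  have "exp (real k) \<le> real (nat \<lfloor>exp (real k)\<rfloor>) + 1"
    by linarith
  also have "\<dots> \<le> 2 * real (nat \<lfloor>exp (real k)\<rfloor>)"
    using pos by linarith
  also have "\<dots> \<le> exp 1 * real (nat \<lfloor>exp (real k)\<rfloor>)"
    using exp_ge_add_one_self[of 1] by (intro mult_right_mono) auto
  finally have "exp (real k - 1) \<le> real (nat \<lfloor>exp (real k)\<rfloor>)"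
    by (simp add: exp_diff field_simps)
  thus "real k - 1 \<le> ln (real (nat \<lfloor>exp (real k)\<rfloor>))"
    using ln_mono[of "exp (real k - 1)"] by simp
qed

lemma ln4_le: "ln (4::real) \<le> 2"
proof -
  have "ln (4::real) = 2 * ln 2"
    using ln_realpow[of 2 2] by simp
  thus ?thesis using ln_2_less_1 by simp
qed

text \<open>The constants collect \<open>ln 4 <= 2\<close>, the bound 4 for the prime-power
  correction, 1 from Stirling's bound and 1 from rounding \<open>e^k\<close> down.\<close>

lemma sum_primes_exp_bounds:
  "(\<Sum>p\<in>primes_exp k. ln (real p) / real p) \<le> real k + 2"
  "(\<Sum>p\<in>primes_exp k. ln (real p) / real p) \<ge> real k - 6"
  "mertens_sum k \<le> real k + 6" "mertens_sum k \<ge> real k - 2"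
proof -
  note b = sum_ln_primes_div_le[of "nat \<lfloor>exp (real k)\<rfloor>", folded primes_exp_eq]
    sum_ln_primes_div_pred_le[of "nat \<lfloor>exp (real k)\<rfloor>", folded primes_exp_eq mertens_sum_def]
    sum_ln_primes_div_pred_ge[OF ln_nat_floor_exp(3)[of k], folded primes_exp_eq mertens_sum_def]
    ln_nat_floor_exp[of k] ln4_le
  show "(\<Sum>p\<in>primes_exp k. ln (real p) / real p) \<le> real k + 2" using b by linarith
  show "(\<Sum>p\<in>primes_exp k. ln (real p) / real p) \<ge> real k - 6" using b by linarith
  show "mertens_sum k \<le> real k + 6" using b by linarith
  show "mertens_sum k \<ge> real k - 2" using b by linarith
qed

lemma primes_exp_mono: "j \<le> k \<Longrightarrow> primes_exp j \<subseteq> primes_exp k"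
  by (auto simp: primes_exp_def intro: order_trans)

text \<open>Only primes above \<open>e^j\<close> are used. There \<open>ln p >= j\<close>, and their
  sum of \<open>ln p / p\<close> is at least \<open>(k - 6) - (j + 2)\<close>.\<close>

lemma sum_ln_sq_primes_exp_ge:
  assumes "j \<le> k"
  shows "(\<Sum>p\<in>primes_exp k. ln (real p) ^ 2 / real p) \<ge> real j * (real k - real j - 8)"
proof -
  have "real j * (real k - real j - 8)
        \<le> real j * ((\<Sum>p\<in>primes_exp k. ln (real p) / real p) - (\<Sum>p\<in>primes_exp j. ln (real p) / real p))"
    using sum_primes_exp_bounds(2)[of k] sum_primes_exp_bounds(1)[of j]
    by (intro mult_left_mono) auto
  also have "\<dots> = (\<Sum>p\<in>primes_exp k - primes_exp j. real j * (ln (real p) / real p))"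
    using primes_exp_mono[OF assms] primes_exp.finite_P by (simp add: sum_diff sum_distrib_left right_diff_distrib)
  also have "\<dots> \<le> (\<Sum>p\<in>primes_exp k - primes_exp j. ln (real p) * (ln (real p) / real p))"
  proof (intro sum_mono mult_right_mono)
    fix p assume p: "p \<in> primes_exp k - primes_exp j"
    hence "exp (real j) < real p" by (auto simp: primes_exp_def)
    thus "real j \<le> ln (real p)"
      using ln_mono[of "exp (real j)" "real p"] by simp
  qed (auto dest: primes_exp.P_ge_2)
  also have "\<dots> \<le> (\<Sum>p\<in>primes_exp k. ln (real p) * (ln (real p) / real p))"
    using primes_exp.finite_P by (intro sum_mono2) (auto dest: primes_exp.P_ge_2)
  finally show ?thesis by (simp add: power2_eq_square)
qed

section \<open>Mertens' third theorem, lower bound\<close>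

definition euler_log :: "nat \<Rightarrow> real" where
  "euler_log k = (\<Sum>p\<in>primes_exp k. - ln (1 - 1 / real p))"

text \<open>Each Euler factor contributes \<open>- ln (1 - 1/p) <= 1 / (p - 1)\<close>, and
  inserting \<open>ln p / j >= 1\<close> for primes above \<open>e^j\<close> turns this into an
  increment of \<open>mertens_sum\<close>.\<close>

lemma euler_log_Suc_le:
  assumes "j \<ge> 1"
  shows "euler_log (Suc j) - euler_log j \<le> (mertens_sum (Suc j) - mertens_sum j) / real j"
proof -
  let ?D = "primes_exp (Suc j) - primes_exp j"
  have sub: "primes_exp j \<subseteq> primes_exp (Suc j)" by (intro primes_exp_mono) simp
  have "euler_log (Suc j) - euler_log j = (\<Sum>p\<in>?D. - ln (1 - 1 / real p))"
    unfolding euler_log_def using sub primes_exp.finite_P by (subst sum_diff) auto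
  also have "\<dots> \<le> (\<Sum>p\<in>?D. ln (real p) / (real p - 1) / real j)"
  proof (rule sum_mono)
    fix p assume p: "p \<in> ?D"
    have p2: "real p \<ge> 2" using primes_exp.P_ge_2 p by force
    have "exp (real j) < real p" using p by (auto simp: primes_exp_def)
    hence lnp: "real j \<le> ln (real p)"
      using ln_mono[of "exp (real j)" "real p"] by simp
    have "- ln (1 - 1 / real p) = ln (1 / (1 - 1 / real p))"
      using p2 by (simp add: ln_div)
    also have "\<dots> \<le> 1 / (1 - 1 / real p) - 1"
      using p2 by (intro ln_le_minus_one) auto
    also have "\<dots> = 1 / (real p - 1)"
      using p2 by (simp add: field_simps)
    also have "\<dots> \<le> ln (real p) / (real p - 1) / real j"
      using divide_right_mono[of 1 "ln (real p) / real j" "real p - 1"] lnp p2 assms by (simp add: mult.commute)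
    finally show "- ln (1 - 1 / real p) \<le> ln (real p) / (real p - 1) / real j" .
  qed
  also have "\<dots> = (mertens_sum (Suc j) - mertens_sum j) / real j"
    unfolding mertens_sum_def using sub primes_exp.finite_P
    by (subst sum_diff[symmetric]) (auto simp: sum_divide_distrib)
  finally show ?thesis .
qed

text \<open>Partial summation with \<open>mertens_sum k = k + E k\<close> and \<open>E\<close>
  bounded by 6: the linear part reproduces the harmonic numbers, and \<open>E\<close> only
  contributes boundary terms and a telescoping sum of size \<open>O(1/i)\<close>.\<close>

lemma euler_log_diff_le:
  assumes "1 \<le> i" "i \<le> j"
  shows "euler_log j - harm j \<le> euler_log i - harm i + 20 / real i"
proof -
  define E where "E = (\<lambda>k. mertens_sum k - real k)"
  have E: "\<bar>E k\<bar> \<le> 6" for k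
    using sum_primes_exp_bounds(3,4)[of k] by (auto simp: E_def)
  have "euler_log j - harm j \<le> euler_log i - harm i + 7 * (1 / real i - 1 / real j) + E j / real j + (- E i / real i)"
    using assms(2)
  proof (induction j rule: nat_induct_at_least)
    case (Suc j)
    have j: "real j \<ge> 1" using Suc.hyps assms(1) by simp
    have "euler_log (Suc j) \<le> euler_log j + (1 + E (Suc j) - E j) / real j"
      using euler_log_Suc_le[of j] j by (simp add: E_def algebra_simps)
    \<comment> \<open>Abel's rearrangement: the division by \<open>j\<close> is replaced by
      \<open>Suc j\<close>, so that \<open>E j / j\<close> telescopes; \<open>1 + E\<close> is at
      most 7.\<close>
    also have "(1 + E (Suc j) - E j) / real j
      = 1 / real (Suc j) + (1 + E (Suc j)) * (1 / real j - 1 / real (Suc j)) + E (Suc j) / real (Suc j) - E j / real j"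
      by (simp add: algebra_simps add_divide_distrib diff_divide_distrib)
    also have "(1 + E (Suc j)) * (1 / real j - 1 / real (Suc j)) \<le> 7 * (1 / real j - 1 / real (Suc j))"
      using E[of "Suc j"] j by (intro mult_right_mono) (auto simp: field_simps)
    finally show ?case
      using Suc.IH by (simp add: harm_Suc inverse_eq_divide algebra_simps)
  qed simp
  moreover have "E j / real j \<le> 6 / real j"
    using E[of j] by (intro divide_right_mono) auto
  moreover have "- E i / real i \<le> 6 / real i"
    using E[of i] by (intro divide_right_mono) auto
  \<comment> \<open>The left side equals \<open>13/i - 1/j\<close>; the constant 20 is a generous
    round value.\<close>
  moreover have "7 * (1 / real i - 1 / real j) + 6 / real j + 6 / real i \<le> 20 / real i"
  proof -
    have "7 * (a - b) + 6 * b + 6 * a \<le> 20 * a" if "0 \<le> a" "0 \<le> b" for a b :: real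
      using that by simp
    from this[of "1 / real i" "1 / real j"] show ?thesis by simp
  qed
  ultimately show ?thesis by linarith
qed

text \<open>Summation by parts writes the difference with nonnegative coefficients
  \<open>w k - w (k + 1)\<close>. The induction carries the boundary term
  \<open>w K * (V K - U K)\<close> explicitly.\<close>

lemma sum_abel_mono:
  fixes w U V :: "nat \<Rightarrow> real"
  assumes "decseq w" "\<And>k. w k \<ge> 0" "\<And>k. U k \<le> V k" "U 0 = V 0"
  shows "(\<Sum>k=1..K. w k * (U k - U (k - 1))) \<le> (\<Sum>k=1..K. w k * (V k - V (k - 1)))"
proof -
  have "w K * (V K - U K) \<le> (\<Sum>k=1..K. w k * (V k - V (k - 1))) - (\<Sum>k=1..K. w k * (U k - U (k - 1)))"
  proof (induction K)
    case 0
    show ?case using assms(4) by simp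
  next
    case (Suc K)
    have "w (Suc K) * (V K - U K) \<le> w K * (V K - U K)"
      using assms(1,3) by (intro mult_right_mono) (auto simp: decseq_Suc_iff)
    thus ?case using Suc by (simp add: algebra_simps)
  qed
  moreover have "0 \<le> w K * (V K - U K)"
    using assms(2,3) by simp
  ultimately show ?thesis by linarith
qed

text \<open>Concavity of \<open>ln\<close> on the segment from \<open>1 - b\<close> to 1. With
  \<open>a = p^(-d)\<close> and \<open>b = 1/p\<close> it detaches the damping factor
  \<open>p^(-d)\<close> from an Euler factor at \<open>1 + d\<close>.\<close>

lemma ln_concave_scale:
  assumes "0 \<le> a" "a \<le> 1" "0 \<le> b" "b < (1::real)"
  shows "- ln (1 - a * b) \<le> a * (- ln (1 - b))"
proof -
  have "(1 - a) * ln 1 + a * ln (1 - b) \<le> ln ((1 - a) *\<^sub>R 1 + a *\<^sub>R (1 - b))"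
    using assms by (intro concave_onD[OF ln_concave]) auto
  also have "(1 - a) *\<^sub>R 1 + a *\<^sub>R (1 - b) = 1 - a * b"
    by (simp add: algebra_simps)
  finally show ?thesis by simp
qed

text \<open>Comparison with the integral of \<open>x^(-1-d)\<close> over \<open>[1, N + 1]\<close>,
  done by induction; one step amounts to \<open>1 - d/x <= (1 + 1/x)^(-d)\<close>.\<close>

lemma sum_powr_ge:
  assumes "d > 0"
  shows "(\<Sum>n=1..N. real n powr (-(1 + d))) \<ge> (1 - (real N + 1) powr (-d)) / d"
proof (induction N)
  case (Suc N)
  define x where "x = real N + 1"
  have x: "x \<ge> 1" by (simp add: x_def)
  have "x powr (-d) * (1 - d / x) \<le> x powr (-d) * exp (- d * ln (1 + 1 / x))"
  proof (intro mult_left_mono)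
    have "ln (1 + 1 / x) \<le> 1 / x"
      using x by (intro ln_add_one_self_le_self) auto
    hence "d * ln (1 + 1 / x) \<le> d * (1 / x)"
      using assms by (intro mult_left_mono) auto
    hence "1 - d / x \<le> 1 + (- d * ln (1 + 1 / x))"
      by simp
    also have "\<dots> \<le> exp (- d * ln (1 + 1 / x))"
      by (rule exp_ge_add_one_self)
    finally show "1 - d / x \<le> exp (- d * ln (1 + 1 / x))" .
  qed simp
  also have "exp (- d * ln (1 + 1 / x)) = (1 + 1 / x) powr (-d)"
    using x by (simp add: powr_def add_nonneg_eq_0_iff)
  also have "x powr (-d) * (1 + 1 / x) powr (-d) = (x + 1) powr (-d)"
    using x by (subst powr_mult[symmetric]) (auto simp: distrib_left)
  finally have "x powr (-d) * (1 - d / x) \<le> (x + 1) powr (-d)" .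
  hence "x powr (-d) - (x + 1) powr (-d) \<le> d * x powr (-(1 + d))"
  proof -
    have "-(1 + d) = -d - 1" by simp
    hence "x powr (-(1 + d)) = x powr (-d) / x"
      using x by (simp only: powr_diff powr_one)
    thus ?thesis
      using \<open>x powr (-d) * (1 - d / x) \<le> (x + 1) powr (-d)\<close> by (simp add: algebra_simps)
  qed
  hence "(x powr (-d) - (x + 1) powr (-d)) / d \<le> x powr (-(1 + d))"
    using assms by (simp add: field_simps)
  thus ?case
    using Suc by (simp add: x_def diff_divide_distrib add_ac)
qed simp


text \<open>The Euler product at \<open>1 + d\<close> dominates the sum. After \<open>p^(-d)\<close>
  is detached by concavity, it is at most \<open>e^(-d(k-1))\<close> on the block of primes in
  \<open>(e^(k-1), e^k]\<close>.\<close>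

lemma ln_sum_powr_le:
  assumes "d > 0"
  shows "ln (\<Sum>n=1..nat \<lfloor>exp (real K)\<rfloor>. real n powr (-(1 + d)))
         \<le> (\<Sum>k=1..K. exp (- d * real (k - 1)) * (euler_log k - euler_log (k - 1)))"
proof -
  let ?N = "nat \<lfloor>exp (real K)\<rfloor>" and ?w = "\<lambda>k. exp (- d * real (k - 1))"
  \<comment> \<open>The term \<open>n = 1\<close> makes the sum positive, as monotonicity of
    \<open>ln\<close> requires.\<close>
  have "(\<Sum>n=1..?N. real n powr (-(1 + d))) \<ge> (\<Sum>n\<in>{1}. real n powr (-(1 + d)))"
    using ln_nat_floor_exp(3)[of K] by (intro sum_mono2) (auto simp: Suc_le_eq simp del: zero_less_nat_eq)
  hence "ln (\<Sum>n=1..?N. real n powr (-(1 + d))) \<le> ln (\<Prod>p\<in>primes_exp K. 1 / (1 - real p powr (-(1 + d))))"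
    using assms by (intro ln_mono primes_exp.prod_ge_sum_powr) (auto simp: primes_exp_eq)
  also have "\<dots> = (\<Sum>p\<in>primes_exp K. - ln (1 - real p powr (-(1 + d))))"
  proof -
    have "real p powr (-(1 + d)) < 1" if "p \<in> primes_exp K" for p
      using primes_exp.P_ge_2[OF that] assms by (intro powr_less_one) auto
    hence "inverse (1 - real p powr (-(1 + d))) \<noteq> 0" if "p \<in> primes_exp K" for p
      using that by fastforce
    hence "ln (\<Prod>p\<in>primes_exp K. inverse (1 - real p powr (-(1 + d))))
           = (\<Sum>p\<in>primes_exp K. ln (inverse (1 - real p powr (-(1 + d)))))"
      by (intro ln_prod primes_exp.finite_P)
    thus ?thesis
      by (simp only: inverse_eq_divide[symmetric] ln_inverse)
  qed
  also have "\<dots> \<le> (\<Sum>p\<in>primes_exp K. real p powr (-d) * (- ln (1 - 1 / real p)))"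
  proof (rule sum_mono)
    fix p assume p: "p \<in> primes_exp K"
    have p2: "real p \<ge> 2" using primes_exp.P_ge_2[OF p] by simp
    have "real p powr (-(1 + d)) = real p powr (-d) * (1 / real p)"
    proof -
      have "-(1 + d) = -d - 1" by simp
      thus ?thesis
        using p2 by (simp only: powr_diff) simp
    qed
    thus "- ln (1 - real p powr (-(1 + d))) \<le> real p powr (-d) * (- ln (1 - 1 / real p))"
      using p2 powr_less_one[of "real p" "-d"] assms ln_concave_scale[of "real p powr (-d)" "1 / real p"]
      by simp
  qed
  also have "\<dots> \<le> (\<Sum>k=1..K. ?w k * (euler_log k - euler_log (k - 1)))"
  proof (induction K)
    case 0
    show ?case by (simp add: primes_exp_0)
  next
    case (Suc K)
    have sub: "primes_exp K \<subseteq> primes_exp (Suc K)" by (intro primes_exp_mono) simp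
    let ?D = "primes_exp (Suc K) - primes_exp K"
    have "(\<Sum>p\<in>?D. real p powr (-d) * (- ln (1 - 1 / real p))) \<le> (\<Sum>p\<in>?D. ?w (Suc K) * (- ln (1 - 1 / real p)))"
    proof (intro sum_mono mult_right_mono)
      fix p assume p: "p \<in> ?D"
      have p2: "real p \<ge> 2" using primes_exp.P_ge_2 p by force
      have "real p powr (-d) \<le> exp (real K) powr (-d)"
        using p assms by (intro powr_mono2') (auto simp: primes_exp_def)
      thus "real p powr (-d) \<le> ?w (Suc K)"
        by (simp add: powr_def mult.commute)
      show "0 \<le> - ln (1 - 1 / real p)"
        using p2 by (simp add: field_simps)
    qed
    also have "\<dots> = ?w (Suc K) * (euler_log (Suc K) - euler_log K)"
      unfolding euler_log_def sum_distrib_left[symmetric]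
      using sub primes_exp.finite_P by (subst sum_diff) auto
    finally have "(\<Sum>p\<in>?D. real p powr (-d) * (- ln (1 - 1 / real p))) \<le> ?w (Suc K) * (euler_log (Suc K) - euler_log K)" .
    moreover have "(\<Sum>p\<in>primes_exp (Suc K). real p powr (-d) * (- ln (1 - 1 / real p)))
      = (\<Sum>p\<in>?D. real p powr (-d) * (- ln (1 - 1 / real p))) + (\<Sum>p\<in>primes_exp K. real p powr (-d) * (- ln (1 - 1 / real p)))"
      using sub primes_exp.finite_P by (intro sum.subset_diff) auto
    ultimately show ?case using Suc by simp
  qed
  finally show ?thesis .
qed

lemma sum_power_div_le:
  fixes x :: real
  assumes "0 \<le> x" "x < 1"
  shows "(\<Sum>k=1..K. x ^ k / real k) \<le> - ln (1 - x)"
proof -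
  let ?f = "\<lambda>y::real. - ln (1 - y) - (\<Sum>k=1..K. y ^ k / real k)"
  have "?f 0 \<le> ?f x"
  proof (rule DERIV_nonneg_imp_nondecreasing[OF assms(1)])
    fix y assume y: "0 \<le> y" "y \<le> x"
    have "(?f has_real_derivative (1 / (1 - y) - (\<Sum>k=1..K. y ^ (k - 1)))) (at y)"
      using y assms by (auto intro!: derivative_eq_intros sum.cong)
    moreover have "(\<Sum>k=1..K. y ^ (k - 1)) = (\<Sum>k<K. y ^ k)"
      by (intro sum.reindex_bij_witness[of _ Suc "\<lambda>k. k - 1"]) auto
    moreover have "(\<Sum>k<K. y ^ k) = (1 - y ^ K) / (1 - y)"
      using y assms by (subst geometric_sum) (auto simp: field_simps)
    moreover have "(1 - y ^ K) / (1 - y) \<le> 1 / (1 - y)"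
      using y assms by (intro divide_right_mono) auto
    ultimately show "\<exists>z. (?f has_real_derivative z) (at y) \<and> 0 \<le> z"
      by (intro exI[of _ "1 / (1 - y) - (\<Sum>k=1..K. y ^ (k - 1))"]) simp
  qed
  moreover have "(\<Sum>k=1..K. (0::real) ^ k / real k) = 0"
    by (intro sum.neutral) auto
  ultimately show ?thesis by simp
qed

text \<open>
  The constant \<open>e^\<gamma>\<close> enters through a comparison with harmonic numbers. As \<open>d \<rightarrow> 0\<close>, the Euler product
  at \<open>1 + d\<close> bounds the Abel mean of \<open>euler_log\<close> below by \<open>log (1/d)\<close>, while the same Abel mean of
  \<open>harm\<close> is \<open>- log (1 - e^{-d}) = log (1/d) + o(1)\<close>. So the almost decreasing difference
  \<open>euler_log - harm\<close> cannot drop much below \<open>0\<close>.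
\<close>

lemma euler_log_ge_harm:
  assumes "i \<ge> 1"
  shows "euler_log i \<ge> harm i - 20 / real i"
proof -
  \<comment> \<open>By \<open>euler_log_diff_le\<close>, \<open>F\<close> bounds
    \<open>euler_log k - harm k\<close> for all \<open>k >= i\<close>, and \<open>F >= 0\<close> is
    the claim. The finitely many \<open>k < i\<close> are absorbed by \<open>G\<close>;
    \<open>V\<close> is the resulting majorant, set to 0 at 0 to agree with
    \<open>euler_log 0\<close>.\<close>
  define F where "F = euler_log i - harm i + 20 / real i"
  define G where "G = (\<Sum>k\<le>i. \<bar>euler_log k - harm k - F\<bar>)"
  define V where "V = (\<lambda>k::nat. if k = 0 then 0 else harm k + F + (if k < i then G else 0))"
  have G: "G \<ge> 0" unfolding G_def by (intro sum_nonneg) auto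
  have V: "euler_log k \<le> V k" for k
  proof (cases "k \<ge> i")
    case True
    thus ?thesis
      using euler_log_diff_le[OF assms True] assms by (simp add: V_def F_def)
  next
    case False
    show ?thesis
    proof (cases "k = 0")
      case True
      thus ?thesis using True by (simp add: V_def euler_log_def primes_exp_0)
    next
      case k: False
      have "\<bar>euler_log k - harm k - F\<bar> \<le> G"
        unfolding G_def using False by (intro member_le_sum) auto
      thus ?thesis using k False by (simp add: V_def)
    qed
  qed
  have V0: "euler_log 0 = V 0"
    by (simp add: V_def euler_log_def primes_exp_0)
  \<comment> \<open>The factor \<open>exp d\<close> comes from the weights
    \<open>e^(-d(k-1))\<close> in place of \<open>e^(-dk)\<close>. The increments of
    \<open>V\<close> contain \<open>+G\<close> at \<open>k = 1\<close> and \<open>-G\<close> at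
    \<open>k = i\<close>, so \<open>G\<close> survives only with a factor that vanishes as
    \<open>d\<close> tends to 0.\<close>
  have bound: "ln (1 / d) \<le> exp d * (- ln (1 - exp (- d))) + F + G * (1 - exp (- d * real (i - 1)))" if d: "d > 0" for d
  proof -
    let ?w = "\<lambda>k. exp (- d * real (k - 1))"
    let ?R = "exp d * (- ln (1 - exp (- d))) + F + G * (1 - exp (- d * real (i - 1)))"
    have upper: "(\<Sum>k=1..K. ?w k * (V k - V (k - 1))) \<le> ?R" if K: "K \<ge> i" for K
    proof -
      have Vdiff: "V k - V (k - 1) = 1 / real k + (if k = 1 then F + G else 0) - (if k = i then G else 0)" if k1: "k \<ge> 1" for k
      proof (cases "k = 1")
        case True
        thus ?thesis using assms by (auto simp: V_def harm_Suc harm_def)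
      next
        case False
        then obtain m where m: "k = Suc m" "m \<ge> 1" using k1 by (cases k) auto
        show ?thesis unfolding m(1) using m(2)
          by (auto simp: V_def harm_Suc inverse_eq_divide)
      qed
      have "(\<Sum>k=1..K. ?w k * (V k - V (k - 1)))
            = (\<Sum>k=1..K. ?w k * (1 / real k) + (if k = 1 then ?w 1 * (F + G) else 0) - (if k = i then ?w i * G else 0))"
      proof (rule sum.cong[OF refl])
        fix k assume "k \<in> {1..K}"
        hence "V k - V (k - 1) = 1 / real k + (if k = 1 then F + G else 0) - (if k = i then G else 0)"
          by (intro Vdiff) auto
        thus "?w k * (V k - V (k - 1)) = ?w k * (1 / real k) + (if k = 1 then ?w 1 * (F + G) else 0) - (if k = i then ?w i * G else 0)"
          by (auto simp only: right_diff_distrib distrib_left mult_zero_right split: if_splits)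
      qed
      also have "\<dots> = (\<Sum>k=1..K. ?w k * (1 / real k)) + ?w 1 * (F + G) - ?w i * G"
        using assms K by (simp add: sum.distrib sum_subtractf)
      also have "(\<Sum>k=1..K. ?w k * (1 / real k)) = exp d * (\<Sum>k=1..K. exp (- d * real k) / real k)"
        unfolding sum_distrib_left
        by (intro sum.cong refl) (auto simp: exp_add[symmetric] of_nat_diff algebra_simps)
      also have "\<dots> \<le> exp d * (- ln (1 - exp (- d)))"
        using d sum_power_div_le[of "exp (- d)" K]
        by (intro mult_left_mono) (auto simp: exp_of_nat_mult[symmetric] mult.commute)
      finally show ?thesis by (simp add: algebra_simps)
    qed
    let ?N = "\<lambda>K. nat \<lfloor>exp (real K)\<rfloor>"
    have "ln ((1 - (real (?N K) + 1) powr (-d)) / d) \<le> ?R" if K: "K \<ge> i" for K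
    proof -
      have "(real (?N K) + 1) powr (-d) < 1"
        using ln_nat_floor_exp(3)[of K] d by (intro powr_less_one) auto
      hence "ln ((1 - (real (?N K) + 1) powr (-d)) / d) \<le> ln (\<Sum>n=1..?N K. real n powr (-(1 + d)))"
        using d by (intro ln_mono sum_powr_ge) auto
      also have "\<dots> \<le> (\<Sum>k=1..K. ?w k * (euler_log k - euler_log (k - 1)))"
        by (rule ln_sum_powr_le[OF d])
      also have "\<dots> \<le> (\<Sum>k=1..K. ?w k * (V k - V (k - 1)))"
        using V V0 d by (intro sum_abel_mono) (auto simp: decseq_Suc_iff)
      also have "\<dots> \<le> ?R" by (rule upper[OF K])
      finally show ?thesis .
    qed
    \<comment> \<open>\<open>K\<close> tends to infinity with \<open>d\<close> fixed; only
      afterwards does \<open>d\<close> tend to 0.\<close>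
    moreover have "(\<lambda>K. ln ((1 - (real (?N K) + 1) powr (-d)) / d)) \<longlonglongrightarrow> ln ((1 - 0) / d)"
    proof (intro tendsto_intros)
      show "(\<lambda>K. (real (?N K) + 1) powr (-d)) \<longlonglongrightarrow> 0"
        using d by real_asymp
    qed (use d in auto)
    ultimately show ?thesis
      by (intro LIMSEQ_le_const2[of "\<lambda>K. ln ((1 - (real (?N K) + 1) powr (-d)) / d)"]) auto
  qed
  have "F \<ge> 0"
  proof (rule tendsto_lowerbound[of _ F "at_right 0"])
    have l1: "((\<lambda>d::real. exp d * (- ln (1 - exp (- d))) - ln (1 / d)) \<longlongrightarrow> 0) (at_right 0)"
      by real_asymp
    have l2: "((\<lambda>d::real. G * (1 - exp (- d * real (i - 1)))) \<longlongrightarrow> G * (1 - exp (- 0 * real (i - 1)))) (at_right 0)"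
      by (intro tendsto_intros)
    show "((\<lambda>d. (exp d * (- ln (1 - exp (- d))) - ln (1 / d)) + F + G * (1 - exp (- d * real (i - 1)))) \<longlongrightarrow> F) (at_right 0)"
      using tendsto_add[OF tendsto_add[OF l1 tendsto_const[of F]] l2] by simp
    show "eventually (\<lambda>d. 0 \<le> (exp d * (- ln (1 - exp (- d))) - ln (1 / d)) + F + G * (1 - exp (- d * real (i - 1)))) (at_right 0)"
      using eventually_at_right_less[of 0]
    proof eventually_elim
      case (elim d)
      thus ?case using bound[of d] by linarith
    qed
  qed auto
  thus ?thesis by (simp add: F_def)
qed

text \<open>\<open>harm i - ln i\<close> decreases to \<open>euler_mascheroni\<close> and therefore
  never falls below it.\<close>

lemma prod_primes_exp_ge:
  assumes "i \<ge> 1"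
  shows "(\<Prod>p\<in>primes_exp i. 1 / (1 - 1 / real p)) \<ge> exp euler_mascheroni * real i * exp (- 20 / real i)"
proof -
  have "harm i - ln (real i) \<ge> (euler_mascheroni :: real)"
  proof (rule LIMSEQ_le_const2[OF euler_mascheroni_LIMSEQ])
    show "\<exists>N. \<forall>n\<ge>N. harm n - ln (real n) \<le> harm i - ln (real i)"
      using euler_mascheroni_sequence_decreasing[of i] assms by (intro exI[of _ i]) auto
  qed
  hence "euler_mascheroni + ln (real i) - 20 / real i \<le> euler_log i"
    using euler_log_ge_harm[OF assms] by linarith
  hence "exp (euler_mascheroni + ln (real i) - 20 / real i) \<le> exp (euler_log i)"
    by simp
  also have "exp (euler_log i) = (\<Prod>p\<in>primes_exp i. 1 / (1 - 1 / real p))"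
    unfolding euler_log_def
    by (subst exp_sum) (auto simp: primes_exp.finite_P exp_minus inverse_eq_divide dest!: primes_exp.P_ge_2 intro!: prod.cong)
  also have "exp (euler_mascheroni + ln (real i) - 20 / real i) = exp euler_mascheroni * real i * exp (- 20 / real i)"
    using assms by (simp add: exp_add exp_diff exp_minus divide_inverse)
  finally show ?thesis .
qed

section \<open>Logarithmic moments over smooth numbers\<close>

text \<open>\<open>L\<close> stands for \<open>ln (ln T)\<close>, which exceeds \<open>k\<close> by
  a factor of at most \<open>1 / (1 - e)\<close>. The condition \<open>e < 1/11\<close> gives
  \<open>L <= 1.1 k\<close>, exactly what the second moment can absorb in every power
  \<open>l >= 2\<close>.\<close>

lemma log_moment_asymp:
  assumes "0 < e" "e < 1 / 11"
  shows "\<forall>\<^sub>F k in sequentially. \<forall>(l::nat) L. 0 \<le> L \<longrightarrow> (1 - e) * L \<le> real k \<longrightarrow>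
    (1 - e)^2 * (exp euler_mascheroni / (real l + 1) * L ^ (l + 1)) \<le> log_moment l (primes_exp k) (exp (real k ^ 2))"
proof -
  have ev1: "\<forall>\<^sub>F k in sequentially. (1 - (real k + 6) / real k ^ 2) * exp (- 20 / real k) \<ge> 1 - e"
  proof -
    have "((\<lambda>k. (1 - (real k + 6) / real k ^ 2) * exp (- 20 / real k)) \<longlongrightarrow> 1) sequentially"
      by real_asymp
    hence "\<forall>\<^sub>F k in sequentially. (1 - (real k + 6) / real k ^ 2) * exp (- 20 / real k) > 1 - e"
      using assms by (intro order_tendstoD) auto
    thus ?thesis by (rule eventually_mono) simp
  qed
  \<comment> \<open>The limiting ratio to \<open>k\<close> is 1. The value \<open>3/4\<close> is a
    convenient choice, as \<open>3/4 * 10/11\<close> still exceeds the \<open>1/2\<close> required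
    for \<open>l = 1\<close>.\<close>
  have ev2: "\<forall>\<^sub>F k in sequentially. (real k - 6) * (1 - (real k + 6) / (real k ^ 2 - real k)) \<ge> real k * (3 / 4)"
    by real_asymp
  \<comment> \<open>Splitting the primes at \<open>e^(k/2)\<close> gives \<open>k^2/4\<close> from
    the squares of \<open>ln p\<close>, besides \<open>k^2\<close> from the squared first sum. The
    limit \<open>5/4\<close> exceeds \<open>1.1^2 = 1.21\<close>.\<close>
  have ev3: "\<forall>\<^sub>F k in sequentially. ((real k / 2 - 1) * (real k / 2 - 8) + (real k - 6) ^ 2) * (1 - (real k + 6) / (real k ^ 2 - 2 * real k))
      \<ge> (11 / 10 * real k) ^ 2"
  proof -
    have "((\<lambda>k. ((real k / 2 - 1) * (real k / 2 - 8) + (real k - 6) ^ 2) * (1 - (real k + 6) / (real k ^ 2 - 2 * real k)) / real k ^ 2)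
      \<longlongrightarrow> 5 / 4) sequentially"
      by real_asymp
    hence "\<forall>\<^sub>F k in sequentially. ((real k / 2 - 1) * (real k / 2 - 8) + (real k - 6) ^ 2) * (1 - (real k + 6) / (real k ^ 2 - 2 * real k)) / real k ^ 2 > (11 / 10) ^ 2"
      by (rule order_tendstoD) (simp add: power2_eq_square)
    thus ?thesis
      using eventually_gt_at_top[of 0]
      by eventually_elim (simp add: pos_less_divide_eq power_mult_distrib power_divide less_imp_le)
  qed
  show ?thesis
    \<comment> \<open>\<open>k >= 16\<close> keeps \<open>k/2 - 8\<close> nonnegative and both
      reduced cutoffs \<open>k^2 - k\<close> and \<open>k^2 - 2k\<close> above
      \<open>k + 6\<close>.\<close>
    using ev1 ev2 ev3 eventually_ge_at_top[of 16]
  proof eventually_elim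
    case (elim k)
    let ?P = "primes_exp k" and ?x = "exp (real k ^ 2)" and ?y = "exp (real k)"
    let ?W = "log_moment 0 ?P ?x" and ?g = "exp (euler_mascheroni :: real)"
    have k: "real k \<ge> 16" using elim by simp
    have ge: "real k ^ 2 - 2 * real k \<ge> real k + 6"
    proof -
      have "16 * real k \<le> real k * real k" using k by (intro mult_right_mono) auto
      thus ?thesis using k unfolding power2_eq_square by linarith
    qed
    have Q: "(\<Sum>p\<in>?P. ln (real p) / (real p - 1)) \<le> real k + 6"
      using sum_primes_exp_bounds(3)[of k] by (simp add: mertens_sum_def)
    have W: "?W \<ge> (1 - e) * ?g * real k"
    proof -
      have "(1 - e) * ?g * real k \<le> ((1 - (real k + 6) / real k ^ 2) * exp (- 20 / real k)) * ?g * real k"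
        using elim(1) by (intro mult_right_mono) auto
      also have "\<dots> = (1 - (real k + 6) / real k ^ 2) * (?g * real k * exp (- 20 / real k))"
        by simp
      also have "\<dots> \<le> (1 - (\<Sum>p\<in>?P. ln (real p) / (real p - 1)) / ln ?x) * (\<Prod>p\<in>?P. 1 / (1 - 1 / real p))"
      proof (rule mult_mono)
        show "1 - (real k + 6) / real k ^ 2 \<le> 1 - (\<Sum>p\<in>?P. ln (real p) / (real p - 1)) / ln ?x"
          using Q by (simp add: divide_right_mono)
        show "?g * real k * exp (- 20 / real k) \<le> (\<Prod>p\<in>?P. 1 / (1 - 1 / real p))"
          using k by (intro prod_primes_exp_ge) auto
        show "0 \<le> 1 - (\<Sum>p\<in>?P. ln (real p) / (real p - 1)) / ln ?x"
          using Q ge k by simp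
      qed simp
      also have "\<dots> \<le> ?W"
        using Q ge k by (intro primes_exp.log_moment_0_ge) auto
      finally show ?thesis .
    qed
    have W0: "?W \<ge> 0" by (rule log_moment_nonneg)
    have tail: "log_moment 0 ?P (exp u) \<ge> (1 - (real k + 6) / u) * ?W"
      if u: "real k + 6 \<le> u" "u \<le> real k ^ 2" for u
    proof -
      have "(1 - (real k + 6) / u) * ?W \<le> (1 - (\<Sum>p\<in>?P. ln (real p) / (real p - 1)) / ln (exp u)) * ?W"
        using Q W0 u by (intro mult_right_mono) (auto intro!: divide_right_mono)
      also have "\<dots> \<le> log_moment 0 ?P (exp u)"
        using u k by (intro primes_exp.log_moment_0_tail) auto
      finally show ?thesis .
    qed
    have py: "real p \<le> ?y" if "p \<in> ?P" for p using that by (simp add: primes_exp_def)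
    have A: "(\<Sum>p\<in>?P. ln (real p) / real p) \<ge> real k - 6" by (rule sum_primes_exp_bounds)
    have moment1: "log_moment 1 ?P ?x \<ge> real k * (3 / 4) * ?W"
    proof -
      have "real k * (3 / 4) * ?W \<le> (real k - 6) * (1 - (real k + 6) / (real k ^ 2 - real k)) * ?W"
        using elim(2) W0 by (rule mult_right_mono)
      also have "\<dots> \<le> (real k - 6) * log_moment 0 ?P (exp (real k ^ 2 - real k))"
        using tail[of "real k ^ 2 - real k"] ge k by (simp add: mult.assoc mult_left_mono)
      also have "\<dots> \<le> (\<Sum>p\<in>?P. ln (real p) / real p) * log_moment 0 ?P (?x / ?y)"
        using A by (simp add: exp_diff mult_right_mono log_moment_nonneg)
      also have "\<dots> \<le> log_moment 1 ?P ?x"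
        using py by (intro primes_exp.log_moment_1_ge) auto
      finally show ?thesis .
    qed
    have moment2: "log_moment 2 ?P ?x \<ge> (11 / 10 * real k) ^ 2 * ?W"
    proof -
      have B: "(\<Sum>p\<in>?P. ln (real p) ^ 2 / real p) \<ge> (real k / 2 - 1) * (real k / 2 - 8)"
      proof -
        have "real (k div 2) \<ge> real k / 2 - 1" "real (k div 2) \<le> real k / 2"
          by linarith+
        hence "(real k / 2 - 1) * (real k / 2 - 8) \<le> real (k div 2) * (real k - real (k div 2) - 8)"
          using k by (intro mult_mono) auto
        also have "\<dots> \<le> (\<Sum>p\<in>?P. ln (real p) ^ 2 / real p)"
          by (intro sum_ln_sq_primes_exp_ge) auto
        finally show ?thesis .
      qed
      let ?c = "(real k / 2 - 1) * (real k / 2 - 8) + (real k - 6) ^ 2"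
      have c: "0 \<le> ?c" using k by (intro add_nonneg_nonneg mult_nonneg_nonneg) auto
      have "(11 / 10 * real k) ^ 2 * ?W \<le> ?c * (1 - (real k + 6) / (real k ^ 2 - 2 * real k)) * ?W"
        using elim(3) W0 by (rule mult_right_mono)
      also have "\<dots> \<le> ?c * log_moment 0 ?P (exp (real k ^ 2 - 2 * real k))"
        unfolding mult.assoc using tail[of "real k ^ 2 - 2 * real k"] ge k c by (intro mult_left_mono) auto
      also have "exp (real k ^ 2 - 2 * real k) = ?x / ?y ^ 2"
        by (simp add: exp_diff exp_double)
      also have "?c * log_moment 0 ?P (?x / ?y ^ 2)
          \<le> ((\<Sum>p\<in>?P. ln (real p) ^ 2 / real p) + (\<Sum>p\<in>?P. ln (real p) / real p) ^ 2) * log_moment 0 ?P (?x / ?y ^ 2)"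
        using A B k by (intro mult_right_mono add_mono power_mono log_moment_nonneg) auto
      also have "\<dots> \<le> log_moment 2 ?P ?x"
        using py by (intro primes_exp.log_moment_2_ge) auto
      finally show ?thesis .
    qed
    show ?case
    proof (intro allI impI)
      fix l :: nat and L :: real assume L: "0 \<le> L" "(1 - e) * L \<le> real k"
      have e1: "0 < 1 - e" "1 - e \<le> 1" "10 / 11 \<le> 1 - e" using assms by auto
      have "10 / 11 * L \<le> (1 - e) * L" using e1 L by (intro mult_right_mono) auto
      hence L': "L \<le> 11 / 10 * real k" using L by simp
      consider "l = 0" | "l = 1" | "l \<ge> 2" by linarith
      thus "(1 - e)^2 * (?g / (real l + 1) * L ^ (l + 1)) \<le> log_moment l ?P ?x"
      proof cases
        case 1
        have "(1 - e)^2 * (?g * L) = (1 - e) * ?g * ((1 - e) * L)"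
          by (simp add: power2_eq_square)
        also have "\<dots> \<le> (1 - e) * ?g * real k"
          using L e1 by (intro mult_left_mono) auto
        also note W
        finally show ?thesis using 1 by simp
      next
        case 2
        have "(1 - e)^2 * (?g / 2 * L ^ 2) = ?g / 2 * ((1 - e) * L) ^ 2"
          by (simp add: power_mult_distrib)
        also have "\<dots> \<le> ?g / 2 * real k ^ 2"
          using L e1 by (intro mult_left_mono power_mono) auto
        also have "\<dots> \<le> real k * (3 / 4) * ((10 / 11) * ?g * real k)"
          by (simp add: power2_eq_square)
        also have "\<dots> \<le> real k * (3 / 4) * ((1 - e) * ?g * real k)"
          using e1 by (intro mult_left_mono mult_right_mono) auto
        also have "\<dots> \<le> real k * (3 / 4) * ?W"
          using W by (intro mult_left_mono) auto
        also note moment1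
        finally show ?thesis using 2 by (simp add: numeral_2_eq_2)
      next
        case 3
        \<comment> \<open>Only \<open>1 / (l + 1) <= 1/3\<close> is kept of the denominator:
          \<open>1/3 * 11/10 = 11/30\<close> is already below \<open>1 - e\<close>.\<close>
        have "(1 - e)^2 * (?g / (real l + 1) * L ^ (l + 1)) \<le> 1 * (?g / 3 * (L * L ^ l))"
          using 3 e1 L by (intro mult_mono frac_le) (auto simp: power_le_one)
        also have "\<dots> \<le> 1 * (?g / 3 * ((11 / 10 * real k) * (11 / 10 * real k) ^ l))"
          using L L' by (intro mult_left_mono mult_mono power_mono) auto
        also have "\<dots> = (11 / 10 * real k) ^ l * (11 / 30 * ?g * real k)"
          by simp
        also have "\<dots> \<le> (11 / 10 * real k) ^ l * ((1 - e) * ?g * real k)"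
          using e1 by (intro mult_left_mono mult_right_mono) auto
        also have "\<dots> \<le> (11 / 10 * real k) ^ l * ?W"
          using W by (intro mult_left_mono) auto
        also have "\<dots> \<le> log_moment l ?P ?x"
          by (rule log_moment_jensen[OF _ moment2 3]) (use k in simp)
        finally show ?thesis .
      qed
    qed
  qed
qed

section \<open>The resonance inequality\<close>

lemma sin_ge_half:
  assumes "0 \<le> x" "x \<le> (1::real)"
  shows "x / 2 \<le> sin x"
proof -
  have "sin 0 - 0 / 2 \<le> sin x - x / 2"
  proof (rule DERIV_nonneg_imp_nondecreasing[OF assms(1)])
    fix y assume y: "0 \<le> y" "y \<le> x"
    have "cos (pi / 3) \<le> cos y"
      using y assms pi_gt3 by (intro cos_monotone_0_pi_le) auto
    hence "0 \<le> cos y - 1 / 2"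
      by (simp add: cos_60)
    moreover have "((\<lambda>x. sin x - x / 2) has_real_derivative (cos y - 1 / 2)) (at y)"
      by (auto intro!: derivative_eq_intros)
    ultimately show "\<exists>z. ((\<lambda>x. sin x - x / 2) has_real_derivative z) (at y) \<and> 0 \<le> z"
      by blast
  qed
  thus ?thesis by simp
qed

lemma norm_one_minus_cis_ge:
  assumes "\<bar>x\<bar> \<le> 1"
  shows "\<bar>x\<bar> / 2 \<le> norm (1 - cis x)"
proof -
  have "\<bar>x\<bar> / 2 \<le> sin \<bar>x\<bar>"
    using assms by (intro sin_ge_half) auto
  also have "\<dots> \<le> \<bar>Im (1 - cis x)\<bar>"
    by (simp add: abs_if)
  also have "\<dots> \<le> norm (1 - cis x)"
    by (rule abs_Im_le_cmod)
  finally show ?thesis .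
qed

lemma norm_sum_cis_le:
  assumes "x \<noteq> 0" "\<bar>x\<bar> \<le> 1"
  shows "norm (\<Sum>j<J. cis (real j * x)) \<le> 4 / \<bar>x\<bar>"
proof -
  have ge: "\<bar>x\<bar> / 2 \<le> norm (1 - cis x)"
    using assms by (intro norm_one_minus_cis_ge)
  have ne: "cis x \<noteq> 1"
    using ge assms(1) by auto
  have "(\<Sum>j<J. cis (real j * x)) = (\<Sum>j<J. cis x ^ j)"
    by (intro sum.cong refl) (simp only: Complex.DeMoivre)
  also have "\<dots> = (cis x ^ J - 1) / (cis x - 1)"
    using ne by (rule geometric_sum)
  also have "norm \<dots> = norm (cis x ^ J - 1) / norm (1 - cis x)"
    by (simp add: norm_divide norm_minus_commute)
  also have "\<dots> \<le> 2 / (\<bar>x\<bar> / 2)"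
  proof (rule frac_le)
    show "norm (cis x ^ J - 1) \<le> 2"
      using norm_triangle_ineq4[of "cis x ^ J" 1] by (simp add: norm_power)
  qed (use ge assms in auto)
  finally show ?thesis by simp
qed

text \<open>
  The two-fold sum has a triangular weight, so oscillating terms decay quadratically in their
  frequency. A single mean would not suffice: the coefficients \<open>(log n)^\<ell>/n\<close> can sum up to more than \<open>T\<close>.
\<close>

definition grid_mean :: "real \<Rightarrow> real \<Rightarrow> nat \<Rightarrow> (real \<Rightarrow> complex) \<Rightarrow> complex" where
  "grid_mean T h J f = (\<Sum>j<J. \<Sum>k<J. f (T + (real j + real k) * h)) / of_nat (J ^ 2)"

text \<open>The double sum factors into a unimodular number times the square of one geometric sum.
  The bound on \<open>xi * h\<close> excludes aliasing, that is, a nonzero frequency whose phase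
  step on the grid is a multiple of \<open>2 pi\<close>.\<close>

lemma norm_grid_mean_cis_le:
  assumes "xi \<noteq> 0" "\<bar>xi * h\<bar> \<le> 1" "h > 0" "J > 0"
  shows "norm (grid_mean T h J (\<lambda>t. cis (t * xi))) \<le> 16 / (xi * h * real J) ^ 2"
proof -
  let ?S = "\<Sum>j<J. cis (real j * (xi * h))"
  have "(\<Sum>j<J. \<Sum>k<J. cis ((T + (real j + real k) * h) * xi))
        = (\<Sum>j<J. \<Sum>k<J. cis (T * xi) * (cis (real j * (xi * h)) * cis (real k * (xi * h))))"
    by (intro sum.cong refl) (simp add: cis_mult algebra_simps)
  also have "\<dots> = cis (T * xi) * ?S ^ 2"
    unfolding power2_eq_square sum_product by (simp only: sum_distrib_left)
  finally have "norm (grid_mean T h J (\<lambda>t. cis (t * xi))) = norm ?S ^ 2 / real J ^ 2"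
    by (simp add: grid_mean_def norm_divide norm_mult norm_power)
  also have "\<dots> \<le> (4 / \<bar>xi * h\<bar>) ^ 2 / real J ^ 2"
    using assms by (intro divide_right_mono power_mono norm_sum_cis_le) auto
  also have "\<dots> = 16 / (xi * h * real J) ^ 2"
    by (simp add: power_divide power_mult_distrib)
  finally show ?thesis .
qed

lemma grid_mean_sum: "grid_mean T h J (\<lambda>t. \<Sum>i\<in>I. c i * f i t) = (\<Sum>i\<in>I. c i * grid_mean T h J (f i))"
proof -
  have "(\<Sum>j<J. \<Sum>k<J. \<Sum>i\<in>I. c i * f i (T + (real j + real k) * h))
        = (\<Sum>j<J. \<Sum>i\<in>I. \<Sum>k<J. c i * f i (T + (real j + real k) * h))"
    by (intro sum.cong refl sum.swap)
  also have "\<dots> = (\<Sum>i\<in>I. \<Sum>j<J. \<Sum>k<J. c i * f i (T + (real j + real k) * h))"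
    by (rule sum.swap)
  finally show ?thesis
    by (simp add: grid_mean_def sum_divide_distrib sum_distrib_left)
qed

text \<open>Only one of the two integers has to be bounded: a larger \<open>a\<close> only increases
  the gap. Hence the separation of \<open>m\<close> from \<open>m' * n\<close> depends on
  \<open>M\<close> and not on the length \<open>N\<close>.\<close>

lemma abs_ln_diff_ge:
  assumes "a > 0" "b > 0" "a \<noteq> b" "b \<le> (M::nat)"
  shows "\<bar>ln (real a) - ln (real b)\<bar> \<ge> 1 / (2 * real M)"
proof (cases "a < b")
  case True
  have "ln (real a / real b) \<le> real a / real b - 1"
    using assms by (intro ln_le_minus_one) auto
  hence "(real b - real a) / real b \<le> ln (real b) - ln (real a)"
    using assms by (simp add: ln_div diff_divide_distrib)
  moreover have "1 / (2 * real M) \<le> (real b - real a) / real b"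
    using assms True by (intro frac_le) auto
  ultimately show ?thesis by linarith
next
  case False
  have "ln (real b / real a) \<le> real b / real a - 1"
    using assms by (intro ln_le_minus_one) auto
  hence "1 - real b / real a \<le> ln (real a) - ln (real b)"
    using assms by (simp add: ln_div)
  moreover have "real b / real a \<le> real b / (real b + 1)"
    using assms False by (intro divide_left_mono) auto
  moreover have "1 - real b / (real b + 1) = 1 / (real b + 1)"
    by (simp add: field_simps)
  moreover have "1 / (2 * real M) \<le> 1 / (real b + 1)"
    using assms by (intro divide_left_mono) auto
  ultimately show ?thesis by linarith
qed

lemma abs_ln_diff_le:
  assumes "a > 0" "b > 0" "a \<le> B" "b \<le> (B::nat)"
  shows "\<bar>ln (real a) - ln (real b)\<bar> \<le> ln (real B)"
proof -
  have "0 \<le> ln (real a)" "0 \<le> ln (real b)" "ln (real a) \<le> ln (real B)" "ln (real b) \<le> ln (real B)"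
    using assms by auto
  thus ?thesis by linarith
qed

text \<open>Let \<open>R\<close> be the resonator and \<open>f\<close> the Dirichlet polynomial. The
  mean of \<open>|R|^2 f\<close> is at most \<open>Z\<close> times the mean of \<open>|R|^2\<close>,
  while its real part is at least the diagonal \<open>m = m' * n\<close> minus the oscillating
  terms. Each oscillating mean is at most \<open>eta\<close>, where \<open>64 = 16 * 2^2\<close>
  comes from the frequency gap \<open>1 / (2 M)\<close>.\<close>

lemma resonance:
  fixes a :: "nat \<Rightarrow> real" and S :: "nat set"
  assumes S: "finite S" "S \<noteq> {}" "\<And>m. m \<in> S \<Longrightarrow> 0 < m \<and> m \<le> M"
    and a: "\<And>n. a n \<ge> 0"
    and h: "h > 0" "h * ln (real (M * N)) \<le> 1" and J: "J > 0" and N: "N > 0"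
    and Z: "\<And>t. T \<le> t \<Longrightarrow> t \<le> T + 2 * real J * h \<Longrightarrow> norm (\<Sum>n=1..N. of_real (a n) * cis (- (t * ln (real n)))) \<le> Z"
  defines "eta \<equiv> 64 * real M ^ 2 / (h * real J) ^ 2"
  shows "(\<Sum>n=1..N. a n * real (card {m\<in>S. m * n \<in> S})) \<le> real (card S) * (Z * (1 + eta * real (card S)) + eta * real (card S) * (\<Sum>n=1..N. a n))"
proof -
  let ?R = "\<lambda>t. \<Sum>m\<in>S. cis (t * ln (real m))"
  let ?f = "\<lambda>t. \<Sum>n=1..N. of_real (a n) * cis (- (t * ln (real n)))"
  let ?mean = "grid_mean T h J"
  have eta: "eta \<ge> 0" by (simp add: eta_def)
  have Mpos: "M > 0" using S by (metis all_not_in_conv gr0I leD)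
  have Z0: "Z \<ge> 0"
  proof -
    have "norm (?f T) \<le> Z" using h by (intro Z) auto
    thus ?thesis by (rule order_trans[OF norm_ge_zero])
  qed
  have mean_1: "?mean (\<lambda>t. cis (t * 0)) = 1"
    using J by (simp add: grid_mean_def power2_eq_square)
  have mean_small: "norm (?mean (\<lambda>t. cis (t * (ln (real u) - ln (real v))))) \<le> eta"
    if uv: "u > 0" "v > 0" "u \<noteq> v" "u \<le> M" "v \<le> M * N" for u v
  proof -
    let ?xi = "ln (real u) - ln (real v)"
    have ge: "1 / (2 * real M) \<le> \<bar>?xi\<bar>"
      using abs_ln_diff_ge[of v u M] uv by (simp add: abs_minus_commute)
    have "u \<le> M * N" using uv N by (metis Suc_leI le_trans mult.right_neutral mult_le_mono2 One_nat_def)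
    hence "\<bar>?xi\<bar> * h \<le> ln (real (M * N)) * h"
      using uv h by (intro mult_right_mono abs_ln_diff_le) auto
    also have "\<dots> \<le> 1"
      using h(2) by (simp only: mult.commute)
    finally have le: "\<bar>?xi * h\<bar> \<le> 1"
      using h(1) by (simp add: abs_mult)
    have ne: "?xi \<noteq> 0" using ge Mpos by (auto simp: field_simps)
    have "norm (?mean (\<lambda>t. cis (t * ?xi))) \<le> 16 / (?xi * h * real J) ^ 2"
      using ne le h J by (intro norm_grid_mean_cis_le)
    also have "\<dots> = 16 / (\<bar>?xi\<bar> ^ 2 * (h * real J) ^ 2)"
      by (simp add: power_mult_distrib mult.assoc)
    also have "\<dots> \<le> 16 / ((1 / (2 * real M)) ^ 2 * (h * real J) ^ 2)"
      using ge Mpos h J ne by (intro divide_left_mono mult_right_mono power_mono mult_pos_pos) auto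
    also have "\<dots> = eta"
      using Mpos by (simp add: eta_def power_divide power_mult_distrib)
    finally show ?thesis .
  qed
  have sq: "?R t * cnj (?R t) = (\<Sum>(m, m')\<in>S \<times> S. 1 * cis (t * (ln (real m) - ln (real m'))))" for t
    by (simp add: sum_product sum.cartesian_product cis_mult algebra_simps cis_cnj)
  have sqf: "?R t * cnj (?R t) * ?f t
      = (\<Sum>(n, m, m')\<in>{1..N} \<times> S \<times> S. of_real (a n) * cis (t * (ln (real m) - ln (real (m' * n)))))" for t
  proof -
    have "?R t * cnj (?R t) * ?f t = (\<Sum>n=1..N. \<Sum>(m, m')\<in>S \<times> S.
        of_real (a n) * cis (- (t * ln (real n))) * (1 * cis (t * (ln (real m) - ln (real m')))))"
      unfolding sq by (simp add: sum_distrib_left sum_distrib_right case_prod_unfold mult.commute) (rule sum.swap)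
    also have "\<dots> = (\<Sum>n=1..N. \<Sum>(m, m')\<in>S \<times> S. of_real (a n) * cis (t * (ln (real m) - ln (real (m' * n)))))"
    proof (intro sum.cong refl, clarify)
      fix n m m' assume "n \<in> {1..N}" "m \<in> S" "m' \<in> S"
      hence "ln (real (m' * n)) = ln (real m') + ln (real n)"
        using S by (simp add: ln_mult)
      thus "of_real (a n) * cis (- (t * ln (real n))) * (1 * cis (t * (ln (real m) - ln (real m'))))
          = of_real (a n) * cis (t * (ln (real m) - ln (real (m' * n))))"
        by (simp add: cis_mult algebra_simps)
    qed
    finally show ?thesis by (simp add: sum.cartesian_product)
  qed
  have sq_real: "?R t * cnj (?R t) = of_real (norm (?R t) ^ 2)" for t
    by (rule complex_norm_square[symmetric])
  \<comment> \<open>The mean of \<open>|R|^2\<close>: the diagonal gives \<open>card S\<close>, and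
    every other pair contributes at most \<open>eta\<close>.\<close>
  define W where "W = (\<Sum>j<J. \<Sum>k<J. norm (?R (T + (real j + real k) * h)) ^ 2) / real (J ^ 2)"
  have W_eq: "of_real W = ?mean (\<lambda>t. ?R t * cnj (?R t))"
    unfolding W_def grid_mean_def sq_real by simp
  have "W \<le> real (card S) + eta * real (card S) ^ 2"
  proof -
    have "of_real W = (\<Sum>p\<in>S \<times> S. 1 * ?mean (\<lambda>t. cis (t * (ln (real (fst p)) - ln (real (snd p))))))"
      unfolding W_eq sq grid_mean_sum[symmetric] by (simp add: case_prod_unfold)
    hence "norm (complex_of_real W) \<le> (\<Sum>p\<in>S \<times> S. norm (?mean (\<lambda>t. cis (t * (ln (real (fst p)) - ln (real (snd p)))))))"
      by (simp add: norm_sum)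
    also have "\<dots> \<le> (\<Sum>p\<in>S \<times> S. (if fst p = snd p then 1 else 0) + eta)"
    proof (rule sum_mono)
      fix p assume p: "p \<in> S \<times> S"
      show "norm (?mean (\<lambda>t. cis (t * (ln (real (fst p)) - ln (real (snd p)))))) \<le> (if fst p = snd p then 1 else 0) + eta"
      proof (cases "fst p = snd p")
        case True
        thus ?thesis using mean_1 eta by simp
      next
        case False
        have "snd p \<le> M * N"
          using p S(3)[of "snd p"] N by (metis Suc_leI le_trans mult.right_neutral mult_le_mono2 One_nat_def mem_Times_iff)
        thus ?thesis using False p S mean_small[of "fst p" "snd p"] by auto
      qed
    qed
    also have "\<dots> = real (card S) + eta * real (card S) ^ 2"
    proof -
      have "(\<Sum>p\<in>S \<times> S. if fst p = snd p then 1 else (0::real)) = (\<Sum>m\<in>S. \<Sum>m'\<in>S. if m = m' then 1 else 0)"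
        by (simp add: sum.cartesian_product case_prod_unfold)
      also have "\<dots> = real (card S)"
        using S by simp
      finally show ?thesis
        using S by (simp add: sum.distrib card_cartesian_product power2_eq_square)
    qed
    finally show ?thesis by simp
  qed
  moreover have W0: "W \<ge> 0" unfolding W_def by (intro divide_nonneg_nonneg sum_nonneg) auto
  ultimately have WZ: "W * Z \<le> (real (card S) + eta * real (card S) ^ 2) * Z"
    using Z0 by (intro mult_right_mono)
  have up: "norm (?mean (\<lambda>t. ?R t * cnj (?R t) * ?f t)) \<le> W * Z"
  proof -
    have "norm (\<Sum>j<J. \<Sum>k<J. ?R (T + (real j + real k) * h) * cnj (?R (T + (real j + real k) * h)) * ?f (T + (real j + real k) * h))
       \<le> (\<Sum>j<J. \<Sum>k<J. norm (?R (T + (real j + real k) * h)) ^ 2 * Z)"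
    proof (intro sum_norm_le)
      fix j k assume "j \<in> {..<J}" "k \<in> {..<J}"
      hence "(real j + real k) * h \<le> 2 * real J * h"
        using h by (intro mult_right_mono) auto
      hence "norm (?f (T + (real j + real k) * h)) \<le> Z"
        using h by (intro Z) auto
      thus "norm (?R (T + (real j + real k) * h) * cnj (?R (T + (real j + real k) * h)) * ?f (T + (real j + real k) * h))
            \<le> norm (?R (T + (real j + real k) * h)) ^ 2 * Z"
        unfolding norm_mult sq_real by (simp add: norm_power mult_left_mono)
    qed
    hence "norm (?mean (\<lambda>t. ?R t * cnj (?R t) * ?f t)) \<le> (\<Sum>j<J. \<Sum>k<J. norm (?R (T + (real j + real k) * h)) ^ 2 * Z) / real (J ^ 2)"
      unfolding grid_mean_def norm_divide norm_of_nat by (rule divide_right_mono) simp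
    also have "\<dots> = W * Z"
      unfolding W_def times_divide_eq_left sum_distrib_right ..
    finally show ?thesis .
  qed
  have low: "Re (?mean (\<lambda>t. ?R t * cnj (?R t) * ?f t))
      \<ge> (\<Sum>n=1..N. a n * (real (card {m\<in>S. m * n \<in> S}) - eta * real (card S) ^ 2))"
  proof -
    have "?mean (\<lambda>t. ?R t * cnj (?R t) * ?f t)
        = (\<Sum>q\<in>{1..N} \<times> S \<times> S. of_real (a (fst q)) * ?mean (\<lambda>t. cis (t * (ln (real (fst (snd q))) - ln (real (snd (snd q) * fst q))))))"
      unfolding sqf grid_mean_sum[symmetric] by (simp add: case_prod_unfold)
    also have "Re \<dots> = (\<Sum>q\<in>{1..N} \<times> S \<times> S. a (fst q) * Re (?mean (\<lambda>t. cis (t * (ln (real (fst (snd q))) - ln (real (snd (snd q) * fst q)))))))"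
      by simp
    also have "\<dots> \<ge> (\<Sum>q\<in>{1..N} \<times> S \<times> S. a (fst q) * ((if fst (snd q) = snd (snd q) * fst q then 1 else 0) - eta))"
    proof (intro sum_mono mult_left_mono a)
      fix q assume q: "q \<in> {1..N} \<times> S \<times> S"
      show "(if fst (snd q) = snd (snd q) * fst q then 1 else 0) - eta
            \<le> Re (?mean (\<lambda>t. cis (t * (ln (real (fst (snd q))) - ln (real (snd (snd q) * fst q))))))"
      proof (cases "fst (snd q) = snd (snd q) * fst q")
        case True
        thus ?thesis using mean_1 eta by simp
      next
        case False
        have "norm (?mean (\<lambda>t. cis (t * (ln (real (fst (snd q))) - ln (real (snd (snd q) * fst q)))))) \<le> eta"
          using False q S(3) by (intro mean_small) (auto intro!: mult_le_mono)
        thus ?thesis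
          using False abs_Re_le_cmod[of "?mean (\<lambda>t. cis (t * (ln (real (fst (snd q))) - ln (real (snd (snd q) * fst q)))))"]
          by simp
      qed
    qed
    also have "(\<Sum>q\<in>{1..N} \<times> S \<times> S. a (fst q) * ((if fst (snd q) = snd (snd q) * fst q then 1 else 0) - eta))
      = (\<Sum>n=1..N. a n * (\<Sum>m'\<in>S. \<Sum>m\<in>S. (if m = m' * n then 1 else 0) - eta))"
    proof -
      have "(\<Sum>q\<in>{1..N} \<times> S \<times> S. a (fst q) * ((if fst (snd q) = snd (snd q) * fst q then 1 else 0) - eta))
        = (\<Sum>n=1..N. \<Sum>m\<in>S. \<Sum>m'\<in>S. a n * ((if m = m' * n then 1 else 0) - eta))"
        unfolding sum.cartesian_product by (simp add: case_prod_unfold)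
      also have "\<dots> = (\<Sum>n=1..N. \<Sum>m'\<in>S. \<Sum>m\<in>S. a n * ((if m = m' * n then 1 else 0) - eta))"
        by (intro sum.cong refl sum.swap)
      finally show ?thesis
        by (simp only: sum_distrib_left)
    qed
    also have "\<dots> = (\<Sum>n=1..N. a n * (real (card {m\<in>S. m * n \<in> S}) - eta * real (card S) ^ 2))"
    proof (intro sum.cong refl arg_cong2[where f = "(*)"])
      fix n
      have "(\<Sum>m'\<in>S. \<Sum>m\<in>S. (if m = m' * n then 1 else 0) - eta)
          = (\<Sum>m'\<in>S. (if m' * n \<in> S then 1 else 0)) - eta * real (card S) ^ 2"
        using S by (simp add: sum_subtractf power2_eq_square sum.delta)
      also have "(\<Sum>m'\<in>S. (if m' * n \<in> S then 1 else (0::real))) = real (card {m\<in>S. m * n \<in> S})"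
        using S by (simp add: sum.If_cases Int_def)
      finally show "(\<Sum>m'\<in>S. \<Sum>m\<in>S. (if m = m' * n then 1 else 0) - eta) = real (card {m\<in>S. m * n \<in> S}) - eta * real (card S) ^ 2" .
    qed
    finally show ?thesis .
  qed
  have "(\<Sum>n=1..N. a n * (real (card {m\<in>S. m * n \<in> S}) - eta * real (card S) ^ 2))
        \<le> (real (card S) + eta * real (card S) ^ 2) * Z"
    using low complex_Re_le_cmod up WZ by (meson order_trans)
  moreover have "(\<Sum>n=1..N. a n * (real (card {m\<in>S. m * n \<in> S}) - eta * real (card S) ^ 2))
      = (\<Sum>n=1..N. a n * real (card {m\<in>S. m * n \<in> S})) - (\<Sum>n=1..N. a n) * (eta * real (card S) ^ 2)"
    by (simp only: right_diff_distrib sum_subtractf sum_distrib_right)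
  ultimately show ?thesis
    by (simp add: algebra_simps power2_eq_square)
qed

section \<open>Stability of the box under multiplication\<close>

lemma prod_one_minus_ge:
  fixes x :: "'a \<Rightarrow> real"
  assumes "finite A" "\<And>i. i \<in> A \<Longrightarrow> 0 \<le> x i" "\<And>i. i \<in> A \<Longrightarrow> x i \<le> 1"
  shows "1 - sum x A \<le> (\<Prod>i\<in>A. 1 - x i)"
  using assms
proof (induction A rule: finite_induct)
  case (insert i A)
  have "(\<Prod>j\<in>A. 1 - x j) \<le> 1" using insert by (intro prod_le_1) auto
  hence "x i * (\<Prod>j\<in>A. 1 - x j) \<le> x i" using insert by (intro mult_left_le) auto
  thus ?case using insert by (simp add: algebra_simps)
qed simp

context prime_set
begin

text \<open>Each prime factor contributes at least \<open>ln 2 >= 1/2\<close> to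
  \<open>ln n\<close>; hence the factor 2.\<close>

lemma sum_multiplicity_le:
  assumes "n > 0" "prime_factors n \<subseteq> P"
  shows "(\<Sum>p\<in>P. real (multiplicity p n)) \<le> 2 * ln (real n)"
proof -
  have "n = (\<Prod>p\<in>P. p ^ multiplicity p n)"
  proof -
    have "n = (\<Prod>p\<in>prime_factors n. p ^ multiplicity p n)"
      using prime_factorization_nat[OF assms(1)] .
    also have "\<dots> = (\<Prod>p\<in>P. p ^ multiplicity p n)"
      using assms prime_P finite_P by (intro prod.mono_neutral_left) (auto simp: prime_factors_multiplicity)
    finally show ?thesis .
  qed
  hence "ln (real n) = ln (real (\<Prod>p\<in>P. p ^ multiplicity p n))" by simp
  also have "\<dots> = (\<Sum>p\<in>P. real (multiplicity p n) * ln (real p))"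
    unfolding of_nat_prod using finite_P
    by (subst ln_prod) (auto simp: ln_realpow dest!: P_ge_2 intro!: sum.cong)
  also have "\<dots> \<ge> (\<Sum>p\<in>P. real (multiplicity p n) * (1 / 2))"
  proof (intro sum_mono mult_left_mono)
    fix p assume "p \<in> P"
    hence "ln 2 \<le> ln (real p)"
      using P_ge_2[of p] by (intro ln_mono) auto
    thus "1 / 2 \<le> ln (real p)"
      using ln2_ge_two_thirds by linarith
  qed auto
  finally show ?thesis by (simp add: sum_divide_distrib[symmetric])
qed

text \<open>Multiplication by \<open>n\<close> stays in the box if each exponent is at most
  \<open>K - v_p\<close>. The proportion of such elements is the product of the
  \<open>1 - v_p / (K + 1)\<close>, bounded below by one minus the sum.\<close>

lemma card_exponent_box_shift_ge:
  assumes n: "n > 0" "prime_factors n \<subseteq> P" and K: "2 * ln (real n) \<le> real K"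
  shows "real (card {m\<in>exponent_box P K. m * n \<in> exponent_box P K})
         \<ge> (1 - 2 * ln (real n) / real (K + 1)) * real (card (exponent_box P K))"
proof -
  let ?v = "\<lambda>p. multiplicity p n" and ?num = "\<lambda>b. \<Prod>p\<in>P. p ^ b p"
  let ?A = "PiE P (\<lambda>p. {..K - ?v p})"
  have v_le: "?v p \<le> K" if "p \<in> P" for p
  proof -
    have "real (?v p) \<le> (\<Sum>p\<in>P. real (?v p))"
      using that finite_P by (intro member_le_sum) auto
    thus ?thesis using sum_multiplicity_le[OF n] K by linarith
  qed
  have sub: "?A \<subseteq> PiE P (\<lambda>_. {..K})" by (intro PiE_mono) auto
  have "?num ` ?A \<subseteq> {m\<in>exponent_box P K. m * n \<in> exponent_box P K}"
  proof safe
    fix b assume b: "b \<in> ?A"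
    hence box: "?num b \<in> exponent_box P K"
      using sub bij_betw_exponent_box[of K] unfolding bij_betw_def by blast
    thus "?num b \<in> exponent_box P K" .
    have pos: "?num b > 0" by (rule exponent_box_pos[OF box])
    have "multiplicity p (?num b * n) \<le> K" if "p \<in> P" for p
    proof -
      have "multiplicity p (?num b * n) = multiplicity p (?num b) + ?v p"
        using prime_P[OF that] pos n by (intro prime_elem_multiplicity_mult_distrib) auto
      also have "multiplicity p (?num b) = b p"
        using multiplicity_prod_prime_powers[OF finite_P prime_P prime_P[OF that], of b] that by simp
      also have "b p \<le> K - ?v p" using b that by auto
      finally show ?thesis using v_le[OF that] by linarith
    qed
    thus "?num b * n \<in> exponent_box P K"
      using pos n box by (simp add: exponent_box_def prime_factors_product)
  qed
  hence "card (?num ` ?A) \<le> card {m\<in>exponent_box P K. m * n \<in> exponent_box P K}"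
    by (intro card_mono) auto
  moreover have "card (?num ` ?A) = card ?A"
    using bij_betw_exponent_box[of K] sub unfolding bij_betw_def
    by (intro card_image) (blast intro: inj_on_subset)
  ultimately have card_le: "real (card ?A) \<le> real (card {m\<in>exponent_box P K. m * n \<in> exponent_box P K})"
    by simp
  have "(1 - 2 * ln (real n) / real (K + 1)) * real (card (exponent_box P K))
        \<le> (\<Prod>p\<in>P. 1 - real (?v p) / real (K + 1)) * real (card (exponent_box P K))"
  proof (rule mult_right_mono)
    have "1 - 2 * ln (real n) / real (K + 1) \<le> 1 - (\<Sum>p\<in>P. real (?v p) / real (K + 1))"
      using sum_multiplicity_le[OF n] by (simp add: sum_divide_distrib[symmetric] divide_right_mono)
    also have "\<dots> \<le> (\<Prod>p\<in>P. 1 - real (?v p) / real (K + 1))"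
    proof (intro prod_one_minus_ge finite_P)
      fix p assume "p \<in> P"
      hence "real (?v p) \<le> real (K + 1)" using v_le[of p] by simp
      thus "real (?v p) / real (K + 1) \<le> 1" by simp
    qed simp
    finally show "1 - 2 * ln (real n) / real (K + 1) \<le> (\<Prod>p\<in>P. 1 - real (?v p) / real (K + 1))" .
  qed simp
  also have "\<dots> = (\<Prod>p\<in>P. real (K + 1) * (1 - real (?v p) / real (K + 1)))"
    by (simp add: prod.distrib card_exponent_box)
  also have "\<dots> = (\<Prod>p\<in>P. real (card {..K - ?v p}))"
    using v_le by (intro prod.cong refl) (simp add: of_nat_diff right_diff_distrib)
  also have "\<dots> = real (card ?A)"
    using finite_P by (simp add: card_PiE)
  also note card_le
  finally show ?thesis .
qed

end

section \<open>Truncated Dirichlet series\<close>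

text \<open>\<open>n^(-s)\<close> minus the integral of \<open>x^(-s)\<close> over
  \<open>[n, n + 1]\<close>.\<close>

definition zeta_term :: "nat \<Rightarrow> complex \<Rightarrow> complex" where
  "zeta_term n s = of_nat n powr (- s) - (of_nat (n + 1) powr (1 - s) - of_nat n powr (1 - s)) / (1 - s)"

text \<open>The continuation of the tail over \<open>n >= N\<close>: for \<open>Re s > 1\<close> the
  first summand is the integral of \<open>x^(-s)\<close> from \<open>N\<close> to infinity.\<close>

definition zeta_rem :: "nat \<Rightarrow> complex \<Rightarrow> complex" where
  "zeta_rem N s = of_nat N powr (1 - s) / (s - 1) + (\<Sum>k. zeta_term (k + N) s)"


lemma norm_zeta_term_le:
  assumes "n > 0" "Re s > 0" "s \<noteq> 1"
  shows "norm (zeta_term n s) \<le> norm s * real n powr (- Re s - 1)"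
  using zeta_term_bound[of s "real n"] assms by (simp add: zeta_term_def add.commute)

lemma summable_powr_three_halves: "summable (\<lambda>k. (real k + 1) powr (-3/2))"
  using summable_real_powr_iff[of "-3/2"] summable_Suc_iff[of "\<lambda>k. real k powr (-3/2)"]
  by (simp add: add.commute)

lemma summable_shift_powr:
  assumes "a < -1" "N > 0"
  shows "summable (\<lambda>k. real (k + N) powr a)"
  using assms summable_real_powr_iff[of a] summable_iff_shift[of "\<lambda>k. real k powr a" N] by simp

lemma summable_zeta_term:
  assumes "N > 0" "Re s > 0" "s \<noteq> 1"
  shows "summable (\<lambda>k. zeta_term (k + N) s)"
proof (rule summable_comparison_test')
  show "summable (\<lambda>k. norm s * real (k + N) powr (- Re s - 1))"
    using assms by (intro summable_mult summable_shift_powr) auto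
  show "norm (zeta_term (k + N) s) \<le> norm s * real (k + N) powr (- Re s - 1)" for k
    using assms by (intro norm_zeta_term_le) auto
qed

lemma zeta_rem_holomorphic:
  assumes "N > 0"
  shows "zeta_rem N holomorphic_on {s. Re s > 0} - {1}"
proof -
  let ?D = "{s. Re s > 0} - {1::complex}"
  have D: "open ?D"
    by (intro open_delete open_halfspace_Re_gt)
  have "(\<lambda>s. \<Sum>k. zeta_term (k + N) s) holomorphic_on ?D"
  proof (rule holomorphic_uniform_sequence[OF D])
    show "(\<lambda>s. \<Sum>k<n. zeta_term (k + N) s) holomorphic_on ?D" for n
      unfolding zeta_term_def using assms by (intro holomorphic_intros) (auto simp: complex_eq_iff)
  next
    fix z assume z: "z \<in> ?D"
    have "open (?D \<inter> {s. Re s > Re z / 2})"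
      by (intro open_Int D open_halfspace_Re_gt)
    moreover have "z \<in> ?D \<inter> {s. Re s > Re z / 2}"
      using z by simp
    ultimately obtain d where d: "d > 0" "cball z d \<subseteq> ?D \<inter> {s. Re s > Re z / 2}"
      unfolding open_contains_cball by blast
    have dw: "Re w > 0" "w \<noteq> 1" "Re w > Re z / 2" if "w \<in> cball z d" for w
      using d(2) that by auto
    have "uniform_limit (cball z d) (\<lambda>n s. \<Sum>k<n. zeta_term (k + N) s) (\<lambda>s. \<Sum>k. zeta_term (k + N) s) sequentially"
    proof (rule Weierstrass_m_test)
      fix k w assume w: "w \<in> cball z d"
      have "norm w \<le> norm z + norm (z - w)"
        by (metis norm_minus_commute norm_triangle_sub)
      hence nw: "norm w \<le> norm z + d"
        using w by (simp add: dist_norm)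
      have "norm (zeta_term (k + N) w) \<le> norm w * real (k + N) powr (- Re w - 1)"
        using dw[OF w] assms by (intro norm_zeta_term_le) auto
      also have "\<dots> \<le> (norm z + d) * real (k + N) powr (- (Re z / 2) - 1)"
        using d(1) dw[OF w] nw assms by (intro mult_mono powr_mono add_nonneg_nonneg) auto
      finally show "norm (zeta_term (k + N) w) \<le> (norm z + d) * real (k + N) powr (- (Re z / 2) - 1)" .
    next
      show "summable (\<lambda>k. (norm z + d) * real (k + N) powr (- (Re z / 2) - 1))"
        using z assms by (intro summable_mult summable_shift_powr) auto
    qed
    thus "\<exists>d>0. cball z d \<subseteq> ?D \<and>
        uniform_limit (cball z d) (\<lambda>n s. \<Sum>k<n. zeta_term (k + N) s) (\<lambda>s. \<Sum>k. zeta_term (k + N) s) sequentially"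
      using d by blast
  qed
  thus ?thesis
    unfolding zeta_rem_def using assms by (intro holomorphic_intros) auto
qed

text \<open>For \<open>Re s > 1\<close> the integrals telescope and cancel
  \<open>N^(1-s) / (s - 1)\<close>. The finite part covers the integers 1 to \<open>N - 1\<close>;
  the remainder starts at \<open>N\<close>.\<close>

lemma zeta_continuation_rem:
  assumes "N > 0"
  shows "zeta_continuation 0 (\<lambda>s. (\<Sum>n<N-1. of_nat (Suc n) powr (- s)) + zeta_rem N s)"
  unfolding zeta_continuation_def
proof (intro conjI allI impI)
  show "(\<lambda>s. (\<Sum>n<N-1. of_nat (Suc n) powr (- s)) + zeta_rem N s) holomorphic_on {s. Re s > 0} - {1}"
    by (intro holomorphic_intros zeta_rem_holomorphic assms)
next
  fix s :: complex assume s: "Re s > 1"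
  have ne: "s \<noteq> 1" using s by auto
  have "(\<lambda>k. complex_of_nat (k + N) powr (1 - s)) \<longlonglongrightarrow> 0"
    using s LIMSEQ_ignore_initial_segment[OF tendsto_neg_powr_complex_of_nat[OF filterlim_ident, of "1 - s"], of N]
    by simp
  from telescope_sums[OF this]
  have "(\<lambda>k. (of_nat (k + N + 1) powr (1 - s) - of_nat (k + N) powr (1 - s)) / (1 - s))
          sums ((0 - of_nat N powr (1 - s)) / (1 - s))"
    by (intro sums_divide) simp
  moreover have "(\<lambda>k. zeta_term (k + N) s) sums (\<Sum>k. zeta_term (k + N) s)"
    using summable_zeta_term[OF assms _ ne] s by (intro summable_sums) auto
  ultimately have "(\<lambda>k. (of_nat (k + N + 1) powr (1 - s) - of_nat (k + N) powr (1 - s)) / (1 - s) + zeta_term (k + N) s)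
      sums ((0 - of_nat N powr (1 - s)) / (1 - s) + (\<Sum>k. zeta_term (k + N) s))"
    by (rule sums_add)
  also have "(0 - of_nat N powr (1 - s)) / (1 - s) + (\<Sum>k. zeta_term (k + N) s) = zeta_rem N s"
    using ne by (simp add: zeta_rem_def field_simps)
  also have "(\<lambda>k. (of_nat (k + N + 1) powr (1 - s) - of_nat (k + N) powr (1 - s)) / (1 - s) + zeta_term (k + N) s)
    = (\<lambda>k. of_nat (Suc (k + (N - 1))) powr (- s))"
    using assms by (simp add: zeta_term_def)
  finally show "(\<lambda>n. of_nat (Suc n) powr (- s)) sums ((\<Sum>n<N-1. of_nat (Suc n) powr (- s)) + zeta_rem N s)"
    by (subst (asm) sums_iff_shift) (simp add: add.commute)
qed

lemma zeta_eq_sum_rem: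
  assumes "N > 0" "Re s > 0" "s \<noteq> 1"
  shows "zeta s = (\<Sum>n<N-1. of_nat (Suc n) powr (- s)) + zeta_rem N s"
  using zeta_eq[OF zeta_continuation_rem[OF assms(1)] assms(2,3)] .

text \<open>The factor \<open>N^(1 - Re s)\<close> is isolated because it is the only part sensitive
  to the radius of the Cauchy circle around a point of the line \<open>Re s = 1\<close>.\<close>

lemma norm_zeta_rem_le:
  assumes "N > 0" "Re s \<ge> 1 / 2" "s \<noteq> 1"
  shows "norm (zeta_rem N s) \<le> real N powr (1 - Re s) *
           (1 / norm (s - 1) + norm s * (\<Sum>k. (real k + 1) powr (-3/2)) * real N powr (-1/2))"
proof -
  have term_le: "norm (zeta_term (k + N) s) \<le> norm s * real N powr (1/2 - Re s) * (real k + 1) powr (-3/2)" for k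
  proof -
    have "norm (zeta_term (k + N) s) \<le> norm s * real (k + N) powr (- Re s - 1)"
      using assms by (intro norm_zeta_term_le) auto
    \<comment> \<open>The exponent is split so that the first factor, being nonincreasing, is
      bounded by its value at \<open>N\<close>, while \<open>-3/2\<close> secures summability over
      \<open>k\<close>.\<close>
    also have "real (k + N) powr (- Re s - 1) = real (k + N) powr (1/2 - Re s) * real (k + N) powr (-3/2)"
      unfolding powr_add[symmetric] by (intro arg_cong2[where f = "(powr)"]) auto
    also have "\<dots> \<le> real N powr (1/2 - Re s) * (real k + 1) powr (-3/2)"
      using assms by (intro mult_mono powr_mono2') auto
    finally show ?thesis
      by (simp add: mult_left_mono mult.assoc)
  qed
  have "norm (\<Sum>k. zeta_term (k + N) s) \<le> (\<Sum>k. norm s * real N powr (1/2 - Re s) * (real k + 1) powr (-3/2))"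
    by (intro norm_suminf_le term_le summable_mult summable_powr_three_halves)
  also have "\<dots> = norm s * real N powr (1/2 - Re s) * (\<Sum>k. (real k + 1) powr (-3/2))"
    by (intro suminf_mult summable_powr_three_halves)
  finally have 1: "norm (\<Sum>k. zeta_term (k + N) s) \<le> norm s * real N powr (1/2 - Re s) * (\<Sum>k. (real k + 1) powr (-3/2))" .
  have 2: "norm (of_nat N powr (1 - s) / (s - 1)) = real N powr (1 - Re s) / norm (s - 1)"
    using assms(1) norm_powr_real_powr[of "of_nat N" "1 - s"] by (simp add: norm_divide)
  have 3: "real N powr (1/2 - Re s) = real N powr (1 - Re s) * real N powr (-1/2)"
    by (simp add: powr_add[symmetric])
  have "norm (zeta_rem N s) \<le> norm (of_nat N powr (1 - s) / (s - 1)) + norm (\<Sum>k. zeta_term (k + N) s)"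
    unfolding zeta_rem_def by (rule norm_triangle_ineq)
  also have "\<dots> \<le> real N powr (1 - Re s) / norm (s - 1) + norm s * real N powr (1/2 - Re s) * (\<Sum>k. (real k + 1) powr (-3/2))"
    using 1 2 by simp
  also have "\<dots> = real N powr (1 - Re s) *
           (1 / norm (s - 1) + norm s * (\<Sum>k. (real k + 1) powr (-3/2)) * real N powr (-1/2))"
    unfolding 3 by (simp add: algebra_simps)
  finally show ?thesis .
qed

section \<open>Derivatives and the finite Dirichlet polynomial\<close>

lemma fact_le_Suc_power: "fact l \<le> (real l + 1) ^ l"
proof -
  have "fact l \<le> real l ^ l"
    using fact_le_power[of l, where 'a = real] by simp
  also have "\<dots> \<le> (real l + 1) ^ l"
    by (intro power_mono) auto
  finally show ?thesis .
qed

text \<open>Cauchy's inequality with radius \<open>r = (l + 1) / ln N\<close>: then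
  \<open>N^r = e^(l+1)\<close>, and \<open>l! / r^l\<close> is at most \<open>(ln N)^l\<close>. The
  length \<open>N >= T^4\<close> makes \<open>|s| * N^(-1/2)\<close> of order
  \<open>1/T\<close>.\<close>

lemma higher_deriv_zeta_rem_le:
  "\<exists>C>0. \<forall>l T t N. T \<ge> 1 \<longrightarrow> T \<le> t \<longrightarrow> t \<le> 2 * T \<longrightarrow> real N \<ge> T ^ 4 \<longrightarrow> real l + 1 \<le> ln (real N) / 2 \<longrightarrow>
     norm ((deriv ^^ l) (zeta_rem N) (Complex 1 t)) \<le> C * exp (real l + 1) * ln (real N) ^ l / T"
proof -
  define C1 where "C1 = (\<Sum>k. (real k + 1) powr (-3/2))"
  have C1: "C1 \<ge> 0"
    unfolding C1_def by (intro suminf_nonneg summable_powr_three_halves) auto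
  have "norm ((deriv ^^ l) (zeta_rem N) (Complex 1 t)) \<le> (2 + 4 * C1) * exp (real l + 1) * ln (real N) ^ l / T"
    if T: "T \<ge> 1" and t: "T \<le> t" "t \<le> 2 * T" and N: "real N \<ge> T ^ 4" and l: "real l + 1 \<le> ln (real N) / 2"
    for l T t N
  proof -
    define r where "r = (real l + 1) / ln (real N)"
    have lnN: "ln (real N) > 0" using l by linarith
    have Npos: "N > 0" using lnN by (cases "N = 0") auto
    have r: "0 < r" "r \<le> 1 / 2"
      using l lnN by (auto simp: r_def field_simps)
    have sub: "cball (Complex 1 t) r \<subseteq> {s. Re s > 0} - {1}"
    proof
      fix s assume "s \<in> cball (Complex 1 t) r"
      hence d: "norm (Complex 1 t - s) \<le> r" by (simp add: dist_norm)
      have "\<bar>Re (Complex 1 t - s)\<bar> \<le> r" "\<bar>Im (Complex 1 t - s)\<bar> \<le> r"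
        using abs_Re_le_cmod[of "Complex 1 t - s"] abs_Im_le_cmod[of "Complex 1 t - s"] d by linarith+
      thus "s \<in> {s. Re s > 0} - {1}"
        using r t T by (auto simp: abs_le_iff)
    qed
    have hol: "zeta_rem N holomorphic_on cball (Complex 1 t) r"
      by (rule holomorphic_on_subset[OF zeta_rem_holomorphic[OF Npos] sub])
    have "norm ((deriv ^^ l) (zeta_rem N) (Complex 1 t)) \<le> fact l * (exp (real l + 1) * ((2 + 4 * C1) / T)) / r ^ l"
    proof (rule Cauchy_inequality)
      show "zeta_rem N holomorphic_on ball (Complex 1 t) r"
        by (rule holomorphic_on_subset[OF hol ball_subset_cball])
      show "continuous_on (cball (Complex 1 t) r) (zeta_rem N)"
        using hol by (rule holomorphic_on_imp_continuous_on)
      show "0 < r" by (rule r(1))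
      fix s assume s: "norm (Complex 1 t - s) = r"
      have ReIm: "\<bar>1 - Re s\<bar> \<le> r" "\<bar>t - Im s\<bar> \<le> r"
        using abs_Re_le_cmod[of "Complex 1 t - s"] abs_Im_le_cmod[of "Complex 1 t - s"] s by auto
      have "T / 2 \<le> \<bar>Im (s - 1)\<bar>"
        using ReIm(2) r t T by simp
      hence 1: "T / 2 \<le> norm (s - 1)"
        using abs_Im_le_cmod[of "s - 1"] by linarith
      have "norm s \<le> \<bar>Re s\<bar> + \<bar>Im s\<bar>"
        by (rule cmod_le)
      hence 2: "norm s \<le> 4 * T"
        using ReIm r t T by linarith
      have "real N powr (-1/2) \<le> (T ^ 4) powr (-1/2)"
        using N T by (intro powr_mono2') auto
      also have "\<dots> = 1 / T ^ 2"
      proof -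
        have "T ^ 4 = T powr 4" "T ^ 2 = T powr 2"
          using T by (simp_all add: powr_numeral)
        thus ?thesis by (simp add: powr_powr powr_minus_divide[symmetric])
      qed
      finally have 3: "real N powr (-1/2) \<le> 1 / T ^ 2" .
      have "norm (zeta_rem N s) \<le> real N powr (1 - Re s) * (1 / norm (s - 1) + norm s * C1 * real N powr (-1/2))"
        unfolding C1_def using ReIm r T 1 Npos by (intro norm_zeta_rem_le) auto
      also have "\<dots> \<le> exp (real l + 1) * (2 / T + 4 * T * C1 * (1 / T ^ 2))"
      proof (intro mult_mono add_mono)
        have "real N powr (1 - Re s) \<le> real N powr r"
          using ReIm(1) Npos by (intro powr_mono) auto
        also have "\<dots> = exp (real l + 1)"
          using lnN Npos by (simp add: powr_def r_def)
        finally show "real N powr (1 - Re s) \<le> exp (real l + 1)" .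
        show "1 / norm (s - 1) \<le> 2 / T"
          using 1 T frac_le[of 1 1 "T / 2" "norm (s - 1)"] by simp
      qed (use 2 3 C1 T in auto)
      also have "2 / T + 4 * T * C1 * (1 / T ^ 2) = (2 + 4 * C1) / T"
        using T by (simp add: field_simps power2_eq_square)
      finally show "norm (zeta_rem N s) \<le> exp (real l + 1) * ((2 + 4 * C1) / T)" .
    qed
    also have "\<dots> = fact l / (real l + 1) ^ l * ((2 + 4 * C1) * exp (real l + 1) * ln (real N) ^ l / T)"
      by (simp add: r_def power_divide mult_ac)
    also have "\<dots> \<le> 1 * ((2 + 4 * C1) * exp (real l + 1) * ln (real N) ^ l / T)"
      using fact_le_Suc_power[of l] C1 T lnN by (intro mult_right_mono) (auto simp: divide_le_eq)
    finally show ?thesis by simp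
  qed
  thus ?thesis
    using C1 by (intro exI[of _ "2 + 4 * C1"]) auto
qed

lemma higher_deriv_powr_sum:
  "(deriv ^^ l) (\<lambda>s::complex. \<Sum>n<N. of_nat (Suc n) powr (- s)) = (\<lambda>s. \<Sum>n<N. (- of_real (ln (real (Suc n)))) ^ l * of_nat (Suc n) powr (- s))"
proof (induction l)
  case (Suc l)
  have "deriv (\<lambda>s. \<Sum>n<N. (- of_real (ln (real (Suc n)))) ^ l * of_nat (Suc n) powr (- s)) s
        = (\<Sum>n<N. (- of_real (ln (real (Suc n)))) ^ Suc l * of_nat (Suc n) powr (- s))" for s :: complex
  proof (rule DERIV_imp_deriv)
    have "((\<lambda>s. of_nat (Suc n) powr (- s)) has_field_derivative (- of_real (ln (real (Suc n)))) * of_nat (Suc n) powr (- s)) (at s)" for n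
    proof -
      have "Ln (of_nat (Suc n)) = of_real (ln (real (Suc n)))"
        using Ln_of_real[of "real (Suc n)"] by simp
      thus ?thesis
        using DERIV_chain2[OF has_field_derivative_powr_right[of "of_nat (Suc n)" "- s"] DERIV_minus[OF DERIV_ident]]
        by (simp del: of_nat_Suc add: mult.commute)
    qed
    hence "((\<lambda>s. (- of_real (ln (real (Suc n)))) ^ l * of_nat (Suc n) powr (- s)) has_field_derivative
             (- of_real (ln (real (Suc n)))) ^ l * ((- of_real (ln (real (Suc n)))) * of_nat (Suc n) powr (- s))) (at s)" for n
      by (intro DERIV_cmult)
    thus "((\<lambda>s. \<Sum>n<N. (- of_real (ln (real (Suc n)))) ^ l * of_nat (Suc n) powr (- s)) has_field_derivative
        (\<Sum>n<N. (- of_real (ln (real (Suc n)))) ^ Suc l * of_nat (Suc n) powr (- s))) (at s)"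
      by (intro DERIV_sum) (simp add: mult_ac)
  qed
  thus ?case unfolding funpow.simps o_apply Suc.IH by (rule ext)
qed simp

lemma zeta_holomorphic: "zeta holomorphic_on {s. Re s > 0} - {1}"
proof (rule holomorphic_transform)
  show "(\<lambda>s. (\<Sum>n<1-1. of_nat (Suc n) powr (- s)) + zeta_rem 1 s) holomorphic_on {s. Re s > 0} - {1}"
    by (intro holomorphic_intros zeta_rem_holomorphic) auto
qed (subst zeta_eq_sum_rem[of 1]; simp)

text \<open>The \<open>GREATEST\<close> in \<open>zeta_max\<close> is meaningful only if the maximum
  is attained; continuity on the compact segment provides this.\<close>

lemma norm_higher_deriv_zeta_le_zeta_max:
  assumes "T > 0" "T \<le> t" "t \<le> 2 * T"
  shows "norm ((deriv ^^ l) zeta (Complex 1 t)) \<le> zeta_max l T"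
proof -
  let ?f = "\<lambda>t. norm ((deriv ^^ l) zeta (Complex 1 t))"
  have "(deriv ^^ l) zeta holomorphic_on {s. Re s > 0} - {1}"
    by (intro holomorphic_higher_deriv zeta_holomorphic open_delete open_halfspace_Re_gt)
  hence 1: "continuous_on ({s. Re s > 0} - {1}) ((deriv ^^ l) zeta)"
    by (rule holomorphic_on_imp_continuous_on)
  have 2: "continuous_on {T..2*T} (Complex 1)"
    unfolding Complex_eq by (intro continuous_intros)
  have 3: "Complex 1 ` {T..2*T} \<subseteq> {s. Re s > 0} - {1}"
    using assms(1) by (auto simp: complex_eq_iff)
  have "continuous_on {T..2*T} ?f"
    by (intro continuous_on_norm continuous_on_compose2[OF 1 2 3])
  moreover have "compact {T..2*T}" "{T..2*T} \<noteq> {}"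
    using assms by auto
  ultimately obtain u where u: "u \<in> {T..2*T}" "\<And>x. x \<in> {T..2*T} \<Longrightarrow> ?f x \<le> ?f u"
    using continuous_attains_sup[of "{T..2*T}" ?f] by blast
  have "zeta_max l T = ?f u"
    unfolding zeta_max_def using u by (intro Greatest_equality) auto
  thus ?thesis
    using u(2)[of t] assms by simp
qed

definition log_poly :: "nat \<Rightarrow> nat \<Rightarrow> real \<Rightarrow> complex" where
  "log_poly l N t = (\<Sum>n=1..N. of_real (ln (real n) ^ l / real n) * cis (- (t * ln (real n))))"

text \<open>Up to the sign \<open>(-1)^l\<close>, \<open>log_poly l N\<close> is the derivative of
  the terms \<open>n <= N\<close>, so the complementary remainder is
  \<open>zeta_rem (Suc N)\<close>.\<close>

lemma norm_log_poly_le: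
  "\<exists>C>0. \<forall>l T t N. T \<ge> 1 \<longrightarrow> T \<le> t \<longrightarrow> t \<le> 2 * T \<longrightarrow> real (Suc N) \<ge> T ^ 4 \<longrightarrow> real l + 1 \<le> ln (real (Suc N)) / 2 \<longrightarrow>
     norm (log_poly l N t) \<le> zeta_max l T + C * exp (real l + 1) * ln (real (Suc N)) ^ l / T"
proof -
  obtain C where C: "C > 0" "\<And>l T t N. T \<ge> 1 \<Longrightarrow> T \<le> t \<Longrightarrow> t \<le> 2 * T \<Longrightarrow> real N \<ge> T ^ 4 \<Longrightarrow> real l + 1 \<le> ln (real N) / 2 \<Longrightarrow>
     norm ((deriv ^^ l) (zeta_rem N) (Complex 1 t)) \<le> C * exp (real l + 1) * ln (real N) ^ l / T"
    using higher_deriv_zeta_rem_le by blast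
  have "norm (log_poly l N t) \<le> zeta_max l T + C * exp (real l + 1) * ln (real (Suc N)) ^ l / T"
    if T: "T \<ge> 1" and t: "T \<le> t" "t \<le> 2 * T" and N: "real (Suc N) \<ge> T ^ 4" and l: "real l + 1 \<le> ln (real (Suc N)) / 2"
    for l T t N
  proof -
    let ?D = "{s. Re s > 0} - {1::complex}" and ?s = "Complex 1 t"
    let ?S = "\<lambda>s. \<Sum>n<N. of_nat (Suc n) powr (- s)"
    have D: "open ?D" by (intro open_delete open_halfspace_Re_gt)
    have s: "?s \<in> ?D" using t T by (auto simp: complex_eq_iff)
    have holS: "?S holomorphic_on ?D" by (intro holomorphic_intros)
    have holR: "zeta_rem (Suc N) holomorphic_on ?D" by (intro zeta_rem_holomorphic) simp
    have "(deriv ^^ l) ?S ?s = (deriv ^^ l) (\<lambda>s. zeta s - zeta_rem (Suc N) s) ?s"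
      using holS holR zeta_holomorphic
      by (intro higher_deriv_transform_within_open[OF _ _ D s])
         (auto intro!: holomorphic_intros simp: zeta_eq_sum_rem[of "Suc N"])
    also have "\<dots> = (deriv ^^ l) zeta ?s - (deriv ^^ l) (zeta_rem (Suc N)) ?s"
      by (intro higher_deriv_diff[OF zeta_holomorphic holR D s])
    finally have "norm ((deriv ^^ l) ?S ?s) \<le> norm ((deriv ^^ l) zeta ?s) + norm ((deriv ^^ l) (zeta_rem (Suc N)) ?s)"
      by (simp add: norm_triangle_ineq4)
    also have "\<dots> \<le> zeta_max l T + C * exp (real l + 1) * ln (real (Suc N)) ^ l / T"
      using T t N l by (intro add_mono norm_higher_deriv_zeta_le_zeta_max C) auto
    also have "(deriv ^^ l) ?S ?s = (-1) ^ l * log_poly l N t"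
    proof -
      have "of_nat (Suc n) powr (- ?s) = of_real (1 / real (Suc n)) * cis (- (t * ln (real (Suc n))))" for n
      proof -
        have "Ln (of_nat (Suc n)) = of_real (ln (real (Suc n)))"
          using Ln_of_real[of "real (Suc n)"] by simp
        hence "of_nat (Suc n) powr (- ?s) = exp (- ?s * of_real (ln (real (Suc n))))"
          by (simp add: powr_def del: of_nat_Suc)
        also have "\<dots> = of_real (exp (- ln (real (Suc n)))) * cis (- (t * ln (real (Suc n))))"
          by (simp add: exp_eq_polar)
        also have "exp (- ln (real (Suc n))) = 1 / real (Suc n)"
          by (simp add: exp_minus inverse_eq_divide del: of_nat_Suc)
        finally show ?thesis .
      qed
      hence "(deriv ^^ l) ?S ?s = (\<Sum>n<N. (-1) ^ l * (of_real (ln (real (Suc n)) ^ l / real (Suc n)) * cis (- (t * ln (real (Suc n))))))"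
        unfolding higher_deriv_powr_sum
        by (intro sum.cong refl) (simp add: power_minus[of "of_real _"] del: of_nat_Suc)
      also have "\<dots> = (-1) ^ l * log_poly l N t"
        unfolding log_poly_def sum_distrib_left[symmetric]
        by (intro arg_cong2[where f = "(*)"] refl sum.reindex_bij_witness[of _ "\<lambda>n. n - 1" Suc]) auto
      finally show ?thesis .
    qed
    finally show ?thesis by (simp add: norm_mult norm_power)
  qed
  thus ?thesis using C(1) by blast
qed

section \<open>The lower bound\<close>

lemma zeta_max_nonneg: "T > 0 \<Longrightarrow> zeta_max l T \<ge> 0"
  using norm_higher_deriv_zeta_le_zeta_max[of T T l] by (intro order_trans[OF norm_ge_zero]) auto

lemma sum_inverse_le: "N > 0 \<Longrightarrow> (\<Sum>n=1..N. 1 / real n) \<le> 1 + ln (real N)"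
  using euler_mascheroni_sequence_decreasing[of 1 N]
  by (simp add: harm_def inverse_eq_divide)

text \<open>This bounds the largest element of the box, with \<open>X = ln T\<close> in mind.
  Chebyshev gives at most \<open>2 e^k\<close> for the sum of \<open>ln p\<close>, so its logarithm
  is at most \<open>2 k^3 e^k\<close>; the 20 leaves a factor 10.\<close>

lemma prod_primes_exp_power_le:
  assumes "20 * real k ^ 3 * exp (real k) \<le> X" "X \<ge> 0"
  shows "ln (real ((\<Prod>(primes_exp k)) ^ (k ^ 3))) \<le> X / 10" "(\<Prod>(primes_exp k)) ^ (k ^ 3) > 0"
proof -
  have pos: "\<Prod>(primes_exp k) > 0"
    using primes_exp.P_ge_2 by (intro prod_pos) force
  thus "(\<Prod>(primes_exp k)) ^ (k ^ 3) > 0" by simp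
  have "ln (real (\<Prod>(primes_exp k))) = (\<Sum>p\<in>primes_exp k. ln (real p))"
    unfolding of_nat_prod by (subst ln_prod) (auto simp: primes_exp.finite_P dest!: primes_exp.P_ge_2)
  also have "\<dots> \<le> real (nat \<lfloor>exp (real k)\<rfloor>) * ln 4"
    unfolding primes_exp_eq by (rule sum_ln_primes_le)
  also have "\<dots> \<le> exp (real k) * 2"
    using ln4_le by (intro mult_mono) auto
  finally have "real (k ^ 3) * ln (real (\<Prod>(primes_exp k))) \<le> real (k ^ 3) * (exp (real k) * 2)"
    by (intro mult_left_mono) auto
  also have "\<dots> \<le> X / 10"
    using assms by simp
  finally show "ln (real ((\<Prod>(primes_exp k)) ^ (k ^ 3))) \<le> X / 10"
    using pos by (simp add: ln_realpow)
qed

text \<open>For \<open>ln n <= k^2\<close> the box with exponents up to \<open>k^3\<close> loses at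
  most the proportion \<open>2 k^2 / k^3\<close>. All other \<open>n\<close> contribute
  nonnegatively.\<close>

lemma log_moment_le_sum_card:
  assumes "k \<ge> 2" "exp (real k ^ 2) \<le> real N"
  shows "(1 - 2 / real k) * log_moment l (primes_exp k) (exp (real k ^ 2)) * real (card (exponent_box (primes_exp k) (k ^ 3)))
    \<le> (\<Sum>n=1..N. ln (real n) ^ l / real n *
         real (card {m\<in>exponent_box (primes_exp k) (k ^ 3). m * n \<in> exponent_box (primes_exp k) (k ^ 3)}))"
proof -
  let ?B = "exponent_box (primes_exp k) (k ^ 3)" and ?S = "smooths (primes_exp k) (exp (real k ^ 2))"
  have "(1 - 2 / real k) * log_moment l (primes_exp k) (exp (real k ^ 2)) * real (card ?B)
      = (\<Sum>n\<in>?S. ln (real n) ^ l / real n * ((1 - 2 / real k) * real (card ?B)))"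
    unfolding log_moment_def by (simp add: sum_distrib_left sum_distrib_right mult_ac)
  also have "\<dots> \<le> (\<Sum>n\<in>?S. ln (real n) ^ l / real n * real (card {m\<in>?B. m * n \<in> ?B}))"
  proof (intro sum_mono mult_left_mono)
    fix n assume n: "n \<in> ?S"
    hence "ln (real n) \<le> ln (exp (real k ^ 2))"
      unfolding smooths_def by (intro ln_mono) auto
    hence lnn: "ln (real n) \<le> real k ^ 2" by simp
    have k3: "real (k ^ 3) = real k * real k ^ 2" by (simp add: power3_eq_cube power2_eq_square)
    have "2 * real k ^ 2 \<le> real (k ^ 3)"
      unfolding k3 using assms(1) by (intro mult_right_mono) auto
    hence K: "2 * ln (real n) \<le> real (k ^ 3)"
      using lnn by linarith
    have "2 * ln (real n) / real (k ^ 3 + 1) \<le> 2 * real k ^ 2 / real (k ^ 3)"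
      using lnn assms(1) by (intro frac_le) auto
    also have "\<dots> = 2 / real k"
      unfolding k3 using assms(1) by simp
    finally have "(1 - 2 / real k) * real (card ?B) \<le> (1 - 2 * ln (real n) / real (k ^ 3 + 1)) * real (card ?B)"
      by (intro mult_right_mono) auto
    also have "\<dots> \<le> real (card {m\<in>?B. m * n \<in> ?B})"
      using n K by (intro primes_exp.card_exponent_box_shift_ge) (auto simp: smooths_def)
    finally show "(1 - 2 / real k) * real (card ?B) \<le> real (card {m\<in>?B. m * n \<in> ?B})" .
  qed (auto simp: smooths_def)
  also have "\<dots> \<le> (\<Sum>n=1..N. ln (real n) ^ l / real n * real (card {m\<in>?B. m * n \<in> ?B}))"
  proof (intro sum_mono2)
    show "?S \<subseteq> {1..N}"
    proof
      fix n assume "n \<in> ?S"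
      hence "0 < n" "real n \<le> real N"
        using assms(2) by (auto simp: smooths_def)
      thus "n \<in> {1..N}" by simp
    qed
  qed auto
  finally show ?thesis .
qed

text \<open>The term \<open>C * 15^l\<close> collects the truncation error and the oscillating
  terms. In both, \<open>(ln T)^l <= T\<close> removes the dependence on \<open>T\<close>.\<close>

lemma zeta_max_ge_log_moment:
  "\<exists>C>0. \<forall>T k l. T \<ge> 8 \<longrightarrow> k \<ge> 2 \<longrightarrow> real k ^ 2 \<le> ln T \<longrightarrow> 20 * real k ^ 3 * exp (real k) \<le> ln T \<longrightarrow>
     real l + 1 \<le> ln T \<longrightarrow> ln T ^ l \<le> T \<longrightarrow> 6144 * ln T \<le> sqrt T \<longrightarrow>
     (1 - 2 / real k) * log_moment l (primes_exp k) (exp (real k ^ 2)) \<le> zeta_max l T * (1 + 1024 / T) + C * 15 ^ l"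
proof -
  obtain C0 where C0: "C0 > 0" and rem: "\<And>l T t N. T \<ge> 1 \<Longrightarrow> T \<le> t \<Longrightarrow> t \<le> 2 * T \<Longrightarrow> real (Suc N) \<ge> T ^ 4 \<Longrightarrow>
     real l + 1 \<le> ln (real (Suc N)) / 2 \<Longrightarrow>
     norm (log_poly l N t) \<le> zeta_max l T + C0 * exp (real l + 1) * ln (real (Suc N)) ^ l / T"
    using norm_log_poly_le by blast
  have "(1 - 2 / real k) * log_moment l (primes_exp k) (exp (real k ^ 2))
        \<le> zeta_max l T * (1 + 1024 / T) + (387 * C0 + 1) * 15 ^ l"
    if T: "T \<ge> 8" and k: "k \<ge> 2" "real k ^ 2 \<le> ln T" "20 * real k ^ 3 * exp (real k) \<le> ln T"
      and l: "real l + 1 \<le> ln T" "ln T ^ l \<le> T" and big: "6144 * ln T \<le> sqrt T"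
    for T k l
  proof -
    define X where "X = ln T"
    define N where "N = nat \<lceil>T ^ 4\<rceil>"
    let ?P = "primes_exp k"
    define S where "S = exponent_box ?P (k ^ 3)"
    define M where "M = (\<Prod>?P) ^ (k ^ 3)"
    \<comment> \<open>\<open>ln (M * N) <= X/10 + 9X/2 <= 5X\<close> determines the step;
      \<open>J\<close> is the largest length that keeps the grid inside
      \<open>[T, 2T]\<close>.\<close>
    define h where "h = 1 / (5 * X)"
    define J where "J = nat \<lfloor>T / (2 * h)\<rfloor>"
    define a where "a = (\<lambda>n::nat. ln (real n) ^ l / real n)"
    define Z where "Z = zeta_max l T + C0 * exp (real l + 1) * ln (real (Suc N)) ^ l / T"
    define eta where "eta = 64 * real M ^ 2 / (h * real J) ^ 2"
    have X: "X \<ge> 1" using l by (simp add: X_def)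
    have T4: "T ^ 4 \<ge> 1" using T by (intro one_le_power) auto
    have TT: "T \<le> T ^ 4" using T power_increasing[of 1 4 T] by simp
    have N: "T ^ 4 \<le> real N" "real N \<le> T ^ 4 + 1"
      unfolding N_def using T4 by linarith+
    have Npos: "N > 0" using N T4 by linarith
    have lnT4: "ln (T ^ 4) = 4 * X"
      using T by (simp add: ln_realpow X_def)
    have lnSN: "ln (real (Suc N)) \<le> 5 * X"
    proof -
      have "real (Suc N) \<le> 8 * T ^ 4" using N T4 by simp
      also have "\<dots> \<le> T * T ^ 4" using T by (intro mult_right_mono) auto
      finally have "ln (real (Suc N)) \<le> ln (T * T ^ 4)"
        using Npos by (intro ln_mono) auto
      also have "\<dots> = X + 4 * X"
        using T lnT4 by (subst ln_mult) (auto simp: X_def)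
      finally show ?thesis by simp
    qed
    have lnN: "ln (real N) \<le> 9 / 2 * X" "ln (real N) \<ge> 0" "ln (real N) \<le> 5 * X"
    proof -
      have "real N \<le> 2 * T ^ 4" using N T4 by simp
      hence "ln (real N) \<le> ln (2 * T ^ 4)"
        using Npos by (intro ln_mono) auto
      also have "\<dots> = ln 2 + 4 * X"
        using T lnT4 by (subst ln_mult) auto
      also have "ln (2::real) \<le> X / 2"
      proof -
        have "2 * ln (2::real) = ln 4" using ln_realpow[of 2 2] by simp
        also have "\<dots> \<le> X" unfolding X_def using T by (intro ln_mono) auto
        finally show ?thesis by simp
      qed
      finally show "ln (real N) \<le> 9 / 2 * X" by simp
      thus "ln (real N) \<le> 5 * X" using X by simp
      show "ln (real N) \<ge> 0" using Npos by simp
    qed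
    have lnSN4: "4 * X \<le> ln (real (Suc N))"
      unfolding lnT4[symmetric] using N T4 by (intro ln_mono) auto
    have M: "ln (real M) \<le> X / 10" "M > 0"
      unfolding M_def X_def using prod_primes_exp_power_le[OF k(3)] T by auto
    \<comment> \<open>In the error bound \<open>M^2\<close> from \<open>eta\<close> meets
      \<open>card S <= M\<close>, so \<open>M^3 <= sqrt T\<close> is needed.\<close>
    have M_le: "real M ^ 6 \<le> T"
    proof -
      have "ln (real M ^ 6) \<le> ln T"
        using M X by (simp add: ln_realpow X_def)
      thus ?thesis using M T by simp
    qed
    have S: "finite S" "S \<noteq> {}" "\<And>m. m \<in> S \<Longrightarrow> 0 < m \<and> m \<le> M"
    proof -
      show "finite S" by (simp add: S_def primes_exp.finite_exponent_box)
      have "1 \<in> S" by (simp add: S_def exponent_box_def)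
      thus "S \<noteq> {}" by blast
      show "0 < m \<and> m \<le> M" if "m \<in> S" for m
        using that unfolding S_def M_def
        by (intro conjI primes_exp.exponent_box_le primes_exp.exponent_box_pos)
    qed
    have cardS: "0 < card S" "card S \<le> M"
    proof -
      show "0 < card S" using S by (simp add: card_gt_0_iff)
      have "S \<subseteq> {1..M}" using S(3) by force
      thus "card S \<le> M" using card_mono[of "{1..M}" S] by simp
    qed
    have h: "h > 0" "h \<le> 1 / 5" using X by (auto simp: h_def field_simps)
    have hMN: "h * ln (real (M * N)) \<le> 1"
    proof -
      have "ln (real (M * N)) = ln (real M) + ln (real N)"
        using M Npos by (simp add: ln_mult)
      also have "\<dots> \<le> 5 * X" using M(1) lnN(1) X by linarith
      finally show ?thesis using X by (simp add: h_def)
    qed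
    have J: "2 * real J * h \<le> T" "h * real J \<ge> T / 4" "J > 0"
    proof -
      have "real J \<le> T / (2 * h)" unfolding J_def using T h by simp
      thus "2 * real J * h \<le> T" using h by (simp add: field_simps)
      have "real J \<ge> T / (2 * h) - 1" unfolding J_def using T h by linarith
      hence "h * real J \<ge> h * (T / (2 * h) - 1)" using h by (intro mult_left_mono) auto
      also have "h * (T / (2 * h) - 1) = T / 2 - h" using h by (simp add: field_simps)
      finally show hJ: "h * real J \<ge> T / 4" using h T by linarith
      show "J > 0" using hJ T by (cases "J = 0") auto
    qed
    have Z: "norm (\<Sum>n=1..N. of_real (a n) * cis (- (t * ln (real n)))) \<le> Z" if "T \<le> t" "t \<le> T + 2 * real J * h" for t
      using rem[of T t N l] that J(1) T N l lnSN4 X by (simp add: log_poly_def a_def Z_def X_def)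
    have a0: "a n \<ge> 0" for n by (cases "n = 0") (auto simp: a_def)
    have res: "(\<Sum>n=1..N. a n * real (card {m\<in>S. m * n \<in> S}))
      \<le> real (card S) * (Z * (1 + eta * real (card S)) + eta * real (card S) * (\<Sum>n=1..N. a n))"
      unfolding eta_def
      by (rule resonance[OF S a0 h(1) hMN J(3) Npos Z])
    \<comment> \<open>The saving beyond \<open>1/T\<close> matters: the coefficients may sum to
      about \<open>5^l * T * 6X\<close>. Here \<open>1024 = 64 * 4^2\<close>, from
      \<open>h * J >= T/4\<close>.\<close>
    have delta: "eta * real (card S) \<le> 1024 / (T * sqrt T)"
    proof -
      have "eta \<le> 64 * real M ^ 2 / (T / 4) ^ 2"
        unfolding eta_def using J(2) T by (intro frac_le power_mono) auto
      also have "\<dots> = 1024 * real M ^ 2 / T ^ 2" by (simp add: power_divide)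
      finally have "eta * real (card S) \<le> 1024 * real M ^ 2 / T ^ 2 * real M"
        using cardS by (intro mult_mono) auto
      also have "\<dots> = 1024 * real M ^ 3 / T ^ 2" by (simp add: power3_eq_cube power2_eq_square)
      also have "\<dots> \<le> 1024 * sqrt T / T ^ 2"
      proof -
        have "(real M ^ 3) ^ 2 \<le> T" using M_le by (simp add: power_mult[symmetric])
        hence "real M ^ 3 \<le> sqrt T" by (rule real_le_rsqrt)
        thus ?thesis by (intro divide_right_mono mult_left_mono) auto
      qed
      also have "\<dots> = 1024 / (T * sqrt T)"
      proof -
        have "T ^ 2 = T * sqrt T * sqrt T" using T by (simp add: power2_eq_square mult.assoc)
        thus ?thesis using T by simp
      qed
      finally show ?thesis .
    qed
    have eta0: "0 \<le> eta * real (card S)" by (simp add: eta_def)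
    have delta': "eta * real (card S) \<le> 1024 / T"
    proof -
      have "1024 / (T * sqrt T) \<le> 1024 / T" using T by (intro divide_left_mono) auto
      thus ?thesis using delta by linarith
    qed
    have Xl: "(5 * X) ^ l \<le> 5 ^ l * T"
      using l(2) by (simp add: power_mult_distrib X_def)
    have sum_a: "(\<Sum>n=1..N. a n) \<le> 5 ^ l * T * (6 * X)"
    proof -
      have "(\<Sum>n=1..N. a n) \<le> (\<Sum>n=1..N. ln (real N) ^ l * (1 / real n))"
        by (intro sum_mono) (auto simp: a_def intro!: divide_right_mono power_mono)
      also have "\<dots> = ln (real N) ^ l * (\<Sum>n=1..N. 1 / real n)"
        by (simp add: sum_distrib_left)
      also have "\<dots> \<le> (5 * X) ^ l * (1 + ln (real N))"
        using lnN Npos X by (intro mult_mono power_mono sum_inverse_le sum_nonneg) auto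
      also have "\<dots> \<le> 5 ^ l * T * (6 * X)"
        using Xl lnN X T by (intro mult_mono) auto
      finally show ?thesis .
    qed
    \<comment> \<open>\<open>6144 = 1024 * 6\<close> explains the constant in the assumption
      \<open>6144 * ln T <= sqrt T\<close>.\<close>
    have err_sum: "eta * real (card S) * (\<Sum>n=1..N. a n) \<le> 5 ^ l"
    proof -
      have "eta * real (card S) * (\<Sum>n=1..N. a n) \<le> 1024 / (T * sqrt T) * (5 ^ l * T * (6 * X))"
        using delta sum_a eta0 T by (intro mult_mono sum_nonneg) (use a0 in auto)
      also have "\<dots> = 5 ^ l * (6144 * X / sqrt T)"
        using T by (simp add: field_simps)
      also have "\<dots> \<le> 5 ^ l * 1"
        using big T by (intro mult_left_mono) (auto simp: X_def divide_le_eq)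
      finally show ?thesis by simp
    qed
    \<comment> \<open>\<open>15 = 3 * 5\<close>: a factor \<open>e <= 3\<close> from the Cauchy
      circle and a factor 5 from \<open>ln (Suc N) <= 5X\<close>, for each derivative.\<close>
    have err_rem: "C0 * exp (real l + 1) * ln (real (Suc N)) ^ l / T \<le> 3 * C0 * 15 ^ l"
    proof -
      have "ln (real (Suc N)) ^ l \<le> 5 ^ l * T"
        using Xl lnSN lnSN4 X power_mono[of "ln (real (Suc N))" "5 * X" l] by linarith
      hence "C0 * exp (real l + 1) * ln (real (Suc N)) ^ l / T \<le> C0 * exp (real l + 1) * (5 ^ l * T) / T"
        using C0 T by (intro divide_right_mono mult_left_mono) auto
      also have "\<dots> = C0 * exp 1 ^ Suc l * 5 ^ l"
        using T exp_of_nat_mult[of "Suc l" "1::real"] by (simp add: add.commute)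
      also have "\<dots> \<le> C0 * 3 ^ Suc l * 5 ^ l"
        using C0 exp_le by (intro mult_right_mono mult_left_mono power_mono) auto
      also have "\<dots> = 3 * C0 * 15 ^ l"
        by (simp add: power_mult_distrib[symmetric])
      finally show ?thesis .
    qed
    have zm: "zeta_max l T \<ge> 0"
      using T by (intro zeta_max_nonneg) auto
    have "(1 - 2 / real k) * log_moment l ?P (exp (real k ^ 2)) * real (card S) \<le> (\<Sum>n=1..N. a n * real (card {m\<in>S. m * n \<in> S}))"
    proof -
      have "exp (real k ^ 2) \<le> exp (ln T)" using k(2) by simp
      hence "exp (real k ^ 2) \<le> real N" using T TT N(1) by simp
      thus ?thesis unfolding S_def a_def using k(1) by (intro log_moment_le_sum_card)
    qed
    with res have "(1 - 2 / real k) * log_moment l ?P (exp (real k ^ 2)) * real (card S)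
        \<le> (Z * (1 + eta * real (card S)) + eta * real (card S) * (\<Sum>n=1..N. a n)) * real (card S)"
      by (simp add: mult.commute)
    hence "(1 - 2 / real k) * log_moment l ?P (exp (real k ^ 2))
        \<le> Z * (1 + eta * real (card S)) + eta * real (card S) * (\<Sum>n=1..N. a n)"
      by (rule mult_right_le_imp_le) (use cardS in simp)
    also have "\<dots> \<le> (zeta_max l T + 3 * C0 * 15 ^ l) * (1 + 1024 / T) + 15 ^ l"
    proof (intro add_mono mult_mono)
      show "Z \<le> zeta_max l T + 3 * C0 * 15 ^ l" using err_rem by (simp add: Z_def)
      have "(5::real) ^ l \<le> 15 ^ l" by (intro power_mono) auto
      thus "eta * real (card S) * (\<Sum>n=1..N. a n) \<le> 15 ^ l" using err_sum by linarith
    qed (use delta' zm C0 eta0 in auto)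
    also have "\<dots> = zeta_max l T * (1 + 1024 / T) + (3 * C0 * (1 + 1024 / T) + 1) * 15 ^ l"
      by (simp add: algebra_simps)
    also have "\<dots> \<le> zeta_max l T * (1 + 1024 / T) + (387 * C0 + 1) * 15 ^ l"
    proof -
      have "1024 / T \<le> 128" using T by (simp add: divide_le_eq)
      hence "3 * C0 * (1 + 1024 / T) \<le> 3 * C0 * 129" using C0 by (intro mult_left_mono) auto
      thus ?thesis by (intro add_left_mono mult_right_mono) auto
    qed
    finally show ?thesis .
  qed
  thus ?thesis using C0 by (intro exI[of _ "387 * C0 + 1"]) auto
qed

lemma zeta_max_ge_eventually:
  assumes e: "0 < e" "e < 1 / 11"
  shows "\<forall>\<^sub>F T in at_top. \<forall>l::nat. real l \<le> ln T / ln (ln T) \<longrightarrow>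
     zeta_max l T \<ge> exp euler_mascheroni / (real l + 1) * ln (ln T) ^ (l + 1) * (1 - 5 * e)"
proof -
  \<comment> \<open>With \<open>L = ln (ln T)\<close>, subtracting \<open>4 ln L\<close> gives
    \<open>e^k <= ln T / L^4\<close>. This absorbs \<open>20 k^3\<close> with a factor
    \<open>L\<close> to spare, while \<open>k / L\<close> still tends to 1.\<close>
  define kk where "kk = (\<lambda>T::real. nat \<lfloor>ln (ln T) - 4 * ln (ln (ln T))\<rfloor>)"
  obtain C where C: "C > 0" and main: "\<And>T k l. T \<ge> 8 \<Longrightarrow> k \<ge> 2 \<Longrightarrow> real k ^ 2 \<le> ln T \<Longrightarrow> 20 * real k ^ 3 * exp (real k) \<le> ln T \<Longrightarrow>
     real l + 1 \<le> ln T \<Longrightarrow> ln T ^ l \<le> T \<Longrightarrow> 6144 * ln T \<le> sqrt T \<Longrightarrow>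
     (1 - 2 / real k) * log_moment l (primes_exp k) (exp (real k ^ 2)) \<le> zeta_max l T * (1 + 1024 / T) + C * 15 ^ l"
    using zeta_max_ge_log_moment by blast
  have kk_top: "filterlim kk at_top at_top"
    unfolding kk_def by real_asymp
  have "\<forall>\<^sub>F T in at_top. \<forall>l L. 0 \<le> L \<longrightarrow> (1 - e) * L \<le> real (kk T) \<longrightarrow>
    (1 - e)^2 * (exp euler_mascheroni / (real l + 1) * L ^ (l + 1)) \<le> log_moment l (primes_exp (kk T)) (exp (real (kk T) ^ 2))"
    using eventually_compose_filterlim[OF log_moment_asymp[OF e] kk_top] .
  moreover have "\<forall>\<^sub>F T in at_top. real (kk T) \<ge> 2 / e"
    by (rule eventually_compose_filterlim[OF _ kk_top]) real_asymp
  moreover have "\<forall>\<^sub>F T in at_top. kk T \<ge> 2"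
    using kk_top by (simp add: filterlim_at_top)
  moreover have "\<forall>\<^sub>F T in at_top. (1 - e) * ln (ln T) \<le> ln (ln T) - 4 * ln (ln (ln T)) - 1"
    using e by real_asymp
  moreover have "\<forall>\<^sub>F T in at_top. ln (ln T) ^ 2 \<le> ln (T::real)"
    by real_asymp
  moreover have "\<forall>\<^sub>F T in at_top. 20 / ln (ln T) \<le> (1::real)" "\<forall>\<^sub>F T in at_top. ln (ln T) \<ge> max 30 (C / e)"
    "\<forall>\<^sub>F T in at_top. ln (ln (ln T)) \<ge> (0::real)" "\<forall>\<^sub>F T in at_top. T \<ge> (8::real)" "\<forall>\<^sub>F T in at_top. ln T \<ge> (2::real)"
    "\<forall>\<^sub>F T in at_top. 6144 * ln T \<le> sqrt T" "\<forall>\<^sub>F T in at_top. 1024 / T \<le> e"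
    using e by real_asymp+
  ultimately show ?thesis
  proof eventually_elim
    case (elim T)
    define L where "L = ln (ln T)"
    define k where "k = kk T"
    have "max 30 (C / e) \<le> L" unfolding L_def using elim by blast
    hence L: "L \<ge> 30" "C / e \<le> L" by simp_all
    have ev: "20 / L \<le> 1" "(1 - e) * L \<le> L - 4 * ln L - 1" "ln L \<ge> 0" "L ^ 2 \<le> ln T"
        "ln T \<ge> 2" "T \<ge> 8" "6144 * ln T \<le> sqrt T" "1024 / T \<le> e"
        and k_pos: "real k \<ge> 2 / e" "k \<ge> 2"
      unfolding L_def k_def using elim by blast+
    have L0: "L > 0" using L by simp
    have kL: "real k \<le> L - 4 * ln L" "L - 4 * ln L - 1 \<le> real k"
    proof -
      have "(1 - e) * L \<ge> 0" using e L by simp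
      hence "L - 4 * ln L \<ge> 1" using ev(2) by linarith
      thus "real k \<le> L - 4 * ln L" "L - 4 * ln L - 1 \<le> real k"
        unfolding k_def kk_def L_def[symmetric] by linarith+
    qed
    have kL': "real k \<le> L" using kL ev(3) by linarith
    have lnT: "ln T \<ge> 2" "ln T = exp L" using ev(5) by (auto simp: L_def)
    show ?case
    proof (intro allI impI)
      fix l :: nat assume l: "real l \<le> ln T / ln (ln T)"
      let ?main = "exp euler_mascheroni / (real l + 1) * L ^ (l + 1)"
      have lL: "real l * L \<le> ln T" using l L0 by (simp add: L_def pos_le_divide_eq)
      have "real l * 2 \<le> real l * L" using L by (intro mult_left_mono) auto
      hence l1: "real l + 1 \<le> ln T" using lL lnT by linarith
      have l2: "ln T ^ l \<le> T"
      proof -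
        have "ln T ^ l = exp (real l * L)" unfolding lnT by (simp add: exp_of_nat_mult)
        also have "\<dots> \<le> exp (ln T)" using lL by simp
        also have "\<dots> = T" using ev(6) by simp
        finally show ?thesis .
      qed
      have k1: "real k ^ 2 \<le> ln T"
      proof -
        have "real k ^ 2 \<le> L ^ 2" using kL' by (intro power_mono) auto
        also note ev(4)
        finally show ?thesis .
      qed
      have k2: "20 * real k ^ 3 * exp (real k) \<le> ln T"
      proof -
        have "20 * real k ^ 3 * exp (real k) \<le> 20 * L ^ 3 * exp (L - 4 * ln L)"
          using kL kL' by (intro mult_mono power_mono) auto
        also have "exp (L - 4 * ln L) = ln T / L ^ 4"
        proof -
          have "exp (4 * ln L) = L ^ 4"
            using L0 exp_of_nat_mult[of 4 "ln L"] by simp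
          thus ?thesis by (simp add: exp_diff lnT(2))
        qed
        also have "20 * L ^ 3 * (ln T / L ^ 4) = 20 / L * ln T"
          using L0 by (simp add: power_eq_if field_simps)
        also have "\<dots> \<le> 1 * ln T"
          using ev(1) lnT(1) by (intro mult_right_mono) linarith+
        finally show ?thesis by simp
      qed
      have main_pos: "?main \<ge> 0" using L0 by simp
      have kL2: "(1 - e) * L \<le> real k" using ev(2) kL by linarith
      have "2 / real k \<le> e" using k_pos e by (simp add: field_simps)
      hence "(1 - e) * ((1 - e)^2 * ?main) \<le> (1 - 2 / real k) * log_moment l (primes_exp k) (exp (real k ^ 2))"
      proof (intro mult_mono)
        show "(1 - e)^2 * ?main \<le> log_moment l (primes_exp k) (exp (real k ^ 2))"
          using elim(1) kL2 L0 unfolding k_def by (meson less_imp_le)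
        show "0 \<le> 1 - 2 / real k" using \<open>2 / real k \<le> e\<close> e by linarith
        show "0 \<le> (1 - e)^2 * ?main" using L0 by simp
      qed linarith
      also have "\<dots> \<le> zeta_max l T * (1 + 1024 / T) + C * 15 ^ l"
        by (intro main ev k_pos k1 k2 l1 l2)
      \<comment> \<open>The denominator \<open>l + 1 <= 2^l\<close> turns \<open>15^l\<close> into
        \<open>30^l <= L^l\<close>. The one remaining factor \<open>L >= C/e\<close> of the main
        term makes the error small uniformly in \<open>l\<close>.\<close>
      also have "C * 15 ^ l \<le> e * ?main"
      proof -
        have "Suc l \<le> 2 ^ l" by (rule Suc_leI[OF less_exp])
        hence "real (Suc l) \<le> real (2 ^ l)" by (simp only: of_nat_le_iff)
        hence "real l + 1 \<le> 2 ^ l" by simp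
        hence "15 ^ l * (real l + 1) \<le> 15 ^ l * 2 ^ l" by (intro mult_left_mono) auto
        also have "\<dots> = 30 ^ l" by (simp add: power_mult_distrib[symmetric])
        also have "\<dots> \<le> L ^ l" using L by (intro power_mono) auto
        finally have "15 ^ l \<le> L ^ l / (real l + 1)" by (simp add: pos_le_divide_eq)
        hence "C * 15 ^ l \<le> e * L * (L ^ l / (real l + 1))"
          using L e C by (intro mult_mono) (auto simp: field_simps)
        also have "\<dots> \<le> e * L * (exp euler_mascheroni * L ^ l / (real l + 1))"
        proof -
          have "(1::real) \<le> exp euler_mascheroni"
            using euler_mascheroni_pos by simp
          hence "1 * L ^ l \<le> exp euler_mascheroni * L ^ l" using L0 by (intro mult_right_mono) auto
          thus ?thesis using e L0 by (intro mult_left_mono divide_right_mono) auto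
        qed
        finally show ?thesis by (simp add: mult_ac)
      qed
      finally have 1: "(1 - e) ^ 3 * ?main \<le> zeta_max l T * (1 + 1024 / T) + e * ?main"
        by (simp add: power3_eq_cube power2_eq_square mult.assoc)
      have zm: "zeta_max l T \<ge> 0"
        using ev(6) by (intro zeta_max_nonneg) auto
      have 2: "zeta_max l T * (1 + 1024 / T) \<le> zeta_max l T * (1 + e)"
        using ev(8) zm by (intro mult_left_mono) auto
      \<comment> \<open>To first order \<open>5e = 3e + e + e\<close>: three factors
        \<open>1 - e\<close>, the additive error \<open>e\<close>, and the factor
        \<open>1 + e\<close> on the side of \<open>zeta_max\<close>.\<close>
      have "(1 - 5 * e) * (1 + e) + e \<le> (1 - e) ^ 3"
      proof -
        have "(1 - e) ^ 3 - ((1 - 5 * e) * (1 + e) + e) = e ^ 2 * (8 - e)"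
          by (simp add: power2_eq_square power3_eq_cube algebra_simps)
        moreover have "e ^ 2 * (8 - e) \<ge> 0" using e by simp
        ultimately show ?thesis by linarith
      qed
      hence 3: "((1 - 5 * e) * (1 + e) + e) * ?main \<le> (1 - e) ^ 3 * ?main"
        using main_pos by (intro mult_right_mono)
      have "x * (1 - 5 * e) * (1 + e) \<le> c"
        if "((1 - 5 * e) * (1 + e) + e) * x \<le> a" "a \<le> b + e * x" "b \<le> c" for a b c x :: real
      proof -
        have "x * (1 - 5 * e) * (1 + e) = ((1 - 5 * e) * (1 + e) + e) * x - e * x"
          by (simp add: algebra_simps)
        thus ?thesis using that by linarith
      qed
      from this[OF 3 1 2] have "?main * (1 - 5 * e) * (1 + e) \<le> zeta_max l T * (1 + e)" .
      hence "?main * (1 - 5 * e) \<le> zeta_max l T"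
        by (rule mult_right_le_imp_le) (use e in simp)
      thus "zeta_max l T \<ge> exp euler_mascheroni / (real l + 1) * ln (ln T) ^ (l + 1) * (1 - 5 * e)"
        by (simp add: L_def)
    qed
  qed
qed

theorem theorem1p1:
  shows "\<exists>R :: real \<Rightarrow> real. (R \<longlongrightarrow> 0) at_top \<and>
    (\<forall>\<^sub>F T in at_top. \<forall>l :: nat. real l \<le> ln T / ln (ln T) \<longrightarrow>
       zeta_max l T \<ge> exp euler_mascheroni / (real l + 1) * ln (ln T) ^ (l + 1) * (1 + R T))"
proof -
  define A where "A = (\<lambda>T::real. {l::nat. real l \<le> ln T / ln (ln T)})"
  define m where "m = (\<lambda>(l::nat) T::real. exp euler_mascheroni / (real l + 1) * ln (ln T) ^ (l + 1))"
  \<comment> \<open>The worst relative error over the finitely many admissible \<open>l\<close>, so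
    that a single function serves all of them. Inserting 0 keeps the set nonempty and forces
    \<open>R T <= 0\<close>, which leaves only the lower bound for the limit.\<close>
  define R where "R = (\<lambda>T. Min (insert 0 ((\<lambda>l. zeta_max l T / m l T - 1) ` A T)))"
  have fin: "finite (A T)" for T
    unfolding A_def by (rule finite_subset[of _ "{..nat \<lfloor>ln T / ln (ln T)\<rfloor>}"]) (auto simp: le_nat_iff le_floor_iff)
  have m_pos: "\<forall>\<^sub>F T in at_top. \<forall>l. m l T > 0"
  proof -
    have "\<forall>\<^sub>F T in at_top. ln (ln T) > (0::real)" by real_asymp
    thus ?thesis by eventually_elim (simp add: m_def)
  qed
  have "(R \<longlongrightarrow> 0) at_top"
  proof (rule order_tendstoI)
    fix x :: real assume "x < 0"
    define e where "e = min (1 / 12) (- x / 6)"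
    have e: "0 < e" "e < 1 / 11" "x < - 5 * e" using \<open>x < 0\<close> by (auto simp: e_def min_def)
    show "\<forall>\<^sub>F T in at_top. x < R T"
      using zeta_max_ge_eventually[OF e(1,2)] m_pos
    proof eventually_elim
      case (elim T)
      have "x < zeta_max l T / m l T - 1" if "l \<in> A T" for l
      proof -
        have "m l T * (1 - 5 * e) \<le> zeta_max l T" using elim(1) that by (simp add: A_def m_def)
        hence "1 - 5 * e \<le> zeta_max l T / m l T" using elim(2) by (simp add: pos_le_divide_eq mult.commute)
        thus ?thesis using e(3) by linarith
      qed
      thus ?case unfolding R_def using fin[of T] \<open>x < 0\<close> by (subst Min_gr_iff) auto
    qed
  next
    fix x :: real assume "x > 0"
    have "R T \<le> 0" for T unfolding R_def using fin[of T] by (intro Min_le) auto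
    hence "R T < x" for T using \<open>x > 0\<close> by (rule le_less_trans)
    thus "\<forall>\<^sub>F T in at_top. R T < x" by (intro always_eventually allI)
  qed
  moreover have "\<forall>\<^sub>F T in at_top. \<forall>l :: nat. real l \<le> ln T / ln (ln T) \<longrightarrow>
       zeta_max l T \<ge> exp euler_mascheroni / (real l + 1) * ln (ln T) ^ (l + 1) * (1 + R T)"
    using m_pos
  proof eventually_elim
    case (elim T)
    show ?case
    proof (intro allI impI)
      fix l :: nat assume "real l \<le> ln T / ln (ln T)"
      hence "l \<in> A T" by (simp add: A_def)
      hence "R T \<le> zeta_max l T / m l T - 1"
        unfolding R_def using fin[of T] by (intro Min_le finite.insertI finite_imageI insertI2 imageI)
      hence "m l T * (1 + R T) \<le> m l T * (zeta_max l T / m l T)"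
        using elim by (intro mult_left_mono) (auto intro: less_imp_le)
      also have "\<dots> = zeta_max l T" using elim[rule_format, of l] by simp
      finally show "zeta_max l T \<ge> exp euler_mascheroni / (real l + 1) * ln (ln T) ^ (l + 1) * (1 + R T)"
        by (simp add: m_def)
    qed
  qed
  ultimately show ?thesis by blast
qed

end
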